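(* The upper bound $\operatorname{cp}(\Gamma)\le \frac{m+1}{2}$ for the complexity of interior reduced, connected labeled oriented graphs $\Gamma$ with $m$ vertices is sharp. In particular, if an interior reduced labeled oriented tree (LOT) $\Gamma$ with $m$ vertices satisfies this bound with equality, i.e. $\operatorname{cp}(\Gamma)=\frac{m+1}{2}$, then its corresponding 2-complex is aspherical.
   Context: A labeled oriented graph (LOG) $\Gamma$ is a finite oriented graph with vertex set $V(\Gamma)$ and edge set $E(\Gamma)$, together with a labeling function $l: E(\Gamma)\to V(\Gamma)$. The underlying undirected graph is assumed to be simple: no vertex is adjacent to itself, and any two vertices are joined by at most one edge. "Connected" refers to the underlying undirected graph. A labeled oriented tree (LOT) is a LOG whose underlying undirected graph is a tree. A LOG is interior reduced if for every edge $e$ with endpoints $x,y$ one has $l(e)\notin\{x,y\}$. For $S\subseteq V(\Gamma)$, the set $T_S\subseteq V(\Gamma)$ of vertices reachable from $S$ is the smallest set such that (1) $S\subseteq T_S$, and (2) if $e$ is an edge with endpoints $x$ and $y$ (in either orientation) and both $y\in T_S$ and $l(e)\in T_S$, then $x\in T_S$. One says that $\Gamma$ is reachable from $S$ if $T_S=V(\Gamma)$. The complexity $\operatorname{cp}(\Gamma)$ is the minimum of $|S|$ over all $S\subseteq V(\Gamma)$ such that $\Gamma$ is reachable from $S$. A LOG $\Gamma$ with vertices $x_1,\dots,x_n$ yields a group presentation $P(\Gamma)$ with generators $x_1,\dots,x_n$ and, for every edge $e$ directed from $x_i$ to $x_j$ with label $l(e)=x_k$, one relation $x_kx_ix_k^{-1}=x_j$.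 The 2-complex corresponding to $\Gamma$ is the standard 2-complex $C(P(\Gamma))$ of this presentation: it has one 0-cell, one 1-cell for each generator, and for each relation $x_kx_ix_k^{-1}=x_j$ one 2-cell attached along the word $x_kx_ix_k^{-1}x_j^{-1}$. A 2-complex $C$ is aspherical if its second homotopy group $\pi_2(C)$ is trivial. *)

theory Defs
  imports
    "Graph_Theory.Digraph_Component"
    "HOL-Algebra.Elementary_Groups"
    "HOL-Analysis.Analysis"
begin

section \<open>Labeled oriented graphs\<close>

locale labeled_oriented_graph = fin_digraph G + loopfree_digraph G
  for G :: "('v, 'e) pre_digraph" +
  fixes l :: "'e \<Rightarrow> 'v"
  assumes simple: "\<lbrakk>e1 \<in> arcs G; e2 \<in> arcs G;
      {tail G e1, head G e1} = {tail G e2, head G e2}\<rbrakk> \<Longrightarrow> e1 = e2"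
    and label_in_verts: "e \<in> arcs G \<Longrightarrow> l e \<in> verts G"

text \<open>
  The library predicate \<open>tree\<close> only forbids directed cycles.  A cycle of the underlying
  undirected simple graph is a cycle of the symmetric closure that is not of the form \<open>x, y, x\<close>.
\<close>

definition undirected_tree :: "('v, 'e) pre_digraph \<Rightarrow> bool" where
  "undirected_tree G \<longleftrightarrow> Digraph_Component.connected G \<and>
     \<not> (\<exists>p. pre_digraph.cycle (with_proj (mk_symmetric G)) p \<and> 3 \<le> length p)"

locale labeled_oriented_tree = labeled_oriented_graph +
  assumes tree: "undirected_tree G"

definition interior_reduced :: "('v, 'e) pre_digraph \<Rightarrow> ('e \<Rightarrow> 'v) \<Rightarrow> bool" where
  "interior_reduced G l \<longleftrightarrow> (\<forall>e \<in> arcs G. l e \<notin> {tail G e, head G e})"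

inductive_set reachable_from ::
    "('v, 'e) pre_digraph \<Rightarrow> ('e \<Rightarrow> 'v) \<Rightarrow> 'v set \<Rightarrow> 'v set"
  for G :: "('v, 'e) pre_digraph" and l :: "'e \<Rightarrow> 'v" and S :: "'v set" where
  base: "x \<in> S \<Longrightarrow> x \<in> reachable_from G l S"
| forward: "\<lbrakk>e \<in> arcs G; tail G e \<in> reachable_from G l S; l e \<in> reachable_from G l S\<rbrakk>
    \<Longrightarrow> head G e \<in> reachable_from G l S"
| backward: "\<lbrakk>e \<in> arcs G; head G e \<in> reachable_from G l S; l e \<in> reachable_from G l S\<rbrakk>
    \<Longrightarrow> tail G e \<in> reachable_from G l S"

definition complexity :: "('v, 'e) pre_digraph \<Rightarrow> ('e \<Rightarrow> 'v) \<Rightarrow> nat" where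
  "complexity G l = Min (card ` {S. S \<subseteq> verts G \<and> reachable_from G l S = verts G})"


section \<open>Standard 2-complexes of group presentations\<close>

text \<open>
  A word is a list of letters; \<open>(g, True)\<close> stands for the generator \<open>g\<close> and
  \<open>(g, False)\<close> for its inverse.  Relators form an indexed family, so that equal words may attach distinct 2-cells.
\<close>

type_synonym 'g word = "('g \<times> bool) list"

record ('g, 'r) presentation =
  gens :: "'g set"
  rels :: "'r set"
  relator :: "'r \<Rightarrow> 'g word"

text \<open>
  Each point of the 2-complex lies in exactly one open cell: the 0-cell, an open 1-cell
  parametrised by \<open>{0<..<1}\<close>, or an open 2-cell parametrised by the open unit disc.
\<close>

datatype ('g, 'r) cell_point = Pt0 | Pt1 'g real | Pt2 'r complex

fun char_map1 :: "'g \<Rightarrow> real \<Rightarrow> ('g, 'r) cell_point" where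
  "char_map1 g t = (if 0 < t \<and> t < 1 then Pt1 g t else Pt0)"

fun letter_path :: "'g \<times> bool \<Rightarrow> real \<Rightarrow> ('g, 'r) cell_point" where
  "letter_path (g, b) t = char_map1 g (if b then t else 1 - t)"

text \<open>The letters of \<open>w\<close> are traversed one after the other, each in time \<open>1 / length w\<close>.\<close>

definition word_path :: "'g word \<Rightarrow> real \<Rightarrow> ('g, 'r) cell_point" where
  "word_path w s =
     (let u = real (length w) * s; i = nat \<lfloor>u\<rfloor>
      in if i < length w then letter_path (w ! i) (u - real i) else Pt0)"

definition char_map2 :: "('g, 'r) presentation \<Rightarrow> 'r \<Rightarrow> complex \<Rightarrow> ('g, 'r) cell_point" where
  "char_map2 P r z =
     (if norm z < 1 then Pt2 r z else word_path (relator P r) (Arg2pi z / (2 * pi)))"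

definition complex_points :: "('g, 'r) presentation \<Rightarrow> ('g, 'r) cell_point set" where
  "complex_points P =
     {Pt0} \<union> {Pt1 g t |g t. g \<in> gens P \<and> 0 < t \<and> t < 1} \<union> {Pt2 r z |r z. r \<in> rels P \<and> norm z < 1}"

text \<open>The weak topology: the final topology with respect to all characteristic maps.\<close>

definition complex_open :: "('g, 'r) presentation \<Rightarrow> ('g, 'r) cell_point set \<Rightarrow> bool" where
  "complex_open P U \<longleftrightarrow> U \<subseteq> complex_points P \<and>
     (\<forall>g \<in> gens P. openin (top_of_set {0..1}) ({0..1} \<inter> char_map1 g -` U)) \<and>
     (\<forall>r \<in> rels P. openin (top_of_set (cball 0 1)) (cball 0 1 \<inter> char_map2 P r -` U))"

definition standard_complex :: "('g, 'r) presentation \<Rightarrow> ('g, 'r) cell_point topology" where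
  "standard_complex P = topology (complex_open P)"

lemma istopology_complex_open: "istopology (complex_open P)"
proof -
  have inter: "complex_open P (S \<inter> T)" if S: "complex_open P S" and T: "complex_open P T" for S T
  proof -
    have 1: "A \<inter> f -` (S \<inter> T) = (A \<inter> f -` S) \<inter> (A \<inter> f -` T)"
      for A :: "'x set" and f :: "'x \<Rightarrow> ('a, 'b) cell_point"
      by auto
    show ?thesis
      using S T unfolding complex_open_def 1 by (blast intro: openin_Int)
  qed
  have union: "complex_open P (\<Union>\<K>)" if K: "\<forall>K\<in>\<K>. complex_open P K" for \<K>
  proof -
    have 1: "A \<inter> f -` \<Union>\<K> = \<Union>((\<lambda>K. A \<inter> f -` K) ` \<K>)"
      for A :: "'x set" and f :: "'x \<Rightarrow> ('a, 'b) cell_point"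
      by auto
    show ?thesis
      using K unfolding complex_open_def 1 by (fastforce intro!: openin_Union)
  qed
  show ?thesis
    unfolding istopology_def using inter union by blast
qed

lemma openin_standard_complex: "openin (standard_complex P) U \<longleftrightarrow> complex_open P U"
  by (simp add: standard_complex_def istopology_complex_open topology_inverse')


section \<open>The second homotopy group\<close>

abbreviation unit_square :: "(real \<times> real) set" where
  "unit_square \<equiv> {0..1} \<times> {0..1}"

definition spheroids :: "'a topology \<Rightarrow> 'a \<Rightarrow> (real \<times> real \<Rightarrow> 'a) set" where
  "spheroids X x =
     {f. continuous_map (top_of_set unit_square) X f \<and> (\<forall>p \<in> frontier unit_square. f p = x)}"

definition spheroid_homotopy ::
    "'a topology \<Rightarrow> 'a \<Rightarrow> ((real \<times> real \<Rightarrow> 'a) \<times> (real \<times> real \<Rightarrow> 'a)) set" where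
  "spheroid_homotopy X x = {(f, g). f \<in> spheroids X x \<and> g \<in> spheroids X x \<and>
     homotopic_with (\<lambda>h. \<forall>p \<in> frontier unit_square. h p = x) (top_of_set unit_square) X f g}"

definition spheroid_join ::
    "(real \<times> real \<Rightarrow> 'a) \<Rightarrow> (real \<times> real \<Rightarrow> 'a) \<Rightarrow> real \<times> real \<Rightarrow> 'a" where
  "spheroid_join f g = (\<lambda>(s, t). if s \<le> 1 / 2 then f (2 * s, t) else g (2 * s - 1, t))"

definition pi2 :: "'a topology \<Rightarrow> 'a \<Rightarrow> (real \<times> real \<Rightarrow> 'a) set monoid" where
  "pi2 X x = \<lparr>
     carrier = spheroids X x // spheroid_homotopy X x,
     mult = (\<lambda>A B. \<Union>f\<in>A. \<Union>g\<in>B. spheroid_homotopy X x `` {spheroid_join f g}),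
     one = spheroid_homotopy X x `` {\<lambda>_. x}\<rparr>"

text \<open>The complex is path connected, so the base point may be taken to be the 0-cell.\<close>

definition aspherical :: "('g, 'r) presentation \<Rightarrow> bool" where
  "aspherical P \<longleftrightarrow> trivial_group (pi2 (standard_complex P) Pt0)"


section \<open>The presentation of a labeled oriented graph\<close>

definition log_presentation ::
    "('v, 'e) pre_digraph \<Rightarrow> ('e \<Rightarrow> 'v) \<Rightarrow> ('v, 'e) presentation" where
  "log_presentation G l = \<lparr>
     gens = verts G,
     rels = arcs G,
     relator = (\<lambda>e. [(l e, True), (tail G e, True), (l e, False), (head G e, False)])\<rparr>"

end

theory Submission
  imports Defs "HOL-Library.Sublist"
begin

text \<open>
  The bound: starting from a single vertex, a reachable set \<open>T\<close> that is not everything has an edge leaving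
  it; the label of that edge is neither in \<open>T\<close> nor an endpoint, so adding it to the generating set
  enlarges the reachable set by at least two vertices.

  Equality forces every greedy step to gain exactly two vertices.  Hence the endpoints and the label of an
  edge form a closed triple, each triple carries exactly two edges of the tree, and the triples fit together
  like the edges of a tree.  Consider the infinite cyclic cover of the 2-complex given by the map to the
  circle that sends every generator to the fundamental loop.  Within a triple, the two 2-cells can be
  collapsed level by level from the top or from the bottom, and because the triples are arranged in a tree,
  every finite subcomplex of the cover collapses to a graph.  A spheroid lifts to the cover, has compact
  image, and is therefore homotopic to a map into a graph, which lifts further to the Cayley tree of a free
  group and is contracted there.
\<close>

section \<open>Reachability and complexity\<close>

text \<open>Why the cyclic cover: in the complex itself no generator of a triple is free. The label
  of an arc occurs twice in its relator, and two partner arcs, say with ends \<open>x\<close>,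
  \<open>y\<close> and label \<open>z\<close>, and with ends \<open>y\<close>, \<open>z\<close> and
  label \<open>x\<close>, both involve all three generators. In the cover the cells acquire levels,
  and since only finitely many of them matter, a topmost or lowest one can have an edge that no
  other cell touches.

  No covering space is built. A point of the cyclic cover is a pair of a point of the complex and a
  real number lifting its value under \<open>circle_map\<close>; a point of the Cayley tree is a
  real-valued function on words. The two lifts of the square come from a continuous logarithm and
  from a subdivision into small squares. The real number is kept in the second lift as well:
  relative to a vertex of known level it shows in which direction an edge is entered, and
  neighbouring vertices of the tree always have different levels.\<close>

context labeled_oriented_graph
begin

abbreviation reach :: "'v set \<Rightarrow> 'v set" where
  "reach S \<equiv> reachable_from G l S"

lemma reach_increasing: "S \<subseteq> reach S"
  by (auto intro: reachable_from.base)

lemma reach_least: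
  assumes "S \<subseteq> reach T"
  shows "reach S \<subseteq> reach T"
proof
  fix x assume "x \<in> reach S"
  then show "x \<in> reach T"
    by induction (use assms in \<open>auto intro: reachable_from.intros\<close>)
qed

lemma reach_mono: "S \<subseteq> T \<Longrightarrow> reach S \<subseteq> reach T"
  using reach_least[of S T] reach_increasing[of T] by simp

lemma reach_subset_verts:
  assumes "S \<subseteq> verts G"
  shows "reach S \<subseteq> verts G"
proof
  fix x assume "x \<in> reach S"
  then show "x \<in> verts G"
    by induction (use assms in auto)
qed

lemma reach_step:
  assumes "e \<in> arcs G" "{tail G e, head G e} = {x, y}" "y \<in> reach S" "l e \<in> reach S"
  shows "x \<in> reach S"
  using assms by (auto simp: doubleton_eq_iff intro: reachable_from.intros)

lemma boundary_arc:
  assumes con: "Digraph_Component.connected G"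
    and T: "T \<subseteq> verts G" "T \<noteq> {}" "T \<noteq> verts G"
  obtains e p q where "e \<in> arcs G" "{tail G e, head G e} = {p, q}" "p \<in> T" "q \<in> verts G - T"
proof -
  obtain u v where uv: "u \<in> T" "v \<in> verts G" "v \<notin> T" using T by blast
  have "u \<rightarrow>\<^sup>*\<^bsub>with_proj (mk_symmetric G)\<^esub> v"
    using con uv T unfolding Digraph_Component.connected_def strongly_connected_def by auto
  then have "(u, v) \<in> (arcs_ends (with_proj (mk_symmetric G)))\<^sup>*"
    unfolding reachable_def by (rule rtrancl_on_rtranclI)
  then have "v \<notin> T \<longrightarrow> (\<exists>a b. (a, b) \<in> arcs_ends (with_proj (mk_symmetric G)) \<and> a \<in> T \<and> b \<notin> T)"
    by induction (use uv in auto)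
  then obtain a b where ab: "(a, b) \<in> arcs_ends (with_proj (mk_symmetric G))" "a \<in> T" "b \<notin> T"
    using uv by blast
  then have "(a, b) \<in> parcs (mk_symmetric G)"
    by (simp add: arcs_ends_conv)
  then obtain e where "e \<in> arcs G" "{tail G e, head G e} = {a, b}"
    by (auto simp: parcs_mk_symmetric)
  then show thesis
    using that[of e a b] ab head_in_verts tail_in_verts by (auto simp: doubleton_eq_iff)
qed

lemma complexity_le:
  assumes "S \<subseteq> verts G" "reach S = verts G"
  shows "complexity G l \<le> card S"
proof -
  have "finite (card ` {S. S \<subseteq> verts G \<and> reach S = verts G})"
    using finite_verts by auto
  then show ?thesis
    unfolding complexity_def using assms by (intro Min_le) auto
qed

lemma complexity_attained:
  obtains S where "S \<subseteq> verts G" "reach S = verts G" "card S = complexity G l"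
proof -
  have "finite (card ` {S. S \<subseteq> verts G \<and> reach S = verts G})"
    using finite_verts by auto
  moreover have "verts G \<in> {S. S \<subseteq> verts G \<and> reach S = verts G}"
    using reach_subset_verts[of "verts G"] reach_increasing[of "verts G"] by auto
  ultimately have "complexity G l \<in> card ` {S. S \<subseteq> verts G \<and> reach S = verts G}"
    unfolding complexity_def by (intro Min_in) auto
  then show thesis using that by auto
qed

lemma label_of_boundary_arc:
  assumes "interior_reduced G l" "e \<in> arcs G" "{tail G e, head G e} = {p, q}"
    and "p \<in> reach S" "q \<notin> reach S"
  shows "l e \<notin> reach S" "l e \<noteq> q" "reach S \<union> {q, l e} \<subseteq> reach (insert (l e) S)"
proof -
  show 1: "l e \<notin> reach S"
    using assms reach_step[of e q p S] by (auto simp: insert_commute)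
  show "l e \<noteq> q"
  proof -
    have "l e \<notin> {p, q}"
      using assms(1,2) unfolding interior_reduced_def assms(3)[symmetric] by simp
    then show ?thesis by simp
  qed
  have "reach S \<subseteq> reach (insert (l e) S)" "l e \<in> reach (insert (l e) S)"
    using reach_mono[of S "insert (l e) S"] by (auto intro: reachable_from.base)
  then show "reach S \<union> {q, l e} \<subseteq> reach (insert (l e) S)"
    using assms reach_step[of e q p "insert (l e) S"] by (auto simp: insert_commute)
qed

text \<open>Adding the label of a boundary arc raises \<open>2 * card S\<close> by two and
  \<open>card (reach S)\<close> by at least two, so their difference never grows. Once everything is
  reached, \<open>complexity G l \<le> card S\<close> turns this into the bound.\<close>

lemma greedy_bound:
  assumes ir: "interior_reduced G l" and con: "Digraph_Component.connected G"
    and "S \<subseteq> verts G" "S \<noteq> {}"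
  shows "2 * complexity G l + card (reach S) \<le> 2 * card S + card (verts G)"
  using assms(3,4)
proof (induction "card (verts G) - card (reach S)" arbitrary: S rule: less_induct)
  case less
  have sub: "reach S \<subseteq> verts G" using reach_subset_verts less by blast
  show ?case
  proof (cases "reach S = verts G")
    case True
    then show ?thesis using complexity_le[of S] less by simp
  next
    case False
    have "reach S \<noteq> {}" using less(3) reach_increasing[of S] by auto
    then obtain e p q where e: "e \<in> arcs G" "{tail G e, head G e} = {p, q}" "p \<in> reach S" "q \<in> verts G - reach S"
      using boundary_arc[OF con sub _ False] by metis
    let ?S = "insert (l e) S"
    have lab: "l e \<notin> reach S" "l e \<noteq> q" "reach S \<union> {q, l e} \<subseteq> reach ?S"
      using label_of_boundary_arc[OF ir e(1,2,3)] e by auto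
    have S: "?S \<subseteq> verts G" using less label_in_verts e by auto
    have fin: "finite (reach S)" "finite (reach ?S)" "finite S"
      using finite_verts reach_subset_verts S less finite_subset by metis+
    have "card (reach S \<union> {q, l e}) = card (reach S) + 2"
      using fin lab e by auto
    then have two: "card (reach S) + 2 \<le> card (reach ?S)"
      using card_mono[OF fin(2) lab(3)] by simp
    have "card (reach ?S) \<le> card (verts G)"
      using card_mono[OF finite_verts reach_subset_verts[OF S]] .
    then have "2 * complexity G l + card (reach ?S) \<le> 2 * card ?S + card (verts G)"
      using less(1)[OF _ S] two by simp
    then show ?thesis
      using two fin card_insert_le_m1[of "card S + 1" S "l e"] by (simp add: card_insert_if split: if_splits)
  qed
qed

lemma complexity_upper_bound:
  assumes "interior_reduced G l" "Digraph_Component.connected G"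
  shows "2 * complexity G l \<le> card (verts G) + 1"
proof -
  obtain x where x: "x \<in> verts G"
    using assms unfolding Digraph_Component.connected_def strongly_connected_def by auto
  have "finite (reach {x})" using finite_subset[OF reach_subset_verts finite_verts, of "{x}"] x by simp
  moreover have "x \<in> reach {x}" by (auto intro: reachable_from.base)
  ultimately have "card (reach {x}) \<ge> 1"
    by (metis One_nat_def Suc_leI card_gt_0_iff empty_iff)
  then show ?thesis
    using greedy_bound[OF assms, of "{x}"] x by simp
qed

definition triple :: "'e \<Rightarrow> 'v set" where
  "triple e = {tail G e, head G e, l e}"

lemma card_triple: "interior_reduced G l \<Longrightarrow> e \<in> arcs G \<Longrightarrow> card (triple e) = 3"
  using no_loops[of e] unfolding interior_reduced_def triple_def by auto

lemma triple_subset_verts: "e \<in> arcs G \<Longrightarrow> triple e \<subseteq> verts G"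
  using label_in_verts unfolding triple_def by auto

end

section \<open>Graphs that meet the bound with equality, and their triples\<close>

locale extremal_log = labeled_oriented_graph +
  assumes ir: "interior_reduced G l" and con: "Digraph_Component.connected G"
    and extremal: "2 * complexity G l = card (verts G) + 1"
begin

text \<open>Equality exhausts the slack of \<open>greedy_bound\<close> for every starting set, not
  just for those of a greedy run. The value of the complexity enters the structure theory only
  through this estimate.\<close>

lemma card_reach_le:
  assumes "S \<subseteq> verts G" "S \<noteq> {}"
  shows "card (reach S) + 1 \<le> 2 * card S"
  using greedy_bound[OF ir con assms] extremal by linarith

lemma finite_reach: "S \<subseteq> verts G \<Longrightarrow> finite (reach S)"
  using finite_subset[OF reach_subset_verts finite_verts] .

text \<open>Two vertices reach at most three by \<open>card_reach_le\<close>, and an endpoint with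
  the label already reaches the three of the triple.\<close>

lemma reach_endpoint_label:
  assumes "e \<in> arcs G" "x \<in> {tail G e, head G e}"
  shows "reach {x, l e} = triple e"
proof -
  have sub: "{x, l e} \<subseteq> verts G" using assms label_in_verts by auto
  have "triple e \<subseteq> reach {x, l e}"
    using assms reach_step[of e] unfolding triple_def
    by (auto intro: reachable_from.intros)
  moreover have "card (reach {x, l e}) \<le> card (triple e)"
    using card_reach_le[OF sub] card_triple[OF ir assms(1)] card_insert_le_m1[of 2 "{l e}" x] by auto
  ultimately show ?thesis
    using card_seteq[OF finite_reach[OF sub]] by metis
qed

lemma reach_triple: "e \<in> arcs G \<Longrightarrow> reach (triple e) = triple e"
  using reach_endpoint_label[of e "tail G e"] reach_least[of "triple e" "{tail G e, l e}"]
    reach_increasing[of "triple e"] by auto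

text \<open>The sets produced by the greedy procedure; they meet the bound of \<open>card_reach_le\<close> with equality.\<close>

definition tight :: "'a set \<Rightarrow> bool" where
  "tight T \<longleftrightarrow> (\<exists>S. S \<subseteq> verts G \<and> S \<noteq> {} \<and> reach S = T \<and> card T + 1 = 2 * card S)"

lemma tight_singleton:
  assumes "x \<in> verts G"
  shows "tight {x}"
proof -
  have "card (reach {x}) \<le> card {x}"
    using card_reach_le[of "{x}"] assms by simp
  then have "reach {x} = {x}"
    using card_seteq[of "reach {x}" "{x}"] finite_reach[of "{x}"] assms reach_increasing[of "{x}"] by simp
  then show ?thesis
    unfolding tight_def using assms by (intro exI[of _ "{x}"]) auto
qed

lemma tight_closed: "tight T \<Longrightarrow> S \<subseteq> T \<Longrightarrow> reach S \<subseteq> T"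
  unfolding tight_def using reach_least[of S] by auto

lemma tight_subset_verts: "tight T \<Longrightarrow> T \<subseteq> verts G"
  unfolding tight_def using reach_subset_verts by auto

text \<open>The gain of at least two from \<open>label_of_boundary_arc\<close> meets the upper limit
  from \<open>card_reach_le\<close>, so the new reachable set consists of \<open>T\<close>,
  \<open>q\<close> and \<open>l e\<close> and nothing else.\<close>

lemma tight_step:
  assumes "tight T" "e \<in> arcs G" "{tail G e, head G e} = {p, q}" "p \<in> T" "q \<notin> T"
  shows "l e \<notin> T" "l e \<noteq> q" "tight (T \<union> {q, l e})"
proof -
  obtain S where S: "S \<subseteq> verts G" "S \<noteq> {}" "reach S = T" "card T + 1 = 2 * card S"
    using assms unfolding tight_def by blast
  have lab: "l e \<notin> T" "l e \<noteq> q" "T \<union> {q, l e} \<subseteq> reach (insert (l e) S)"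
    using label_of_boundary_arc[OF ir assms(2,3), of S] assms S by auto
  show "l e \<notin> T" "l e \<noteq> q" by (rule lab)+
  have sub: "insert (l e) S \<subseteq> verts G" using S assms label_in_verts by auto
  have "finite T" "finite S" using S finite_reach finite_subset[OF _ finite_verts] by auto
  moreover have "l e \<notin> S" using lab(1) S(3) by (auto intro: reachable_from.base)
  ultimately have c: "card (T \<union> {q, l e}) = card T + 2" "card (insert (l e) S) = card S + 1"
    using lab assms by auto
  then have "card (reach (insert (l e) S)) \<le> card (T \<union> {q, l e})"
    using card_reach_le[OF sub] S by simp
  then have "reach (insert (l e) S) = T \<union> {q, l e}"
    using card_seteq[OF finite_reach[OF sub] lab(3)] by blast
  moreover have "card (T \<union> {q, l e}) + 1 = 2 * card (insert (l e) S)"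
    unfolding c using S(4) by simp
  ultimately show "tight (T \<union> {q, l e})"
    unfolding tight_def using sub by blast
qed

text \<open>This plays the part of induction along a greedy run: a maximal tight set with property
  \<open>Q\<close> is everything, or else the next \<open>tight_step\<close> destroys
  \<open>Q\<close>.\<close>

lemma ex_maximal_tight:
  assumes "tight T0" "Q T0"
  shows "\<exists>T. tight T \<and> Q T \<and> (\<forall>T'. tight T' \<longrightarrow> Q T' \<longrightarrow> T \<subseteq> T' \<longrightarrow> T = T')"
proof -
  let ?A = "{T. tight T \<and> Q T}"
  have "?A \<subseteq> Pow (verts G)" using tight_subset_verts by auto
  then have "finite ?A" by (rule finite_subset) simp
  moreover have "?A \<noteq> {}" using assms by auto
  ultimately have "\<exists>T\<in>?A. \<forall>T'\<in>?A. T \<subseteq> T' \<longrightarrow> T = T'" by (rule finite_has_maximal)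
  then obtain T where T: "T \<in> ?A" "\<forall>T'\<in>?A. T \<subseteq> T' \<longrightarrow> T = T'" ..
  then show ?thesis by (intro exI[of _ T]) simp
qed

text \<open>Grow a maximal tight set around the label that avoids both endpoints: the next step must swallow
  both endpoints at once, and the edge responsible for it is the partner.\<close>

lemma partner_arc:
  assumes e: "e \<in> arcs G"
  obtains x y z e' where "{tail G e, head G e} = {x, y}" "l e = z" "triple e = {x, y, z}"
    "e' \<in> arcs G" "{tail G e', head G e'} = {y, z}" "l e' = x"
    "x \<noteq> y" "y \<noteq> z" "x \<noteq> z"
proof -
  define a b where "a = tail G e" "b = head G e"
  have ne: "a \<noteq> b" "l e \<noteq> a" "l e \<noteq> b"
    using e ir no_loops[OF e] unfolding a_b_def interior_reduced_def by auto
  have Q0: "l e \<in> {l e} \<and> a \<notin> {l e} \<and> b \<notin> {l e}" using ne by auto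
  obtain T where T: "tight T" "l e \<in> T \<and> a \<notin> T \<and> b \<notin> T"
    and max: "\<forall>T'. tight T' \<longrightarrow> l e \<in> T' \<and> a \<notin> T' \<and> b \<notin> T' \<longrightarrow> T \<subseteq> T' \<longrightarrow> T = T'"
    using ex_maximal_tight[OF tight_singleton[OF label_in_verts[OF e]],
      of "\<lambda>T. l e \<in> T \<and> a \<notin> T \<and> b \<notin> T", OF Q0] by metis
  have "a \<in> verts G" using e a_b_def by auto
  then have "T \<noteq> {}" "T \<noteq> verts G" using T(2) by auto
  then obtain e' p q where e': "e' \<in> arcs G" "{tail G e', head G e'} = {p, q}" "p \<in> T" "q \<in> verts G - T"
    using boundary_arc[OF con tight_subset_verts[OF T(1)]] by metis
  note step = tight_step[OF T(1) e'(1,2,3)]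
  have tT': "tight (T \<union> {q, l e'})" using step e' by auto
  \<comment> \<open>The label of \<open>e\<close> lies in \<open>T\<close>, so a reachable set above
    \<open>T\<close> that contains one endpoint of \<open>e\<close> contains the other.\<close>
  have both: "a \<in> T \<union> {q, l e'} \<longleftrightarrow> b \<in> T \<union> {q, l e'}"
  proof -
    obtain S' where S': "reach S' = T \<union> {q, l e'}" using tT' unfolding tight_def by blast
    have "l e \<in> reach S'" using T S' by auto
    then show ?thesis
      using reach_step[OF e, of a b S'] reach_step[OF e, of b a S'] unfolding S' a_b_def by auto
  qed
  have "a \<in> T \<union> {q, l e'} \<or> b \<in> T \<union> {q, l e'}"
    using max[rule_format, OF tT'] T(2) e'(4) by auto
  then have "a \<in> {q, l e'}" "b \<in> {q, l e'}"
    using both T(2) by auto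
  then have ab: "{a, b} = {q, l e'}"
    using ne(1) by auto
  have gen: "x \<in> triple e \<Longrightarrow> y \<in> triple e \<Longrightarrow> reach {x, y} \<subseteq> triple e" for x y
    using reach_triple[OF e] reach_least[of "{x, y}" "triple e"] by auto
  \<comment> \<open>The pair \<open>{q, l e'}\<close> is the pair of endpoints of \<open>e\<close>,
    and \<open>e'\<close> leads from it to \<open>p\<close>, so \<open>p\<close> is in the triple of
    \<open>e\<close>. Since \<open>p\<close> lies in \<open>T\<close> and the endpoints do not,
    \<open>p\<close> is the label of \<open>e\<close>.\<close>
  have "p \<in> reach {q, l e'}"
    using reach_step[OF e'(1,2), of "{q, l e'}"] by (auto intro: reachable_from.base)
  moreover have "reach {q, l e'} \<subseteq> triple e"
    using gen[of a b] ab unfolding triple_def a_b_def by simp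
  ultimately have "p \<in> {a, b, l e}" unfolding triple_def a_b_def by auto
  then have p: "p = l e" using e'(3) T(2) by auto
  show thesis
  proof (rule that[of "l e'" q "l e" e'])
    show "{tail G e, head G e} = {l e', q}" using ab unfolding a_b_def by auto
    show "triple e = {l e', q, l e}"
      using ab unfolding a_b_def triple_def by auto
    show "{tail G e', head G e'} = {q, l e}" using e'(2) p by auto
    show "l e' \<noteq> q" "q \<noteq> l e" "l e' \<noteq> l e" using ab ne by (auto simp: doubleton_eq_iff)
  qed (use e' in auto)
qed

text \<open>The arc \<open>e\<close> alone handles the pairs that contain its label. The pair of its
  endpoints consists of an endpoint and the label of the partner arc, whose triple is the
  same.\<close>

lemma reach_two_of_triple:
  assumes "e \<in> arcs G" "u \<in> triple e" "v \<in> triple e" "u \<noteq> v"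
  shows "reach {u, v} = triple e"
proof -
  obtain x y z e' where *: "{tail G e, head G e} = {x, y}" "l e = z" "triple e = {x, y, z}"
    "e' \<in> arcs G" "{tail G e', head G e'} = {y, z}" "l e' = x" "x \<noteq> y" "y \<noteq> z" "x \<noteq> z"
    using partner_arc[OF assms(1)] .
  have tr: "triple e' = triple e"
    using * unfolding triple_def by (metis insert_commute insert_is_Un)
  have "reach {x, z} = triple e" "reach {y, z} = triple e"
    using reach_endpoint_label[OF assms(1)] unfolding *(1,2) by simp_all
  moreover have "reach {y, x} = triple e" "reach {z, x} = triple e"
    using reach_endpoint_label[OF *(4)] unfolding *(5,6) tr by simp_all
  moreover have "{u, v} \<in> {{x, z}, {y, z}, {y, x}, {z, x}}"
    using assms(2-4) unfolding *(3) by auto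
  ultimately show ?thesis by (auto simp: insert_commute)
qed

lemma triple_eqI:
  assumes "e \<in> arcs G" "e' \<in> arcs G" "u \<noteq> v" "{u, v} \<subseteq> triple e" "{u, v} \<subseteq> triple e'"
  shows "triple e = triple e'"
  using reach_two_of_triple[of e u v] reach_two_of_triple[of e' u v] assms by auto

text \<open>Take a maximal tight \<open>T\<close> within which every nonempty family of triples has
  such a leaf. When \<open>T\<close> grows by \<open>q\<close> and \<open>l a\<close>, a triple that
  newly fits meets \<open>T\<close> in at most one vertex and hence contains both new ones. By
  \<open>triple_eqI\<close> there is only one such triple, and it meets the others at most in that
  vertex of \<open>T\<close>, so it is a leaf. Hence \<open>T\<close> is everything.\<close>

lemma leaf_triple:
  assumes "F \<subseteq> arcs G" "F \<noteq> {}"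
  obtains e p where "e \<in> F" "\<And>e'. e' \<in> F \<Longrightarrow> triple e' \<noteq> triple e \<Longrightarrow> triple e \<inter> triple e' \<subseteq> {p}"
proof -
  define leaf where "leaf F \<longleftrightarrow> (\<exists>e\<in>F. \<exists>p. \<forall>e'\<in>F. triple e' \<noteq> triple e \<longrightarrow> triple e \<inter> triple e' \<subseteq> {p})" for F
  define Q where "Q T \<longleftrightarrow> (\<forall>F. F \<subseteq> arcs G \<and> F \<noteq> {} \<and> (\<forall>e\<in>F. triple e \<subseteq> T) \<longrightarrow> leaf F)" for T
  obtain x where x: "x \<in> verts G"
    using con unfolding Digraph_Component.connected_def strongly_connected_def by auto
  have "Q {x}"
    unfolding Q_def
  proof (intro allI impI, elim conjE)
    fix F assume "F \<subseteq> arcs G" "F \<noteq> {}" and sub: "\<forall>e\<in>F. triple e \<subseteq> {x}"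
    then obtain e where "e \<in> F" "e \<in> arcs G" by blast
    then have "card (triple e) \<le> card {x}" using sub by (intro card_mono) auto
    then show "leaf F" using card_triple[OF ir \<open>e \<in> arcs G\<close>] by simp
  qed
  then obtain T where T: "tight T" "Q T" and max: "\<forall>T'. tight T' \<longrightarrow> Q T' \<longrightarrow> T \<subseteq> T' \<longrightarrow> T = T'"
    using ex_maximal_tight[OF tight_singleton[OF x], of Q] by metis
  have "T = verts G"
  proof (rule ccontr)
    assume ne: "T \<noteq> verts G"
    have "T \<noteq> {}" using T(1) unfolding tight_def by (auto intro: reachable_from.base)
    then obtain a p q where a: "a \<in> arcs G" "{tail G a, head G a} = {p, q}" "p \<in> T" "q \<in> verts G - T"
      using boundary_arc[OF con tight_subset_verts[OF T(1)] _ ne] by metis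
    let ?T = "T \<union> {q, l a}"
    have tight: "tight ?T" using tight_step[OF T(1) a(1,2,3)] a by auto
    have meet: "triple e \<inter> T \<subseteq> {u} \<and> {q, l a} \<subseteq> triple e"
      if e: "e \<in> arcs G" "triple e \<subseteq> ?T" "\<not> triple e \<subseteq> T" and u: "T \<inter> triple e = {} \<or> u \<in> T \<inter> triple e" for e u
    proof -
      have one: "v = w" if "v \<in> triple e \<inter> T" "w \<in> triple e \<inter> T" for v w
      proof (rule ccontr)
        assume "v \<noteq> w"
        then have "triple e \<subseteq> T"
          using reach_two_of_triple[OF e(1), of v w] tight_closed[OF T(1), of "{v, w}"] that by auto
        then show False using e by simp
      qed
      then have sub: "triple e \<inter> T \<subseteq> {u}" using u by auto
      have "{q, l a} \<subseteq> triple e"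
      proof (rule ccontr)
        assume "\<not> {q, l a} \<subseteq> triple e"
        then obtain w where "triple e \<subseteq> {u, w}" using e sub by blast
        then have "card (triple e) \<le> 2" using card_mono[of "{u, w}" "triple e"] card_insert_le_m1[of 2 "{w}" u] by simp
        then show False using card_triple[OF ir e(1)] by simp
      qed
      then show ?thesis using sub by blast
    qed
    have "Q ?T"
      unfolding Q_def
    proof (intro allI impI, elim conjE)
      fix F assume F: "F \<subseteq> arcs G" "F \<noteq> {}" and sub: "\<forall>e\<in>F. triple e \<subseteq> ?T"
      show "leaf F"
      proof (cases "\<forall>e\<in>F. triple e \<subseteq> T")
        case True
        then show ?thesis using T(2) F unfolding Q_def by blast
      next
        case False
        then obtain e where e: "e \<in> F" "\<not> triple e \<subseteq> T" by blast
        obtain u where u: "T \<inter> triple e = {} \<or> u \<in> T \<inter> triple e" by blast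
        have "triple e \<inter> triple e' \<subseteq> {u}" if e': "e' \<in> F" "triple e' \<noteq> triple e" for e'
        proof -
          have "triple e' \<subseteq> T"
          proof (rule ccontr)
            assume n: "\<not> triple e' \<subseteq> T"
            obtain u' where u': "T \<inter> triple e' = {} \<or> u' \<in> T \<inter> triple e'" by blast
            have "{q, l a} \<subseteq> triple e" "{q, l a} \<subseteq> triple e'"
              using meet[OF _ _ e(2) u] meet[OF _ _ n u'] e e' F sub by auto
            moreover have "q \<noteq> l a" using tight_step[OF T(1) a(1,2,3)] a by auto
            ultimately show False
              using triple_eqI[of e e' q "l a"] e e' F by auto
          qed
          then show ?thesis using meet[OF _ _ e(2) u] e F sub by auto
        qed
        then show ?thesis unfolding leaf_def using e by blast
      qed
    qed
    then show False using max[rule_format, OF tight] a(4) by auto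
  qed
  then have "leaf F"
    using T(2) assms triple_subset_verts unfolding Q_def by blast
  then show thesis unfolding leaf_def using that by blast
qed

end

text \<open>The 2-cell of an arc \<open>e\<close>, lifted to level \<open>k\<close> of the infinite cyclic cover, is a square
  with left side \<open>l e\<close>, \<open>tail e\<close> and right side \<open>head e\<close>, \<open>l e\<close>, both read upwards from level \<open>k\<close>
  to level \<open>k + 2\<close>.\<close>

definition cell_edges :: "('v, 'e) pre_digraph \<Rightarrow> ('e \<Rightarrow> 'v) \<Rightarrow> 'e \<times> int \<Rightarrow> ('v \<times> int) set" where
  "cell_edges G l c = (case c of (e, k) \<Rightarrow> {(l e, k), (tail G e, k + 1), (l e, k + 1), (head G e, k)})"

lemma exclusive_element:
  assumes "A1 \<noteq> A2" "card A1 = 2" "card A2 = 2"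
  obtains x1 x2 where "x1 \<in> A1" "x1 \<notin> A2" "x2 \<in> A2" "x2 \<notin> A1" "x1 \<noteq> x2"
proof -
  have "finite A1" "finite A2" using assms(2,3) by (metis card.infinite zero_neq_numeral)+
  then have "\<not> A1 \<subseteq> A2" "\<not> A2 \<subseteq> A1"
    using assms card_seteq[of A2 A1] card_seteq[of A1 A2] by auto
  then show thesis using that by blast
qed

section \<open>Free edges of finite sets of cells in the cyclic cover\<close>

locale extremal_lot = extremal_log +
  assumes tree: "undirected_tree G"
begin

text \<open>The only use of acyclicity. It excludes a third arc on a triple, one that joins the two
  vertices not joined by the partner arcs.\<close>

lemma no_triangle:
  assumes "e1 \<in> arcs G" "{tail G e1, head G e1} = {a, b}"
    and "e2 \<in> arcs G" "{tail G e2, head G e2} = {b, c}"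
    and "e3 \<in> arcs G" "{tail G e3, head G e3} = {c, a}"
    and "a \<noteq> b" "b \<noteq> c" "a \<noteq> c"
  shows False
proof -
  let ?H = "with_proj (mk_symmetric G)"
  let ?p = "[(a, b), (b, c), (c, a)]"
  have arc: "(u, v) \<in> parcs (mk_symmetric G)" "u \<in> verts G"
    if "e \<in> arcs G" "{tail G e, head G e} = {u, v}" for e u v
  proof -
    have "u = tail G e \<and> v = head G e \<or> u = head G e \<and> v = tail G e"
      using that(2) by (auto simp: doubleton_eq_iff)
    then show "(u, v) \<in> parcs (mk_symmetric G)" "u \<in> verts G"
      using that(1) unfolding parcs_mk_symmetric by auto
  qed
  note arcs = arc[OF assms(1,2)] arc[OF assms(3,4)] arc[OF assms(5,6)]
  have "pre_digraph.cycle ?H ?p"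
    unfolding pre_digraph.cycle_def pre_digraph.awalk_def
    using arcs assms(7-9)
    by (auto simp: pre_digraph.awalk_verts.simps pre_digraph.cas.simps)
  then show False
    using tree unfolding undirected_tree_def by (metis length_Cons list.size(3) numeral_3_eq_3 order_refl)
qed

text \<open>The last claim compares the upper and the lower sides of the two cells. The labels are
  \<open>z\<close> and \<open>x\<close>, so equal upper sides force the tails \<open>x\<close> and
  \<open>z\<close>; then both heads are \<open>y\<close>, and the lower sides \<open>{y, z}\<close>
  and \<open>{y, x}\<close> differ.\<close>

lemma arcs_of_triple:
  assumes e: "e \<in> arcs G"
  obtains e' where "e' \<in> arcs G" "triple e' = triple e" "e' \<noteq> e"
    "\<And>e''. e'' \<in> arcs G \<Longrightarrow> triple e'' = triple e \<Longrightarrow> e'' = e \<or> e'' = e'"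
    "{tail G e, l e} \<noteq> {tail G e', l e'} \<or> {head G e, l e} \<noteq> {head G e', l e'}"
proof -
  obtain x y z e' where *: "{tail G e, head G e} = {x, y}" "l e = z" "triple e = {x, y, z}"
    "e' \<in> arcs G" "{tail G e', head G e'} = {y, z}" "l e' = x" "x \<noteq> y" "y \<noteq> z" "x \<noteq> z"
    using partner_arc[OF e] .
  have tr: "triple e' = triple e"
    using * unfolding triple_def by (metis insert_commute insert_is_Un)
  have only: "e'' = e \<or> e'' = e'" if e'': "e'' \<in> arcs G" "triple e'' = triple e" for e''
  proof (rule ccontr)
    assume n: "\<not> (e'' = e \<or> e'' = e')"
    have "{tail G e'', head G e''} \<noteq> {x, y}" "{tail G e'', head G e''} \<noteq> {y, z}"
      using simple[of e e''] simple[of e' e''] e e'' * n by auto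
    moreover have "tail G e'' \<noteq> head G e''" "tail G e'' \<in> {x, y, z}" "head G e'' \<in> {x, y, z}"
      using no_loops e'' *(3) unfolding triple_def by auto
    ultimately have "{tail G e'', head G e''} = {z, x}" by (auto simp: doubleton_eq_iff)
    then show False using no_triangle[OF e *(1,4,5) e''(1)] * by auto
  qed
  have "tail G e = x \<and> head G e = y \<or> tail G e = y \<and> head G e = x"
    "tail G e' = y \<and> head G e' = z \<or> tail G e' = z \<and> head G e' = y"
    using *(1,5) by (simp_all add: doubleton_eq_iff)
  then have "{tail G e, l e} \<noteq> {tail G e', l e'} \<or> {head G e, l e} \<noteq> {head G e', l e'}"
    unfolding *(2,6) using *(7-9) by (elim disjE conjE) (simp_all add: doubleton_eq_iff)
  then show thesis using that[OF *(4) tr _ only] *(2,6,9) by metis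
qed

text \<open>Take a leaf triple, attached to the others at most at \<open>p\<close>, and its highest
  occupied level \<open>k\<close> when the upper sides of its two cells differ. An edge
  \<open>(x, k + 1)\<close> with \<open>x \<noteq> p\<close> is on no cell of another triple, and on
  no lower cell of the same triple, whose edges have level at most \<open>k\<close>. When the lower
  sides differ, the lowest level serves in the same way.\<close>

theorem ex_free_edge:
  assumes fin: "finite C" and ne: "C \<noteq> {}" and arcs: "fst ` C \<subseteq> arcs G"
  obtains c \<epsilon> where "c \<in> C" "\<epsilon> \<in> cell_edges G l c" "\<And>c'. c' \<in> C \<Longrightarrow> c' \<noteq> c \<Longrightarrow> \<epsilon> \<notin> cell_edges G l c'"
proof -
  obtain e p where e: "e \<in> fst ` C"
    and leaf: "\<And>e'. e' \<in> fst ` C \<Longrightarrow> triple e' \<noteq> triple e \<Longrightarrow> triple e \<inter> triple e' \<subseteq> {p}"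
    using leaf_triple[OF arcs] ne by blast
  then have eG: "e \<in> arcs G" using arcs by blast
  obtain e' where e': "e' \<in> arcs G" "triple e' = triple e" "e' \<noteq> e"
    and only: "\<And>e''. e'' \<in> arcs G \<Longrightarrow> triple e'' = triple e \<Longrightarrow> e'' = e \<or> e'' = e'"
    and differ: "{tail G e, l e} \<noteq> {tail G e', l e'} \<or> {head G e, l e} \<noteq> {head G e', l e'}"
    using arcs_of_triple[OF eG] by metis
  define K where "K = snd ` {c \<in> C. triple (fst c) = triple e}"
  have K: "finite K" "K \<noteq> {}" using fin e unfolding K_def by auto
  \<comment> \<open>Only the cells of the triple at level \<open>k\<close> compete. If both are
    present, each has a vertex that the other lacks, and these are distinct, so one of them is not
    \<open>p\<close>. If one is present, any vertex other than \<open>p\<close> will do.\<close>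
  have select: "\<exists>a x. a \<in> {e, e'} \<and> (a, k) \<in> C \<and> x \<in> f a \<and> x \<noteq> p \<and>
      (\<forall>a'. a' \<in> {e, e'} \<and> (a', k) \<in> C \<and> a' \<noteq> a \<longrightarrow> x \<notin> f a')"
    if k: "k \<in> K" and f: "f e \<noteq> f e'" "card (f e) = 2" "card (f e') = 2" for k and f :: "'b \<Rightarrow> 'a set"
  proof -
    obtain x1 x2 where x: "x1 \<in> f e" "x1 \<notin> f e'" "x2 \<in> f e'" "x2 \<notin> f e" "x1 \<noteq> x2"
      using exclusive_element[OF f] .
    have two: "\<exists>x\<in>A. x \<noteq> p" if "card A = 2" for A :: "'a set"
      using that by (auto simp: card_2_iff)
    obtain a where a: "(a, k) \<in> C" "triple a = triple e" using k unfolding K_def by auto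
    then have "a \<in> {e, e'}" using only arcs by force
    consider "(e, k) \<in> C" "(e', k) \<in> C" | "(e, k) \<in> C" "(e', k) \<notin> C" | "(e, k) \<notin> C" "(e', k) \<in> C"
      using a \<open>a \<in> {e, e'}\<close> by blast
    then show ?thesis
    proof cases
      case 1
      then show ?thesis using x by (cases "x1 = p") blast+
    next
      case 2
      then show ?thesis using two[OF f(2)] by blast
    next
      case 3
      then show ?thesis using two[OF f(3)] by blast
    qed
  qed
  have card2: "card {tail G a, l a} = 2" "card {head G a, l a} = 2" if "a \<in> arcs G" for a
    using ir that unfolding interior_reduced_def by auto
  have other: "(x, j) \<notin> cell_edges G l (a', k')"
    if "(a', k') \<in> C" "triple a' \<noteq> triple e" "x \<in> triple e" "x \<noteq> p" for a' k' x j
    using leaf[of a'] that unfolding cell_edges_def triple_def by force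
  from differ show thesis
  proof
    assume top: "{tail G e, l e} \<noteq> {tail G e', l e'}"
    define k where "k = Max K"
    have k: "k \<in> K" "\<And>k'. k' \<in> K \<Longrightarrow> k' \<le> k" using K unfolding k_def by auto
    obtain a x where a: "a \<in> {e, e'}" "(a, k) \<in> C" "x \<in> {tail G a, l a}" "x \<noteq> p"
      and ax: "\<And>a'. a' \<in> {e, e'} \<Longrightarrow> (a', k) \<in> C \<Longrightarrow> a' \<noteq> a \<Longrightarrow> x \<notin> {tail G a', l a'}"
      using select[OF k(1), of "\<lambda>a. {tail G a, l a}"] top card2 eG e' by blast
    have xt: "x \<in> triple e" using a e' unfolding triple_def by auto
    show thesis
    proof (rule that[of "(a, k)" "(x, k + 1)"])
      show "(x, k + 1) \<in> cell_edges G l (a, k)" using a unfolding cell_edges_def by auto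
      show "(x, k + 1) \<notin> cell_edges G l c'" if c': "c' \<in> C" "c' \<noteq> (a, k)" for c'
      proof (cases "triple (fst c') = triple e")
        case False
        then show ?thesis using other[of "fst c'" "snd c'" x] c' xt a by simp
      next
        case True
        then have a': "fst c' \<in> {e, e'}" using only c' arcs by blast
        have "snd c' \<le> k" using k(2) True c' unfolding K_def by blast
        then show ?thesis
          using ax[OF a'] c' unfolding cell_edges_def by (cases c') auto
      qed
    qed (use a in auto)
  next
    assume bot: "{head G e, l e} \<noteq> {head G e', l e'}"
    define k where "k = Min K"
    have k: "k \<in> K" "\<And>k'. k' \<in> K \<Longrightarrow> k \<le> k'" using K unfolding k_def by auto
    obtain a x where a: "a \<in> {e, e'}" "(a, k) \<in> C" "x \<in> {head G a, l a}" "x \<noteq> p"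
      and ax: "\<And>a'. a' \<in> {e, e'} \<Longrightarrow> (a', k) \<in> C \<Longrightarrow> a' \<noteq> a \<Longrightarrow> x \<notin> {head G a', l a'}"
      using select[OF k(1), of "\<lambda>a. {head G a, l a}"] bot card2 eG e' by blast
    have xt: "x \<in> triple e" using a e' unfolding triple_def by auto
    show thesis
    proof (rule that[of "(a, k)" "(x, k)"])
      show "(x, k) \<in> cell_edges G l (a, k)" using a unfolding cell_edges_def by auto
      show "(x, k) \<notin> cell_edges G l c'" if c': "c' \<in> C" "c' \<noteq> (a, k)" for c'
      proof (cases "triple (fst c') = triple e")
        case False
        then show ?thesis using other[of "fst c'" "snd c'" x] c' xt a by simp
      next
        case True
        then have a': "fst c' \<in> {e, e'}" using only c' arcs by blast
        have "k \<le> snd c'" using k(2) True c' unfolding K_def by blast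
        then show ?thesis
          using ax[OF a'] c' unfolding cell_edges_def by (cases c') auto
      qed
    qed (use a in auto)
  qed
qed

end

section \<open>Graphs attaining the bound\<close>

definition star_graph :: "nat \<Rightarrow> (nat, nat) pre_digraph" where
  "star_graph n = \<lparr>verts = {0..2 * n}, arcs = {1..2 * n}, tail = (\<lambda>_. 0), head = (\<lambda>i. i)\<rparr>"

text \<open>Leaves \<open>2 * i - 1\<close> and \<open>2 * i\<close> are paired, and each labels the
  arc to the other. Together with the centre \<open>0\<close>, every pair is a triple of the
  extremal kind.\<close>

definition star_label :: "nat \<Rightarrow> nat" where
  "star_label i = (if odd i then i + 1 else i - 1)"

lemma star_graph_simps [simp]:
  "verts (star_graph n) = {0..2 * n}" "arcs (star_graph n) = {1..2 * n}"
  "tail (star_graph n) i = 0" "head (star_graph n) i = i"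
  by (simp_all add: star_graph_def)

lemma star_label_bounds: "i \<in> {1..2 * n} \<Longrightarrow> star_label i \<in> {1..2 * n}"
  unfolding star_label_def by (cases "even i"; simp; presburger)

lemma star_label_pair: "1 \<le> i \<Longrightarrow> (star_label i + 1) div 2 = (i + 1) div 2" "1 \<le> i \<Longrightarrow> star_label i \<noteq> i"
  unfolding star_label_def by (auto elim!: evenE oddE)

lemma star_labeled_oriented_graph: "labeled_oriented_graph (star_graph n) star_label"
proof
  show "e1 = e2" if "{tail (star_graph n) e1, head (star_graph n) e1} = {tail (star_graph n) e2, head (star_graph n) e2}"
    for e1 e2 using that by (auto simp: doubleton_eq_iff)
  show "star_label e \<in> verts (star_graph n)" if "e \<in> arcs (star_graph n)" for e
    using star_label_bounds[of e n] that by auto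
qed auto

lemma star_interior_reduced: "interior_reduced (star_graph n) star_label"
  unfolding interior_reduced_def using star_label_pair(2) star_label_bounds by fastforce

lemma star_connected: "Digraph_Component.connected (star_graph n)"
proof -
  let ?H = "with_proj (mk_symmetric (star_graph n))"
  interpret labeled_oriented_graph "star_graph n" star_label by (rule star_labeled_oriented_graph)
  interpret H: pair_wf_digraph "mk_symmetric (star_graph n)" by (rule wellformed_mk_symmetric)
  have adj: "(0, i) \<in> arcs_ends ?H \<and> (i, 0) \<in> arcs_ends ?H" if "i \<in> {1..2 * n}" for i
    using that by (auto simp: arcs_ends_conv parcs_mk_symmetric)
  have 0: "0 \<rightarrow>\<^sup>*\<^bsub>?H\<^esub> i" "i \<rightarrow>\<^sup>*\<^bsub>?H\<^esub> 0" if "i \<in> {0..2 * n}" for i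
  proof -
    have "i = 0 \<or> i \<in> {1..2 * n}" using that by auto
    then show "0 \<rightarrow>\<^sup>*\<^bsub>?H\<^esub> i" "i \<rightarrow>\<^sup>*\<^bsub>?H\<^esub> 0"
      using adj H.reachable_adjI[of 0 i] H.reachable_adjI[of i 0] H.reachable_refl[of 0] by auto
  qed
  show ?thesis
    unfolding Digraph_Component.connected_def strongly_connected_def
  proof (intro conjI ballI)
    fix u v assume "u \<in> verts ?H" "v \<in> verts ?H"
    then show "u \<rightarrow>\<^sup>*\<^bsub>?H\<^esub> v"
      using 0(2)[of u] 0(1)[of v] H.reachable_trans by auto
  qed auto
qed

text \<open>A pair without a member in \<open>S\<close> is never reached, so \<open>S\<close> has at
  least \<open>n\<close> leaves. With exactly \<open>n\<close> vertices it has one leaf of each pair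
  and not the centre. Then no arc can act: reaching the centre takes a leaf together with its label,
  that is, both leaves of one pair.\<close>

lemma star_complexity: "complexity (star_graph n) star_label = n + 1"
proof -
  interpret labeled_oriented_graph "star_graph n" star_label by (rule star_labeled_oriented_graph)
  have le: "complexity (star_graph n) star_label \<le> n + 1"
    using complexity_upper_bound[OF star_interior_reduced star_connected] by simp
  obtain S where S: "S \<subseteq> {0..2 * n}" "reach S = {0..2 * n}" "card S = complexity (star_graph n) star_label"
    using complexity_attained by (metis star_graph_simps(1))
  have fin: "finite S" using S(1) finite_subset by blast
  \<comment> \<open>The number of the pair of a leaf; the centre gets \<open>0\<close>.\<close>
  define pr where "pr i = (i + 1) div 2" for i :: nat
  have surj: "{1..n} \<subseteq> pr ` (S - {0})"
  proof
    fix j assume j: "j \<in> {1..n}"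
    show "j \<in> pr ` (S - {0})"
    proof (rule ccontr)
      assume no: "j \<notin> pr ` (S - {0})"
      have "x = 0 \<or> pr x \<noteq> j" if "x \<in> reach S" for x
        using that
      proof induction
        case (base x) then show ?case using no by blast
      next
        case (forward e)
        have "star_label e \<noteq> 0" using star_label_bounds[of e n] forward(1) by auto
        then show ?case using forward star_label_pair(1)[of e] unfolding pr_def by auto
      qed simp
      moreover have "2 * j \<in> reach S" unfolding S(2) using j by auto
      moreover have "pr (2 * j) = j" unfolding pr_def by simp
      ultimately show False using j by fastforce
    qed
  qed
  then have cS: "n \<le> card (S - {0})"
    using surj_card_le[of "S - {0}" "{1..n}" pr] fin by simp
  have "n + 1 \<le> card S"
  proof (rule ccontr)
    assume n: "\<not> n + 1 \<le> card S"
    have "card (S - {0}) \<le> card S" using fin by (simp add: card_mono)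
    then have eq: "card S = n" "card (S - {0}) = n" using n cS by auto
    then have 0: "0 \<notin> S" using fin by (metis card_Diff1_less less_irrefl)
    have "card (pr ` (S - {0})) \<ge> n"
      using card_mono[OF _ surj] fin by simp
    then have "card (pr ` S) = card S"
      using eq 0 card_image_le[OF fin, of pr] by simp
    then have inj: "inj_on pr S" using fin by (simp add: eq_card_imp_inj_on)
    have "x \<in> S" if "x \<in> reach S" for x
      using that
    proof induction
      case (backward e)
      then have "e \<in> S" "star_label e \<in> S" "1 \<le> e" by auto
      then show ?case using inj star_label_pair[of e] unfolding pr_def inj_on_def by blast
    qed (use 0 in auto)
    then show False using 0 unfolding S(2) by auto
  qed
  then show ?thesis using le S by simp
qed

section \<open>The standard 2-complex\<close>

definition well_formed :: "('g, 'r) presentation \<Rightarrow> bool" where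
  "well_formed P \<longleftrightarrow> (\<forall>r\<in>rels P. \<forall>a\<in>set (relator P r). fst a \<in> gens P)"

lemma char_map1_in_points: "g \<in> gens P \<Longrightarrow> char_map1 g t \<in> complex_points P"
  by (auto simp: complex_points_def)

lemma letter_path_in_points: "fst a \<in> gens P \<Longrightarrow> letter_path a t \<in> complex_points P"
  by (cases a) (simp only: letter_path.simps char_map1_in_points fst_conv)

lemma char_map2_in_points:
  assumes "well_formed P" "r \<in> rels P"
  shows "char_map2 P r z \<in> complex_points P"
proof (cases "norm z < 1")
  case True
  then show ?thesis using assms by (auto simp: char_map2_def complex_points_def)
next
  case False
  let ?s = "Arg2pi z / (2 * pi)"
  have "word_path (relator P r) ?s \<in> complex_points P"
  proof (cases "nat \<lfloor>real (length (relator P r)) * ?s\<rfloor> < length (relator P r)")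
    case True
    then have "fst (relator P r ! nat \<lfloor>real (length (relator P r)) * ?s\<rfloor>) \<in> gens P"
      using assms unfolding well_formed_def by auto
    then show ?thesis
      using True unfolding word_path_def Let_def by (simp only: if_True letter_path_in_points)
  next
    case False
    then show ?thesis unfolding word_path_def Let_def by (simp only: if_False) (simp add: complex_points_def)
  qed
  then show ?thesis using False by (simp add: char_map2_def)
qed

lemma topspace_standard_complex:
  assumes "well_formed P"
  shows "topspace (standard_complex P) = complex_points P"
proof -
  have "{0..1} \<inter> char_map1 g -` complex_points P = {0..1}" if "g \<in> gens P" for g
    using char_map1_in_points[OF that] by blast
  moreover have "cball 0 1 \<inter> char_map2 P r -` complex_points P = cball 0 1" if "r \<in> rels P" for r
    using char_map2_in_points[OF assms that] by blast
  ultimately have "complex_open P (complex_points P)"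
    unfolding complex_open_def by simp
  then have "complex_points P \<subseteq> topspace (standard_complex P)"
    by (simp add: openin_subset openin_standard_complex)
  moreover have "topspace (standard_complex P) \<subseteq> complex_points P"
    using openin_topspace[of "standard_complex P"] unfolding openin_standard_complex complex_open_def by blast
  ultimately show ?thesis by blast
qed

lemma continuous_map_char_map1:
  assumes "well_formed P" "g \<in> gens P"
  shows "continuous_map (top_of_set {0..1}) (standard_complex P) (char_map1 g)"
  unfolding continuous_map_def
proof (intro conjI allI impI)
  show "char_map1 g \<in> topspace (top_of_set {0..1}) \<rightarrow> topspace (standard_complex P)"
    using char_map1_in_points[OF assms(2)] by (simp add: topspace_standard_complex[OF assms(1)] del: char_map1.simps)
  fix U assume "openin (standard_complex P) U"
  moreover have "{x \<in> topspace (top_of_set {0..1}). char_map1 g x \<in> U} = {0..1} \<inter> char_map1 g -` U"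
    by auto
  ultimately show "openin (top_of_set {0..1}) {x \<in> topspace (top_of_set {0..1}). char_map1 g x \<in> U}"
    using assms by (simp only: openin_standard_complex complex_open_def)
qed

lemma continuous_map_char_map2:
  assumes "well_formed P" "r \<in> rels P"
  shows "continuous_map (top_of_set (cball 0 1)) (standard_complex P) (char_map2 P r)"
  unfolding continuous_map_def
proof (intro conjI allI impI)
  show "char_map2 P r \<in> topspace (top_of_set (cball 0 1)) \<rightarrow> topspace (standard_complex P)"
    using char_map2_in_points[OF assms] by (simp add: topspace_standard_complex[OF assms(1)])
  fix U assume "openin (standard_complex P) U"
  moreover have "{x \<in> topspace (top_of_set (cball 0 1)). char_map2 P r x \<in> U} = cball 0 1 \<inter> char_map2 P r -` U"
    by auto
  ultimately show "openin (top_of_set (cball 0 1)) {x \<in> topspace (top_of_set (cball 0 1)). char_map2 P r x \<in> U}"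
    using assms by (simp only: openin_standard_complex complex_open_def)
qed

section \<open>Continuous functions that separate the points of the complex\<close>

lemma continuous_map_from_complex:
  fixes \<phi> :: "('g, 'r) cell_point \<Rightarrow> 'z :: topological_space"
  assumes wf: "well_formed P"
    and 1: "\<And>g. g \<in> gens P \<Longrightarrow> continuous_on {0..1} (\<lambda>t. \<phi> (char_map1 g t))"
    and 2: "\<And>r. r \<in> rels P \<Longrightarrow> continuous_on (cball 0 1) (\<lambda>z. \<phi> (char_map2 P r z))"
  shows "continuous_map (standard_complex P) euclidean \<phi>"
  unfolding continuous_map_def topspace_standard_complex[OF wf]
proof (intro conjI allI impI)
  fix U :: "'z set" assume "openin euclidean U"
  then have U: "open U" by simp
  let ?V = "{x \<in> complex_points P. \<phi> x \<in> U}"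
  have "openin (top_of_set {0..1}) ({0..1} \<inter> char_map1 g -` ?V)" if "g \<in> gens P" for g
  proof -
    have "{0..1} \<inter> char_map1 g -` ?V = {0..1} \<inter> (\<lambda>t. \<phi> (char_map1 g t)) -` U"
      using char_map1_in_points[OF that] by blast
    then show ?thesis using continuous_openin_preimage_gen[OF 1[OF that] U] by (simp only:)
  qed
  moreover have "openin (top_of_set (cball 0 1)) (cball 0 1 \<inter> char_map2 P r -` ?V)" if "r \<in> rels P" for r
  proof -
    have "cball 0 1 \<inter> char_map2 P r -` ?V = cball 0 1 \<inter> (\<lambda>z. \<phi> (char_map2 P r z)) -` U"
      using char_map2_in_points[OF wf that] by blast
    then show ?thesis using continuous_openin_preimage_gen[OF 2[OF that] U] by (simp only:)
  qed
  ultimately show "openin (standard_complex P) ?V"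
    unfolding openin_standard_complex complex_open_def by blast
qed simp

lemma Hausdorff_space_separating:
  assumes "\<And>x y. x \<in> topspace X \<Longrightarrow> y \<in> topspace X \<Longrightarrow> x \<noteq> y \<Longrightarrow>
    \<exists>f :: _ \<Rightarrow> complex. continuous_map X euclidean f \<and> f x \<noteq> f y"
  shows "Hausdorff_space X"
  unfolding Hausdorff_space_def
proof (intro allI impI, elim conjE)
  fix x y assume xy: "x \<in> topspace X" "y \<in> topspace X" "x \<noteq> y"
  then obtain f :: "_ \<Rightarrow> complex" where f: "continuous_map X euclidean f" "f x \<noteq> f y"
    using assms by blast
  obtain U V where UV: "open U" "open V" "f x \<in> U" "f y \<in> V" "U \<inter> V = {}"
    using hausdorff[OF f(2)] by blast
  have "openin X {x \<in> topspace X. f x \<in> U}" "openin X {x \<in> topspace X. f x \<in> V}"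
    using f(1) UV by (auto simp: continuous_map_def)
  then show "\<exists>U V. openin X U \<and> openin X V \<and> x \<in> U \<and> y \<in> V \<and> disjnt U V"
    using xy UV
    by (intro exI[of _ "{x \<in> topspace X. f x \<in> U}"] exI[of _ "{x \<in> topspace X. f x \<in> V}"])
      (auto simp: disjnt_def)
qed

text \<open>The \<open>j\<close>-th quarter of the unit circle, on which a relator of length four
  spells its \<open>j\<close>-th letter.\<close>

definition arc_point :: "nat \<Rightarrow> real \<Rightarrow> complex" where
  "arc_point j u = cis (pi / 2 * (real j + u))"

lemma norm_arc_point [simp]: "norm (arc_point j u) = 1"
  by (simp add: arc_point_def)

lemma arc_point_eq: "arc_point j u = \<i> ^ j * cis (pi / 2 * u)"
proof -
  have "\<i> ^ j = cis (pi / 2) ^ j" by simp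
  also have "\<dots> = cis (real j * (pi / 2))" by (rule Complex.DeMoivre)
  finally have "cis (pi / 2 * real j) = \<i> ^ j" by (simp add: mult.commute)
  then show ?thesis
    unfolding arc_point_def distrib_left cis_mult[symmetric] by simp
qed

lemma four_cases: "(j::nat) < 4 \<Longrightarrow> j = 0 \<or> j = 1 \<or> j = 2 \<or> j = 3"
  by auto

lemma circle_arc_point:
  assumes "norm z = 1"
  obtains j u where "j < 4" "0 \<le> u" "u < 1" "z = arc_point j u"
proof -
  define x where "x = 2 * Arg2pi z / pi"
  have x: "0 \<le> x" "x < 4" using Arg2pi[of z] unfolding x_def by (auto simp: field_simps)
  have z: "z = cis (pi / 2 * x)"
    using assms Arg2pi_eq[of z] unfolding x_def by (simp add: cis_conv_exp)
  have fl: "\<lfloor>x\<rfloor> < 4" "0 \<le> \<lfloor>x\<rfloor>" using x by linarith+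
  show thesis
  proof (rule that[of "nat \<lfloor>x\<rfloor>" "x - \<lfloor>x\<rfloor>"])
    show "nat \<lfloor>x\<rfloor> < 4" using fl by linarith
    show "0 \<le> x - \<lfloor>x\<rfloor>" "x - \<lfloor>x\<rfloor> < 1" by linarith+
    show "z = arc_point (nat \<lfloor>x\<rfloor>) (x - \<lfloor>x\<rfloor>)" using z fl unfolding arc_point_def by simp
  qed
qed

lemma letter_path_outside [simp]: "t \<le> 0 \<or> 1 \<le> t \<Longrightarrow> letter_path a t = Pt0"
  by (cases a) auto

lemma char_map2_arc_point:
  assumes len: "length (relator P r) = 4" and j: "j < 4" and u: "0 \<le> u" "u \<le> 1"
  shows "char_map2 P r (arc_point j u) = letter_path (relator P r ! j) u"
proof -
  have gen: "char_map2 P r (arc_point j u) = letter_path (relator P r ! j) u"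
    if j: "j < 4" and u: "0 \<le> u" "u < 1" for j u
  proof -
    have "pi / 2 * (real j + u) < pi / 2 * 4"
      using j u by (intro mult_strict_left_mono) auto
    then have "Arg2pi (arc_point j u) = pi / 2 * (real j + u)"
      using u unfolding arc_point_def by (intro Arg2pi_unique[of 1]) (auto simp: cis_conv_exp)
    then have s: "4 * (Arg2pi (arc_point j u) / (2 * pi)) = real j + u"
      by (simp add: field_simps)
    have "nat \<lfloor>real j + u\<rfloor> = j" using u by linarith
    then show ?thesis
      unfolding char_map2_def word_path_def len Let_def using j s by simp
  qed
  show ?thesis
  proof (cases "u = 1")
    case False
    then show ?thesis using gen[OF j] u by simp
  next
    case True
    \<comment> \<open>At \<open>u = 1\<close> the point belongs to the next quarter, cyclically, so
      \<open>word_path\<close> evaluates the next letter at \<open>0\<close>. Both letters give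
      \<open>Pt0\<close> there.\<close>
    have "arc_point j u = arc_point (if j = 3 then 0 else j + 1) 0"
      unfolding arc_point_eq True using four_cases[OF j] by (auto simp: power3_eq_cube cis_pi_half)
    then show ?thesis
      using gen[of "if j = 3 then 0 else j + 1" 0] j True by (simp split: if_splits)
  qed
qed

text \<open>On the circle this is piecewise linear in the angle: it rises from \<open>0\<close> at
  \<open>1\<close> to \<open>2\<close> at \<open>-1\<close> along the first two letters and falls
  back along the two inverse ones. Being a function of the real part, it extends over the disc,
  which continues \<open>circle_map\<close> across the 2-cell.\<close>

definition height :: "complex \<Rightarrow> real" where
  "height z = 1 - 2 / pi * arcsin (Re z)"

lemma continuous_on_height: "continuous_on (cball 0 1) height"
proof -
  have "-1 \<le> Re z \<and> Re z \<le> 1" if "z \<in> cball 0 1" for z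
    using that abs_Re_le_cmod[of z] by auto
  then show ?thesis unfolding height_def by (intro continuous_intros) auto
qed

lemma height_range:
  assumes "norm z \<le> 1" shows "0 \<le> height z" "height z \<le> 2"
proof -
  have "-1 \<le> Re z" "Re z \<le> 1" using assms abs_Re_le_cmod[of z] by auto
  then have "- (pi / 2) \<le> arcsin (Re z)" "arcsin (Re z) \<le> pi / 2" using arcsin_bounded by auto
  then show "0 \<le> height z" "height z \<le> 2" unfolding height_def by (auto simp: field_simps)
qed

lemma height_arc_point:
  assumes "j < 4" "0 \<le> u" "u \<le> 1"
  shows "height (arc_point j u) = (if j < 2 then real j + u else 4 - (real j + u))"
proof (cases "j < 2")
  case True
  then have "j = 0 \<or> j = 1" by auto
  then have b: "real j + u \<le> 2" "0 \<le> real j + u" using assms by auto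
  have "cos (pi / 2 * (real j + u)) = sin (pi / 2 - pi / 2 * (real j + u))"
    by (simp add: sin_diff)
  moreover have "arcsin (sin (pi / 2 - pi / 2 * (real j + u))) = pi / 2 - pi / 2 * (real j + u)"
  proof (rule arcsin_sin)
    have "pi / 2 * (real j + u) \<le> pi / 2 * 2" "pi / 2 * 0 \<le> pi / 2 * (real j + u)"
      using b by (auto intro!: mult_left_mono)
    then show "- (pi / 2) \<le> pi / 2 - pi / 2 * (real j + u)" "pi / 2 - pi / 2 * (real j + u) \<le> pi / 2"
      by linarith+
  qed
  ultimately show ?thesis
    using True unfolding height_def arc_point_def by (simp add: field_simps)
next
  case False
  then have "j = 2 \<or> j = 3" using assms by auto
  then have b: "real j + u \<le> 4" "2 \<le> real j + u" using assms by auto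
  have "cos (pi / 2 * (real j + u)) = sin (pi / 2 * (real j + u) - 3 * pi / 2)"
  proof -
    have "sin (3 * pi / 2) = -1" "cos (3 * pi / 2) = 0"
      using sin_3over2_pi cos_3over2_pi by simp_all
    then show ?thesis by (simp add: sin_diff)
  qed
  moreover have "arcsin (sin (pi / 2 * (real j + u) - 3 * pi / 2)) = pi / 2 * (real j + u) - 3 * pi / 2"
  proof (rule arcsin_sin)
    have "pi / 2 * (real j + u) \<le> pi / 2 * 4" "pi / 2 * 2 \<le> pi / 2 * (real j + u)"
      using b by (auto intro!: mult_left_mono)
    then show "- (pi / 2) \<le> pi / 2 * (real j + u) - 3 * pi / 2" "pi / 2 * (real j + u) - 3 * pi / 2 \<le> pi / 2"
      by linarith+
  qed
  ultimately show ?thesis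
    using False unfolding height_def arc_point_def by (simp add: field_simps)
qed

lemma Re_Im_arc_point:
  "Re (arc_point 0 u) = cos (pi / 2 * u)" "Im (arc_point 0 u) = sin (pi / 2 * u)"
  "Re (arc_point 1 u) = - sin (pi / 2 * u)" "Im (arc_point 1 u) = cos (pi / 2 * u)"
  "Re (arc_point 2 u) = - cos (pi / 2 * u)" "Im (arc_point 2 u) = - sin (pi / 2 * u)"
  "Re (arc_point 3 u) = sin (pi / 2 * u)" "Im (arc_point 3 u) = - cos (pi / 2 * u)"
  unfolding arc_point_eq by (simp_all add: power3_eq_cube)

text \<open>Supported on one quadrant, so it vanishes on the other three quarters of the circle. On
  its own quarter it is a product of sine and cosine, that is \<open>sin (pi * u) / 2\<close>, which
  explains the values of \<open>edge_function\<close> on 1-cells.\<close>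

definition bump :: "nat \<Rightarrow> complex \<Rightarrow> real" where
  "bump j z = (if j = 0 then max 0 (Re z) * max 0 (Im z)
     else if j = 1 then max 0 (- Re z) * max 0 (Im z)
     else if j = 2 then max 0 (- Re z) * max 0 (- Im z)
     else max 0 (Re z) * max 0 (- Im z))"

lemma continuous_on_bump: "continuous_on S (bump j)"
  by (cases "j = 0"; cases "j = 1"; cases "j = 2") (auto simp: bump_def intro!: continuous_intros)

lemma bump_arc_point:
  assumes "i < 4" "j < 4" "0 \<le> u" "u \<le> 1"
  shows "bump i (arc_point j u) = (if i = j then sin (pi * u) / 2 else 0)"
proof -
  have b: "0 \<le> pi / 2 * u" "pi / 2 * u \<le> pi / 2"
    using assms mult_left_mono[of u 1 "pi / 2"] by auto
  have s: "0 \<le> sin (pi / 2 * u)" by (rule sin_ge_zero) (use b in \<open>auto intro: order_trans\<close>)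
  have c: "0 \<le> cos (pi / 2 * u)" by (rule cos_ge_zero) (use b pi_gt_zero in linarith)+
  have sc: "sin (pi * u) / 2 = sin (pi / 2 * u) * cos (pi / 2 * u)"
    using sin_double[of "pi / 2 * u"] by simp
  show ?thesis
    using four_cases[OF assms(1)] four_cases[OF assms(2)] s c
    by (elim disjE) (simp_all add: bump_def Re_Im_arc_point[simplified] sc max_absorb1 max_absorb2 mult.commute)
qed

lemma cis_2pi_add_int: "cis (2 * pi * (of_int n + x)) = cis (2 * pi * x)"
proof -
  have "cis (2 * pi * of_int n) = 1" by (rule cis_multiple_2pi) auto
  then show ?thesis unfolding distrib_left cis_mult[symmetric] by simp
qed

lemma cis_2pi_eq_imp:
  assumes "cis (2 * pi * x) = cis (2 * pi * y)"
  obtains n :: int where "x = y + of_int n"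
proof -
  have "exp (\<i> * of_real (2 * pi * x)) = exp (\<i> * of_real (2 * pi * y))"
    using assms by (simp add: cis_conv_exp)
  then obtain n where "\<i> * of_real (2 * pi * x) = \<i> * of_real (2 * pi * y) + (of_int (2 * n) * pi) * \<i>"
    using exp_eq by blast
  then have "Im (\<i> * of_real (2 * pi * x)) = Im (\<i> * of_real (2 * pi * y) + (of_int (2 * n) * pi) * \<i>)"
    by (rule arg_cong)
  then have "2 * pi * x = 2 * pi * (y + of_int n)"
    by (simp add: algebra_simps)
  then show thesis using that[of n] by simp
qed

text \<open>The class of \<open>H\<^sup>1\<close> that maps every generator to 1; its pullback of the line is the
  infinite cyclic cover.\<close>

fun circle_map :: "('g, 'r) cell_point \<Rightarrow> complex" where
  "circle_map Pt0 = 1"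
| "circle_map (Pt1 g t) = cis (2 * pi * t)"
| "circle_map (Pt2 r z) = cis (2 * pi * height z)"

text \<open>On the 1-skeleton this is positive exactly on the open 1-cell of \<open>g\<close>. The
  bumps extend it over the 2-cells, one for each occurrence of \<open>g\<close> in the
  relator.\<close>

fun edge_function :: "('g, 'r) presentation \<Rightarrow> 'g \<Rightarrow> ('g, 'r) cell_point \<Rightarrow> real" where
  "edge_function P g Pt0 = 0"
| "edge_function P g (Pt1 g' t) = (if g' = g then sin (pi * t) / 2 else 0)"
| "edge_function P g (Pt2 r z) = (\<Sum>j<4. if fst (relator P r ! j) = g then bump j z else 0)"

text \<open>The factor \<open>1 - norm z\<close> makes this and \<open>cell_coordinate\<close>
  vanish on the boundary circle, so both extend by zero; inside the cell their quotient recovers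
  \<open>z\<close>.\<close>

fun cell_function :: "'r \<Rightarrow> ('g, 'r) cell_point \<Rightarrow> complex" where
  "cell_function r (Pt2 r' z) = (if r' = r then of_real (1 - norm z) else 0)"
| "cell_function r _ = 0"

fun cell_coordinate :: "'r \<Rightarrow> ('g, 'r) cell_point \<Rightarrow> complex" where
  "cell_coordinate r (Pt2 r' z) = (if r' = r then of_real (1 - norm z) * z else 0)"
| "cell_coordinate r _ = 0"

lemma circle_map_char_map1: "0 \<le> t \<Longrightarrow> t \<le> 1 \<Longrightarrow> circle_map (char_map1 g t) = cis (2 * pi * t)"
  using cis_2pi_add_int[of 1 0] by (cases "t = 0"; cases "t = 1") auto

lemma edge_function_char_map1:
  "0 \<le> t \<Longrightarrow> t \<le> 1 \<Longrightarrow> edge_function P g (char_map1 g' t) = (if g' = g then sin (pi * t) / 2 else 0)"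
  by (cases "t = 0"; cases "t = 1") auto

lemma sin_pi_reflect: "sin (pi * (1 - u)) = sin (pi * u)"
  by (simp add: sin_diff algebra_simps)

lemma edge_function_letter_path:
  "0 \<le> u \<Longrightarrow> u \<le> 1 \<Longrightarrow> edge_function P g (letter_path a u) = (if fst a = g then sin (pi * u) / 2 else 0)"
  by (cases a) (simp add: edge_function_char_map1 sin_pi_reflect del: char_map1.simps)

context labeled_oriented_graph
begin

abbreviation pres :: "('v, 'e) presentation" where
  "pres \<equiv> log_presentation G l"

abbreviation space :: "('v, 'e) cell_point topology" where
  "space \<equiv> standard_complex pres"

lemma gens_pres [simp]: "gens pres = verts G" and rels_pres [simp]: "rels pres = arcs G"
  by (simp_all add: log_presentation_def)

lemma relator_pres: "relator pres e = [(l e, True), (tail G e, True), (l e, False), (head G e, False)]"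
  by (simp add: log_presentation_def)

lemma length_relator_pres [simp]: "length (relator pres e) = 4"
  by (simp add: relator_pres)

lemma well_formed_pres: "well_formed pres"
  unfolding well_formed_def using label_in_verts by (auto simp: relator_pres)

lemma snd_relator: "j < 4 \<Longrightarrow> snd (relator pres e ! j) \<longleftrightarrow> j < 2"
  using four_cases[of j] by (auto simp: relator_pres)

lemma circle_map_char_map2:
  assumes "z \<in> cball 0 1"
  shows "circle_map (char_map2 pres e z) = cis (2 * pi * height z)"
proof (cases "norm z < 1")
  case True
  then show ?thesis by (simp add: char_map2_def)
next
  case False
  then have "norm z = 1" using assms by simp
  then obtain j u where z: "j < 4" "0 \<le> u" "u < 1" "z = arc_point j u"
    using circle_arc_point by blast
  have "circle_map (letter_path (relator pres e ! j) u) = cis (2 * pi * (if j < 2 then u else 1 - u))"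
    using z snd_relator[OF z(1), of e]
    by (cases "relator pres e ! j") (simp add: circle_map_char_map1 del: char_map1.simps)
  also have "\<dots> = cis (2 * pi * height z)"
    using cis_2pi_add_int[of "int j" u] cis_2pi_add_int[of "3 - int j" "1 - u"] z
    by (auto simp: height_arc_point algebra_simps)
  finally show ?thesis
    using char_map2_arc_point[OF length_relator_pres z(1,2)] z by simp
qed

lemma continuous_map_circle_map: "continuous_map space euclidean circle_map"
proof (rule continuous_map_from_complex[OF well_formed_pres])
  show "continuous_on {0..1} (\<lambda>t. circle_map (char_map1 g t))" for g
    by (rule continuous_on_eq[of _ "\<lambda>t. cis (2 * pi * t)"])
      (auto simp: circle_map_char_map1 intro!: continuous_intros simp del: char_map1.simps)
  show "continuous_on (cball 0 1) (\<lambda>z. circle_map (char_map2 pres e z))" for e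
    by (rule continuous_on_eq[of _ "\<lambda>z. cis (2 * pi * height z)"])
      (auto simp: circle_map_char_map2 intro!: continuous_intros continuous_on_height)
qed

lemma edge_function_char_map2:
  assumes "z \<in> cball 0 1"
  shows "edge_function pres g (char_map2 pres e z) = (\<Sum>j<4. if fst (relator pres e ! j) = g then bump j z else 0)"
proof (cases "norm z < 1")
  case True
  then show ?thesis by (simp add: char_map2_def)
next
  case False
  then have "norm z = 1" using assms by simp
  then obtain j u where z: "j < 4" "0 \<le> u" "u < 1" "z = arc_point j u"
    using circle_arc_point by blast
  have "(\<Sum>i<4. if fst (relator pres e ! i) = g then bump i z else 0) =
      (\<Sum>i<4. if i = j then (if fst (relator pres e ! j) = g then sin (pi * u) / 2 else 0) else 0)"
    using z by (intro sum.cong) (auto simp: bump_arc_point)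
  also have "\<dots> = (if fst (relator pres e ! j) = g then sin (pi * u) / 2 else 0)"
    using z(1) by simp
  finally show ?thesis
    using z by (simp add: char_map2_arc_point edge_function_letter_path)
qed

lemma continuous_map_edge_function: "continuous_map space euclidean (edge_function pres g)"
proof (rule continuous_map_from_complex[OF well_formed_pres])
  have 1: "continuous_on {0..1} (\<lambda>t. if b then sin (pi * t) / 2 else 0)" for b
    by (cases b) (auto intro!: continuous_intros)
  show "continuous_on {0..1} (\<lambda>t. edge_function pres g (char_map1 g' t))" for g'
    by (rule continuous_on_eq[OF 1[of "g' = g"]]) (simp add: edge_function_char_map1 del: char_map1.simps)
  have "continuous_on (cball 0 1) (\<lambda>z. if b then bump j z else 0)" for b j
    by (cases b) (auto intro: continuous_on_bump)
  then have 2: "continuous_on (cball 0 1) (\<lambda>z. \<Sum>j<4. if fst (relator pres e ! j) = g then bump j z else 0)" for e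
    by (intro continuous_on_sum)
  show "continuous_on (cball 0 1) (\<lambda>z. edge_function pres g (char_map2 pres e z))" for e
    by (rule continuous_on_eq[OF 2]) (simp add: edge_function_char_map2)
qed

lemma cell_function_char_map2:
  assumes "z \<in> cball 0 1"
  shows "cell_function r (char_map2 pres e z) = (if e = r then of_real (1 - norm z) else 0)"
    "cell_coordinate r (char_map2 pres e z) = (if e = r then of_real (1 - norm z) * z else 0)"
proof -
  have "cell_function r (letter_path a u) = 0" "cell_coordinate r (letter_path a u) = 0" for a u
    by (cases a; simp)+
  moreover have "\<exists>a u. char_map2 pres e z = letter_path a u" if "norm z = 1"
    using circle_arc_point[OF that] char_map2_arc_point[OF length_relator_pres] by (metis less_imp_le)
  moreover have "norm z = 1 \<or> norm z < 1" using assms by auto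
  ultimately show "cell_function r (char_map2 pres e z) = (if e = r then of_real (1 - norm z) else 0)"
    "cell_coordinate r (char_map2 pres e z) = (if e = r then of_real (1 - norm z) * z else 0)"
    by (auto simp: char_map2_def)
qed

lemma continuous_map_cell_function:
  "continuous_map space euclidean (cell_function r)" "continuous_map space euclidean (cell_coordinate r)"
proof -
  have "cell_function r (char_map1 g t :: ('v, 'e) cell_point) = 0"
    "cell_coordinate r (char_map1 g t :: ('v, 'e) cell_point) = 0" for g t
    by simp_all
  then have 1: "continuous_on {0..1} (\<lambda>t. cell_function r (char_map1 g t :: ('v, 'e) cell_point))"
    "continuous_on {0..1} (\<lambda>t. cell_coordinate r (char_map1 g t :: ('v, 'e) cell_point))" for g
    by (simp_all only: continuous_on_const)
  have "continuous_on (cball 0 1) (\<lambda>z. if b then of_real (1 - norm z) else (0::complex))"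
    "continuous_on (cball 0 1) (\<lambda>z. if b then of_real (1 - norm z) * z else (0::complex))" for b
    by (cases b; auto intro!: continuous_intros)+
  note * = this
  have 2: "continuous_on (cball 0 1) (\<lambda>z. cell_function r (char_map2 pres e z))"
    "continuous_on (cball 0 1) (\<lambda>z. cell_coordinate r (char_map2 pres e z))" for e
    by (rule continuous_on_eq[OF *(1)[of "e = r"]] continuous_on_eq[OF *(2)[of "e = r"]], simp add: cell_function_char_map2)+
  show "continuous_map space euclidean (cell_function r)" "continuous_map space euclidean (cell_coordinate r)"
    using 1 2 by (auto intro!: continuous_map_from_complex[OF well_formed_pres])
qed

lemma edge_function_pos: "0 < t \<Longrightarrow> t < 1 \<Longrightarrow> edge_function P g (Pt1 g t) > 0"
  using sin_gt_zero[of "pi * t"] by simp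

text \<open>\<open>cell_function\<close> detects the 2-cell of a point and
  \<open>cell_coordinate\<close> the place in it; \<open>edge_function\<close> detects the 1-cell
  and \<open>circle_map\<close> the place on it.\<close>

lemma Hausdorff_space_complex: "Hausdorff_space space"
proof (rule Hausdorff_space_separating)
  fix x y assume "x \<in> topspace space" "y \<in> topspace space" and ne: "x \<noteq> y"
  then have pts: "x \<in> complex_points pres" "y \<in> complex_points pres"
    by (simp_all add: topspace_standard_complex[OF well_formed_pres])
  have edge: "continuous_map space euclidean (\<lambda>x. complex_of_real (edge_function pres g x))" for g
    using continuous_map_compose[OF continuous_map_edge_function, of euclidean complex_of_real]
    by (simp add: o_def continuous_on_of_real_id)
  note cont = continuous_map_circle_map edge continuous_map_cell_function
  show "\<exists>f :: _ \<Rightarrow> complex. continuous_map space euclidean f \<and> f x \<noteq> f y"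
  proof (rule ccontr)
    assume no: "\<nexists>f :: _ \<Rightarrow> complex. continuous_map space euclidean f \<and> f x \<noteq> f y"
    have eq: "circle_map x = circle_map y" "edge_function pres g x = edge_function pres g y"
      "cell_function r x = cell_function r y" "cell_coordinate r x = cell_coordinate r y" for g r
      using no cont edge[of g] by (blast, metis of_real_eq_iff, blast, blast)
    have cf: "cell_function r (Pt2 r z) \<noteq> 0" if "norm z < 1" for r and z :: complex
      using that by simp
    have pos: "edge_function pres g (Pt1 g t) > 0" if "0 < t" "t < 1" for g t
      using that by (rule edge_function_pos)
    show False
    proof (cases x)
      case Pt0
      show False
      proof (cases y)
        case (Pt1 g t)
        then have "0 < t" "t < 1" using pts unfolding complex_points_def by auto
        then show False using eq(2)[of g] pos[of t g] Pt1 Pt0 by simp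
      next
        case (Pt2 r z)
        then have "norm z < 1" using pts unfolding complex_points_def by auto
        then show False using eq(3)[of r] Pt2 Pt0 by simp
      qed (use Pt0 ne in simp)
    next
      case (Pt1 g t)
      then have t: "0 < t" "t < 1" using pts unfolding complex_points_def by auto
      show False
      proof (cases y)
        case Pt0
        then show False using eq(2)[of g] pos[OF t, of g] Pt1 by simp
      next
        case y: (Pt1 g' t')
        then have t': "0 < t'" "t' < 1" using pts unfolding complex_points_def by auto
        have "g' = g" using eq(2)[of g] pos[OF t, of g] Pt1 y by (auto split: if_splits)
        moreover obtain n :: int where n: "t = t' + of_int n"
          using eq(1) Pt1 y cis_2pi_eq_imp[of t t'] by auto
        then have "of_int n < (1::real)" "of_int n > (-1::real)" using t t' by auto
        then have "n = 0" by linarith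
        ultimately show False using n ne Pt1 y by simp
      next
        case (Pt2 r z)
        then show False using pts eq(3)[of r] cf[of z r] Pt1 unfolding complex_points_def by auto
      qed
    next
      case (Pt2 r z)
      then have z: "norm z < 1" using pts unfolding complex_points_def by auto
      show False
      proof (cases y)
        case y: (Pt2 r' z')
        have e: "complex_of_real (1 - norm z) = (if r' = r then of_real (1 - norm z') else 0)"
          using eq(3)[of r] unfolding Pt2 y cell_function.simps by (simp only: if_True refl)
        have r: "r' = r"
        proof (rule ccontr)
          assume "r' \<noteq> r"
          then have "1 - norm z = 0" using e by (simp only: if_False of_real_eq_0_iff)
          then show False using z by simp
        qed
        then have n: "1 - norm z = 1 - norm z'" using e by (simp only: if_True of_real_eq_iff refl)
        have "complex_of_real (1 - norm z) * z = of_real (1 - norm z) * z'"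
          using eq(4)[of r] unfolding Pt2 y r cell_coordinate.simps n by (simp only: if_True refl)
        moreover have "complex_of_real (1 - norm z) \<noteq> 0"
          unfolding of_real_eq_0_iff using z by simp
        ultimately have "z = z'" by (simp only: mult_cancel_left simp_thms)
        then show False using ne Pt2 y r by simp
      qed (use eq(3)[of r] cf[OF z, of r] Pt2 in auto)
    qed
  qed
qed

end

section \<open>Collapsing the infinite cyclic cover\<close>

text \<open>The abstract form of an elementary collapse: the cell \<open>\<kappa> ` D\<close> meets the rest of the space
  in the image of a retract of \<open>D\<close>, so it can be pushed into the rest along straight lines.\<close>

lemma collapse_homotopy:
  fixes \<kappa> :: "'d :: euclidean_space \<Rightarrow> 'y"
  assumes Y: "Hausdorff_space Y" and D: "compact D" "convex D"
    and \<kappa>: "continuous_map (top_of_set D) Y \<kappa>"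
    and M: "M retract_of D"
    and B: "closedin Y B" "\<kappa> ` M \<subseteq> B" "\<And>z. z \<in> D - M \<Longrightarrow> \<kappa> z \<notin> B"
    and inj: "inj_on \<kappa> (D - M)"
    and F: "continuous_map Z Y F" "F ` topspace Z \<subseteq> B \<union> \<kappa> ` D"
  obtains F' where "continuous_map Z Y F'" "F' ` topspace Z \<subseteq> B"
    "homotopic_with (\<lambda>h. \<forall>p\<in>topspace Z. F p \<in> B \<longrightarrow> h p = F p) Z Y F F'"
proof -
  obtain r where r: "M \<subseteq> D" "continuous_on D r" "r ` D \<subseteq> M" "\<And>z. z \<in> M \<Longrightarrow> r z = z"
    using M unfolding retract_of_def retraction_def by blast
  define A where "A = B \<union> \<kappa> ` D"
  define d where "d t z = (1 - t) *\<^sub>R z + t *\<^sub>R r z" for t z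
  have dD: "d t z \<in> D" if "t \<in> {0..1}" "z \<in> D" for t z
    unfolding d_def using that r D(2) by (intro convexD_alt) auto
  define J where "J = (\<lambda>(t, y). if y \<in> B then y else \<kappa> (d t (inv_into (D - M) \<kappa> y)))"
  \<comment> \<open>The formula is valid on \<open>M\<close> too: there \<open>r\<close> fixes
    \<open>z\<close>, so the segment is constant, while \<open>J\<close> is the identity on
    \<open>B\<close>.\<close>
  have J\<kappa>: "J (t, \<kappa> z) = \<kappa> (d t z)" if "z \<in> D" for t z
  proof (cases "z \<in> M")
    case True
    then have "d t z = z" unfolding d_def by (simp add: r scaleR_collapse)
    then show ?thesis using True B(2) unfolding J_def by auto
  next
    case False
    then show ?thesis using B(3) that inj unfolding J_def by auto
  qed
  have JB: "J (t, y) = y" if "y \<in> B" for t y using that unfolding J_def by simp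
  have Btop: "B \<subseteq> topspace Y" using B(1) by (rule closedin_subset)
  have \<kappa>top: "\<kappa> z \<in> topspace Y" if "z \<in> D" for z
    using \<kappa> that by (auto simp: continuous_map_def)
  have topA: "topspace (subtopology Y A) = A" using Btop \<kappa>top unfolding A_def by auto
  have comp: "continuous_map U Y (\<lambda>x. \<kappa> (f x))" if "continuous_map U (top_of_set D) f"
    for U :: "(real \<times> 'd) topology" and f
    using continuous_map_compose[OF that \<kappa>] by (simp only: o_def)
  let ?I = "top_of_set {0..1::real}"
  let ?P = "prod_topology ?I (subtopology Y A)"
  \<comment> \<open>Preimages of closed sets are closed: over \<open>B\<close> the map is the
    projection, and over the cell the preimage is the image of the compact set \<open>E\<close>
    under \<open>m\<close>, hence closed in a Hausdorff space.\<close>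
  have contJ: "continuous_map ?P Y J"
    unfolding continuous_map_closedin
  proof (intro conjI allI impI)
    show "J \<in> topspace ?P \<rightarrow> topspace Y"
    proof (clarsimp simp: topA, unfold A_def, elim UnE imageE)
      fix t :: real and y assume "0 \<le> t" "t \<le> 1"
      show "y \<in> B \<Longrightarrow> J (t, y) \<in> topspace Y" using JB Btop by auto
      fix z assume "y = \<kappa> z" "z \<in> D"
      then show "J (t, y) \<in> topspace Y" using J\<kappa> \<kappa>top dD \<open>0 \<le> t\<close> \<open>t \<le> 1\<close> by simp
    qed
    fix K assume K: "closedin Y K"
    define E where "E = {q \<in> {0..1::real} \<times> D. \<kappa> (d (fst q) (snd q)) \<in> K}"
    define m where "m = (\<lambda>q :: real \<times> 'd. (fst q, \<kappa> (snd q)))"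
    have "continuous_on ({0..1::real} \<times> D) (\<lambda>q. d (fst q) (snd q))"
      unfolding d_def by (intro continuous_intros continuous_on_compose2[OF r(2)]) auto
    then have "continuous_map (top_of_set ({0..1::real} \<times> D)) (top_of_set D) (\<lambda>q. d (fst q) (snd q))"
      using dD by auto
    then have "continuous_map (top_of_set ({0..1::real} \<times> D)) Y (\<lambda>q. \<kappa> (d (fst q) (snd q)))"
      by (rule comp)
    then have "closedin (top_of_set ({0..1::real} \<times> D)) E"
      using closedin_continuous_map_preimage[OF _ K] unfolding E_def by fastforce
    then have "compact E"
      using closedin_compact[of "{0..1::real} \<times> D"] D(1) by (auto simp: compact_Times)
    then have "compactin (top_of_set ({0..1::real} \<times> D)) E"
      unfolding compactin_subtopology by (auto simp: E_def)
    moreover have "continuous_map (top_of_set ({0..1::real} \<times> D)) ?P m"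
      unfolding m_def continuous_map_pairwise o_def fst_conv snd_conv
    proof
      show "continuous_map (top_of_set ({0..1::real} \<times> D)) ?I (\<lambda>x. fst x)"
        by (auto intro!: continuous_intros)
      have "continuous_map (top_of_set ({0..1::real} \<times> D)) (top_of_set D) (\<lambda>q. snd q)"
        by (auto intro!: continuous_intros)
      then have "continuous_map (top_of_set ({0..1::real} \<times> D)) Y (\<lambda>x. \<kappa> (snd x))"
        by (rule comp)
      then show "continuous_map (top_of_set ({0..1::real} \<times> D)) (subtopology Y A) (\<lambda>x. \<kappa> (snd x))"
        by (auto simp: continuous_map_in_subtopology A_def)
    qed
    ultimately have "compactin ?P (m ` E)" by (rule image_compactin)
    moreover have "Hausdorff_space ?P"
      unfolding Hausdorff_space_prod_topology
      using Hausdorff_space_subtopology[OF Y] Hausdorff_space_subtopology[OF Hausdorff_space_euclidean] by blast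
    ultimately have "closedin ?P (m ` E)" by (rule compactin_imp_closedin[rotated])
    moreover have "closedin ?P ({0..1} \<times> (B \<inter> K))"
    proof -
      have "closedin (subtopology Y A) (B \<inter> K)"
        unfolding closedin_subtopology using closedin_Int[OF B(1) K] by (intro exI[of _ "B \<inter> K"]) (auto simp: A_def)
      moreover have "closedin ?I {0..1}" using closedin_topspace[of ?I] by simp
      ultimately show ?thesis by (simp add: closedin_prod_Times_iff)
    qed
    ultimately have "closedin ?P (({0..1} \<times> (B \<inter> K)) \<union> m ` E)" by (intro closedin_Un)
    moreover have "{q \<in> topspace ?P. J q \<in> K} = ({0..1} \<times> (B \<inter> K)) \<union> m ` E"
    proof (intro equalityI subsetI)
      fix q assume q: "q \<in> {q \<in> topspace ?P. J q \<in> K}"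
      then obtain t y where ty: "q = (t, y)" "t \<in> {0..1}" "y \<in> A" "J (t, y) \<in> K"
        by (cases q) (auto simp: topA)
      show "q \<in> ({0..1} \<times> (B \<inter> K)) \<union> m ` E"
      proof (cases "y \<in> B")
        case True
        then show ?thesis using ty JB by auto
      next
        case False
        then obtain z where z: "z \<in> D" "y = \<kappa> z" using ty unfolding A_def by auto
        then have "(t, z) \<in> E" using ty J\<kappa> unfolding E_def by auto
        then have "m (t, z) \<in> m ` E" by (rule imageI)
        then show ?thesis using z ty unfolding m_def by simp
      qed
    next
      fix q assume "q \<in> ({0..1} \<times> (B \<inter> K)) \<union> m ` E"
      then show "q \<in> {q \<in> topspace ?P. J q \<in> K}"
      proof
        assume "q \<in> {0..1} \<times> (B \<inter> K)"
        then show ?thesis using JB Btop by (auto simp: A_def)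
      next
        assume "q \<in> m ` E"
        then show ?thesis using J\<kappa> \<kappa>top by (auto simp: A_def m_def E_def)
      qed
    qed
    ultimately show "closedin ?P {q \<in> topspace ?P. J q \<in> K}" by simp
  qed
  define H where "H = (\<lambda>q :: real \<times> _. J (fst q, F (snd q)))"
  have FA: "continuous_map Z (subtopology Y A) F"
    using F unfolding A_def by (auto simp: continuous_map_in_subtopology)
  have "continuous_map (prod_topology ?I Z) ?P (\<lambda>q. (fst q, F (snd q)))"
    unfolding continuous_map_pairwise o_def fst_conv snd_conv
    by (intro conjI continuous_map_fst continuous_map_compose[OF continuous_map_snd FA, unfolded o_def])
  then have H: "continuous_map (prod_topology ?I Z) Y H"
    unfolding H_def by (rule continuous_map_compose[OF _ contJ, unfolded o_def])
  define F' where "F' p = H (1, p)" for p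
  have cF': "continuous_map Z Y F'"
  proof -
    have "continuous_map Z (prod_topology ?I Z) (\<lambda>p. (1, p))"
      by (simp add: continuous_map_pairwise o_def)
    then show ?thesis unfolding F'_def by (rule continuous_map_compose[OF _ H, unfolded o_def])
  qed
  have inA: "F p \<in> B \<or> (\<exists>z\<in>D. F p = \<kappa> z)" if "p \<in> topspace Z" for p
    using F(2) that by auto
  have F'B: "F' p \<in> B" if "p \<in> topspace Z" for p
    using inA[OF that]
  proof
    assume "F p \<in> B" then show ?thesis unfolding F'_def H_def using JB by simp
  next
    assume "\<exists>z\<in>D. F p = \<kappa> z"
    then obtain z where z: "z \<in> D" "F p = \<kappa> z" by blast
    then have "F' p = \<kappa> (r z)" unfolding F'_def H_def using J\<kappa> by (simp add: d_def)
    moreover have "r z \<in> M" using z(1) r(3) by auto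
    ultimately show ?thesis using B(2) by auto
  qed
  have H0: "H (0, p) = F p" if "p \<in> topspace Z" for p
    using inA[OF that] JB J\<kappa> unfolding H_def by (auto simp: d_def)
  have "homotopic_with (\<lambda>h. \<forall>p\<in>topspace Z. F p \<in> B \<longrightarrow> h p = F p) Z Y F F'"
    apply (subst homotopic_with)
     apply simp
    apply (rule exI[of _ H])
    using H H0 JB unfolding F'_def by (auto simp: H_def)
  then show thesis using that[OF cF'] F'B by auto
qed

text \<open>The three closed quarters other than \<open>j\<close>, as a single arc whose parameter
  may run past the full turn \<open>4\<close>: the part of the boundary that remains when side
  \<open>j\<close> is the free one.\<close>

definition rest_arc :: "nat \<Rightarrow> complex set" where
  "rest_arc j = (\<lambda>s. cis (pi / 2 * s)) ` {real j + 1..real j + 4}"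

lemma rest_arc_retract: "rest_arc j retract_of cball 0 1"
proof (rule absolute_retract_homeomorphic_convex_compact)
  let ?S = "{real j + 1..real j + 4}"
  have "inj_on (\<lambda>s. cis (pi / 2 * s)) ?S"
  proof (rule inj_onI)
    fix x y assume xy: "x \<in> ?S" "y \<in> ?S" "cis (pi / 2 * x) = cis (pi / 2 * y)"
    have "cis (2 * pi * (x / 4)) = cis (2 * pi * (y / 4))" using xy(3) by (simp add: mult.commute)
    then obtain n :: int where n: "x / 4 = y / 4 + of_int n"
      by (rule cis_2pi_eq_imp)
    then have "of_int n < (1::real)" "of_int n > (-1::real)" using xy(1,2) by auto
    then have "n = 0" by linarith
    then show "x = y" using n by simp
  qed
  then have "?S homeomorphic rest_arc j"
    unfolding rest_arc_def by (intro homeomorphic_compact) (auto intro!: continuous_intros)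
  then show "rest_arc j homeomorphic ?S" by (rule homeomorphic_sym[THEN iffD1])
  show "rest_arc j \<noteq> {}" "rest_arc j \<subseteq> cball 0 1" by (auto simp: rest_arc_def)
qed auto

lemma arc_point_add_4: "arc_point (j + 4) u = arc_point j u"
  unfolding arc_point_eq power_add by (simp add: power4_eq_xxxx)

lemma rest_arcE:
  assumes "z \<in> rest_arc j" "j < 4"
  obtains i u where "i < 4" "i \<noteq> j" "0 \<le> u" "u \<le> 1" "z = arc_point i u"
proof -
  obtain s where s: "z = cis (pi / 2 * s)" "real j + 1 \<le> s" "s \<le> real j + 4"
    using assms unfolding rest_arc_def by auto
  have "\<exists>n u. j < n \<and> n < j + 4 \<and> 0 \<le> u \<and> u \<le> 1 \<and> s = real n + u"
  proof (cases "s \<le> real j + 2")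
    case True
    then show ?thesis using s by (intro exI[of _ "j + 1"] exI[of _ "s - (real j + 1)"]) auto
  next
    case False
    show ?thesis
    proof (cases "s \<le> real j + 3")
      case True
      then show ?thesis using s False by (intro exI[of _ "j + 2"] exI[of _ "s - (real j + 2)"]) auto
    next
      case F: False
      then show ?thesis using s by (intro exI[of _ "j + 3"] exI[of _ "s - (real j + 3)"]) auto
    qed
  qed
  then obtain n u where n: "j < n" "n < j + 4" "0 \<le> u" "u \<le> 1" "s = real n + u" by blast
  have z: "z = arc_point n u" using s n unfolding arc_point_def by simp
  show thesis
  proof (cases "n < 4")
    case True
    then show thesis using that[of n u] z n by auto
  next
    case False
    then have "z = arc_point (n - 4) u" using z arc_point_add_4[of "n - 4" u] by simp
    then show thesis using that[of "n - 4" u] n False assms(2) by auto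
  qed
qed

lemma circle_minus_rest_arc:
  assumes "norm z = 1" "z \<notin> rest_arc j" "j < 4"
  obtains u where "0 < u" "u < 1" "z = arc_point j u"
proof -
  obtain i u where iu: "i < 4" "0 \<le> u" "u < 1" "z = arc_point i u"
    using circle_arc_point[OF assms(1)] .
  have mem: "arc_point n u \<in> rest_arc j" if "real j + 1 \<le> real n + u" "real n + u \<le> real j + 4" for n
    unfolding rest_arc_def arc_point_def using that by auto
  have "\<not> j < i"
  proof
    assume "j < i"
    then have "real j + 1 \<le> real i" "real i + u \<le> real j + 4" using iu by auto
    then show False using mem[of i] iu assms by auto
  qed
  moreover have "\<not> i < j"
  proof
    assume "i < j"
    then have "real i + 1 \<le> real j" "real j \<le> 3" using assms by auto
    then show False using mem[of "i + 4"] iu assms arc_point_add_4[of i u] by auto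
  qed
  ultimately have "i = j" by simp
  moreover have "u \<noteq> 0"
    using mem[of "j + 4"] iu assms arc_point_add_4[of j u] \<open>i = j\<close> by auto
  ultimately show thesis using that[of u] iu by auto
qed

text \<open>The members of \<open>cell_edges\<close> in the order of the relator, so that quarter
  \<open>j\<close> of the circle maps to side \<open>j\<close>.\<close>

definition cell_side :: "('v, 'e) pre_digraph \<Rightarrow> ('e \<Rightarrow> 'v) \<Rightarrow> 'e \<times> int \<Rightarrow> nat \<Rightarrow> 'v \<times> int" where
  "cell_side G l c j = (case c of (e, k) \<Rightarrow>
     [(l e, k), (tail G e, k + 1), (l e, k + 1), (head G e, k)] ! j)"

lemma cell_edges_eq: "cell_edges G l c = cell_side G l c ` {..<4}"
proof -
  have "{..<4::nat} = {0, 1, 2, 3}" by auto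
  then show ?thesis by (cases c) (auto simp: cell_edges_def cell_side_def)
qed

text \<open>The second component tells apart the lifts of one generator, which agree in the
  first.\<close>

definition edge_map :: "'v \<times> int \<Rightarrow> real \<Rightarrow> ('v, 'e) cell_point \<times> real" where
  "edge_map \<epsilon> t = (char_map1 (fst \<epsilon>) t, real_of_int (snd \<epsilon>) + t)"

definition cell_map ::
    "('v, 'e) pre_digraph \<Rightarrow> ('e \<Rightarrow> 'v) \<Rightarrow> 'e \<times> int \<Rightarrow> complex \<Rightarrow> ('v, 'e) cell_point \<times> real" where
  "cell_map G l c z = (char_map2 (log_presentation G l) (fst c) z, real_of_int (snd c) + height z)"

text \<open>The union of finitely many cells of the infinite cyclic cover, viewed inside the product of
  the complex with the line.\<close>

definition body ::
    "('v, 'e) pre_digraph \<Rightarrow> ('e \<Rightarrow> 'v) \<Rightarrow> ('e \<times> int) set \<Rightarrow> ('v \<times> int) set \<Rightarrow> int \<Rightarrow>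
      (('v, 'e) cell_point \<times> real) set" where
  "body G l C E N = (\<Union>c\<in>C. cell_map G l c ` cball 0 1) \<union> (\<Union>\<epsilon>\<in>E. edge_map \<epsilon> ` {0..1}) \<union>
     (\<lambda>k. (Pt0, real_of_int k)) ` {-N..N}"

lemma edge_map_eq_Pt1D:
  assumes "edge_map \<epsilon> s = (Pt1 g t, real_of_int k + t)"
  shows "\<epsilon> = (g, k)" "s = t"
  using assms by (auto simp: edge_map_def prod_eq_iff split: if_splits)

lemma edge_map_interior: "0 < t \<Longrightarrow> t < 1 \<Longrightarrow> edge_map \<epsilon> t = (Pt1 (fst \<epsilon>) t, real_of_int (snd \<epsilon>) + t)"
  by (simp add: edge_map_def)

section \<open>Elementary collapses in the cyclic cover\<close>

context labeled_oriented_graph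
begin

text \<open>The full product with the line. The cyclic cover is the part where the real coordinate
  lifts \<open>circle_map\<close>, and every \<open>body\<close> over cells and edges of
  \<open>G\<close> lies in it; the homotopies are projected to the first factor at the end.\<close>

abbreviation cover :: "(('v, 'e) cell_point \<times> real) topology" where
  "cover \<equiv> prod_topology space euclideanreal"

lemma Hausdorff_space_cover: "Hausdorff_space cover"
  unfolding Hausdorff_space_prod_topology using Hausdorff_space_complex Hausdorff_space_euclidean by blast

lemma continuous_map_edge_map:
  assumes "fst \<epsilon> \<in> verts G"
  shows "continuous_map (top_of_set {0..1}) cover (edge_map \<epsilon>)"
  unfolding continuous_map_pairwise o_def edge_map_def fst_conv snd_conv
proof
  show "continuous_map (top_of_set {0..1}) space (\<lambda>t. char_map1 (fst \<epsilon>) t)"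
    using continuous_map_char_map1[OF well_formed_pres, of "fst \<epsilon>"] assms by (simp del: char_map1.simps)
  show "continuous_map (top_of_set {0..1}) euclideanreal (\<lambda>t. real_of_int (snd \<epsilon>) + t)"
    by (auto intro!: continuous_intros)
qed

lemma continuous_map_cell_map:
  assumes "fst c \<in> arcs G"
  shows "continuous_map (top_of_set (cball 0 1)) cover (cell_map G l c)"
  unfolding continuous_map_pairwise o_def cell_map_def fst_conv snd_conv
proof
  show "continuous_map (top_of_set (cball 0 1)) space (\<lambda>z. char_map2 pres (fst c) z)"
    using continuous_map_char_map2[OF well_formed_pres, of "fst c"] assms by simp
  show "continuous_map (top_of_set (cball 0 1)) euclideanreal (\<lambda>z. real_of_int (snd c) + height z)"
    by (auto intro!: continuous_intros continuous_on_height)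
qed

lemma Pt0_in_topspace: "Pt0 \<in> topspace space"
  by (simp add: topspace_standard_complex[OF well_formed_pres] complex_points_def)

lemma closedin_body:
  assumes "finite C" "finite E" "fst ` C \<subseteq> arcs G" "fst ` E \<subseteq> verts G"
  shows "closedin cover (body G l C E N)"
proof (rule compactin_imp_closedin[OF Hausdorff_space_cover])
  have "compactin cover (cell_map G l c ` cball 0 1)" if "c \<in> C" for c
    using image_compactin[OF _ continuous_map_cell_map, of "cball 0 1" c] assms that
    by (auto simp: compactin_subtopology)
  moreover have "compactin cover (edge_map \<epsilon> ` {0..1})" if "\<epsilon> \<in> E" for \<epsilon>
    using image_compactin[OF _ continuous_map_edge_map, of "{0..1}" \<epsilon>] assms that
    by (auto simp: compactin_subtopology)
  moreover have "compactin cover ((\<lambda>k. (Pt0, real_of_int k)) ` {-N..N})"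
    by (rule finite_imp_compactin) (use Pt0_in_topspace in auto)
  ultimately show "compactin cover (body G l C E N)"
    unfolding body_def using assms by (intro compactin_Un compactin_Union) auto
qed

lemma cell_map_arc_point:
  assumes "j < 4" "0 \<le> u" "u \<le> 1"
  shows "cell_map G l c (arc_point j u) = edge_map (cell_side G l c j) (if j < 2 then u else 1 - u)"
  using four_cases[OF assms(1)]
  by (elim disjE; cases c)
    (use assms in \<open>auto simp: cell_map_def edge_map_def cell_side_def char_map2_arc_point height_arc_point
       relator_pres simp del: char_map1.simps\<close>)

lemma cell_map_boundary:
  assumes "norm z = 1"
  obtains j t where "j < 4" "0 \<le> t" "t \<le> 1" "cell_map G l c z = edge_map (cell_side G l c j) t"
proof -
  obtain j u where "j < 4" "0 \<le> u" "u < 1" "z = arc_point j u"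
    using circle_arc_point[OF assms] .
  then show thesis
    using that[of j "if j < 2 then u else 1 - u"] cell_map_arc_point[of j u c] by auto
qed

lemma Pt1_in_cell:
  assumes "(Pt1 g t, real_of_int k + t) \<in> cell_map G l c ` cball 0 1"
  shows "(g, k) \<in> cell_edges G l c"
proof -
  obtain z where z: "norm z \<le> 1" "cell_map G l c z = (Pt1 g t, real_of_int k + t)"
    using assms by auto
  then have "norm z = 1" by (auto simp: cell_map_def char_map2_def split: if_splits)
  then obtain j s where "j < 4" "cell_map G l c z = edge_map (cell_side G l c j) s"
    by (rule cell_map_boundary)
  then have "cell_side G l c j = (g, k)" using z edge_map_eq_Pt1D(1) by metis
  then show ?thesis unfolding cell_edges_eq using \<open>j < 4\<close> by force
qed

lemma Pt1_in_body:
  assumes "(Pt1 g t, real_of_int k + t) \<in> body G l C E N"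
  shows "(g, k) \<in> E \<or> (\<exists>c\<in>C. (g, k) \<in> cell_edges G l c)"
  using assms unfolding body_def
proof (elim UnE UN_E)
  fix c assume "c \<in> C" "(Pt1 g t, real_of_int k + t) \<in> cell_map G l c ` cball 0 1"
  then show ?thesis using Pt1_in_cell by metis
next
  fix \<epsilon> assume \<epsilon>: "\<epsilon> \<in> E" "(Pt1 g t :: ('v, 'e) cell_point, real_of_int k + t) \<in> edge_map \<epsilon> ` {0..1}"
  from \<epsilon>(2) obtain s where "(Pt1 g t :: ('v, 'e) cell_point, real_of_int k + t) = edge_map \<epsilon> s"
    by blast
  then have "\<epsilon> = (g, k)" by (rule edge_map_eq_Pt1D(1)[OF sym])
  then show ?thesis using \<epsilon> by simp
qed auto

lemma Pt2_in_body:
  assumes "(Pt2 e z, real_of_int k + height z) \<in> body G l C E N"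
  shows "(e, k) \<in> C"
proof -
  have "\<exists>c\<in>C. (Pt2 e z, real_of_int k + height z) \<in> cell_map G l c ` cball 0 1"
    using assms unfolding body_def
  proof (elim UnE UN_E)
    fix c assume "c \<in> C" "(Pt2 e z, real_of_int k + height z) \<in> cell_map G l c ` cball 0 1"
    then show ?thesis by (rule bexI[rotated])
  next
    fix \<epsilon> assume "(Pt2 e z :: ('v, 'e) cell_point, real_of_int k + height z) \<in> edge_map \<epsilon> ` {0..1}"
    then obtain t where "(Pt2 e z :: ('v, 'e) cell_point, real_of_int k + height z) = edge_map \<epsilon> t"
      by blast
    then have False by (auto simp: edge_map_def split: if_splits)
    then show ?thesis ..
  qed auto
  then obtain c z' where c: "c \<in> C" "(Pt2 e z, real_of_int k + height z) = cell_map G l c z'"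
    by blast
  have n: "norm z' < 1"
  proof (rule ccontr)
    assume "\<not> norm z' < 1"
    then obtain w s where "cell_map G l c z' = (word_path w s, real_of_int (snd c) + height z')"
      by (auto simp: cell_map_def char_map2_def)
    moreover have "word_path w s \<noteq> Pt2 e z"
    proof -
      have "letter_path a u \<noteq> Pt2 e z" for a u by (cases a) auto
      then show ?thesis unfolding word_path_def Let_def by (metis cell_point.distinct(3))
    qed
    ultimately show False using c by simp
  qed
  then have "fst c = e" "z' = z" "real_of_int (snd c) = real_of_int k"
    using c(2) by (auto simp: cell_map_def char_map2_def)
  then show ?thesis using c(1) by (cases c) auto
qed

text \<open>The two copies of the label sit at different levels, and interior reducedness separates
  the upper one from the tail and the lower one from the head.\<close>

lemma cell_side_inj:
  assumes "interior_reduced G l" "fst c \<in> arcs G" "i < 4" "j < 4" "i \<noteq> j"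
  shows "cell_side G l c i \<noteq> cell_side G l c j"
proof -
  have "l (fst c) \<noteq> tail G (fst c)" "l (fst c) \<noteq> head G (fst c)"
    using assms unfolding interior_reduced_def by auto
  then show ?thesis
    using four_cases[OF assms(3)] four_cases[OF assms(4)] assms(5)
    by (cases c) (elim disjE; simp add: cell_side_def)
qed

text \<open>An instance of \<open>collapse_homotopy\<close> with \<open>M\<close> the arc of the
  other three sides. Those sides stay in the body because none of them is \<epsilon>, by
  \<open>cell_side_inj\<close>; freeness keeps the open side \<open>j\<close> out of it.\<close>

lemma collapse_cell:
  assumes ir: "interior_reduced G l"
    and fin: "finite C" "finite E" "fst ` C \<subseteq> arcs G" "fst ` E \<subseteq> verts G"
    and sub: "\<And>c. c \<in> C \<Longrightarrow> cell_edges G l c \<subseteq> E"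
    and c: "c \<in> C" and \<epsilon>: "\<epsilon> \<in> cell_edges G l c"
    and free: "\<And>c'. c' \<in> C \<Longrightarrow> c' \<noteq> c \<Longrightarrow> \<epsilon> \<notin> cell_edges G l c'"
    and F: "continuous_map Z cover F" "F ` topspace Z \<subseteq> body G l C E N"
  obtains F' where "continuous_map Z cover F'" "F' ` topspace Z \<subseteq> body G l (C - {c}) (E - {\<epsilon>}) N"
    "homotopic_with (\<lambda>h. \<forall>p\<in>topspace Z. F p \<in> body G l (C - {c}) (E - {\<epsilon>}) N \<longrightarrow> h p = F p) Z cover F F'"
proof -
  let ?B = "body G l (C - {c}) (E - {\<epsilon>}) N"
  obtain e k where ek: "c = (e, k)" by (cases c)
  obtain j where j: "j < 4" "\<epsilon> = cell_side G l c j" using \<epsilon> unfolding cell_edges_eq by auto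
  have carc: "fst c \<in> arcs G" using fin c by auto
  have clo: "closedin cover ?B" by (rule closedin_body) (use fin in auto)
  have rest: "cell_map G l c ` rest_arc j \<subseteq> ?B"
  proof
    fix y assume "y \<in> cell_map G l c ` rest_arc j"
    then obtain z where z: "z \<in> rest_arc j" "y = cell_map G l c z" by auto
    obtain i u where i: "i < 4" "i \<noteq> j" "0 \<le> u" "u \<le> 1" "z = arc_point i u"
      using rest_arcE[OF z(1) j(1)] .
    have "cell_side G l c i \<in> E - {\<epsilon>}"
      using sub[OF c] i(1,2) j cell_side_inj[OF ir carc i(1) j(1) i(2)] unfolding cell_edges_eq by auto
    moreover have "y \<in> edge_map (cell_side G l c i) ` {0..1}"
      using z i cell_map_arc_point[of i u c] by auto
    ultimately show "y \<in> ?B" unfolding body_def by blast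
  qed
  have interior: "norm z < 1 \<or> (\<exists>t. 0 < t \<and> t < 1 \<and> z = arc_point j (if j < 2 then t else 1 - t) \<and>
      cell_map G l c z = (Pt1 (fst \<epsilon>) t, real_of_int (snd \<epsilon>) + t))"
    if z: "z \<in> cball 0 1 - rest_arc j" for z
  proof (cases "norm z < 1")
    case False
    then have "norm z = 1" using z by auto
    then obtain u where u: "0 < u" "u < 1" "z = arc_point j u"
      using circle_minus_rest_arc[of z j] z j by auto
    define t where "t = (if j < 2 then u else 1 - u)"
    have "0 < t" "t < 1" "u = (if j < 2 then t else 1 - t)" using u unfolding t_def by auto
    moreover have "cell_map G l c z = edge_map \<epsilon> t"
      using cell_map_arc_point[OF j(1), of u c] u j unfolding t_def by simp
    ultimately show ?thesis using u edge_map_interior by metis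
  qed simp
  have Pt2: "cell_map G l c z = (Pt2 e z, real_of_int k + height z)" if "norm z < 1" for z
    using that ek by (simp add: cell_map_def char_map2_def)
  have out: "cell_map G l c z \<notin> ?B" if z: "z \<in> cball 0 1 - rest_arc j" for z
    using interior[OF z]
  proof
    assume "norm z < 1"
    then show ?thesis using Pt2 Pt2_in_body[of e z k "C - {c}"] ek by auto
  next
    assume "\<exists>t. 0 < t \<and> t < 1 \<and> z = arc_point j (if j < 2 then t else 1 - t) \<and>
      cell_map G l c z = (Pt1 (fst \<epsilon>) t, real_of_int (snd \<epsilon>) + t)"
    then obtain t where t: "cell_map G l c z = (Pt1 (fst \<epsilon>) t, real_of_int (snd \<epsilon>) + t)" by blast
    show ?thesis
    proof
      assume "cell_map G l c z \<in> ?B"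
      then have "\<epsilon> \<in> E - {\<epsilon>} \<or> (\<exists>c'\<in>C - {c}. \<epsilon> \<in> cell_edges G l c')"
        using Pt1_in_body[of "fst \<epsilon>" t "snd \<epsilon>" "C - {c}" "E - {\<epsilon>}" N] unfolding t by simp
      then show False using free by blast
    qed
  qed
  have inj: "inj_on (cell_map G l c) (cball 0 1 - rest_arc j)"
  proof (rule inj_onI)
    fix x y assume xy: "x \<in> cball 0 1 - rest_arc j" "y \<in> cball 0 1 - rest_arc j" "cell_map G l c x = cell_map G l c y"
    show "x = y"
    proof (cases "norm x < 1")
      case True
      then have "norm y < 1" using interior[OF xy(2)] Pt2[of x] xy(3) by fastforce
      then show ?thesis using Pt2 True xy(3) by simp
    next
      case False
      then obtain t where t: "x = arc_point j (if j < 2 then t else 1 - t)"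
        "cell_map G l c x = (Pt1 (fst \<epsilon>) t, real_of_int (snd \<epsilon>) + t)"
        using interior[OF xy(1)] by blast
      then have "\<not> norm y < 1" using Pt2[of y] xy(3) by auto
      then obtain t' where t': "y = arc_point j (if j < 2 then t' else 1 - t')"
        "cell_map G l c y = (Pt1 (fst \<epsilon>) t', real_of_int (snd \<epsilon>) + t')"
        using interior[OF xy(2)] by blast
      have "t = t'" using t(2) t'(2) xy(3) by simp
      then show ?thesis using t(1) t'(1) by simp
    qed
  qed
  have edge: "edge_map \<epsilon> ` {0..1} \<subseteq> cell_map G l c ` cball 0 1"
  proof
    fix y :: "('v, 'e) cell_point \<times> real"
    assume "y \<in> edge_map \<epsilon> ` {0..1}"
    then obtain t where t: "t \<in> {0..1}" "y = edge_map \<epsilon> t" by auto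
    then have "y = cell_map G l c (arc_point j (if j < 2 then t else 1 - t))"
      using cell_map_arc_point[OF j(1), of "if j < 2 then t else 1 - t" c] j by auto
    then show "y \<in> cell_map G l c ` cball 0 1" by (intro image_eqI) auto
  qed
  have "body G l C E N \<subseteq> ?B \<union> cell_map G l c ` cball 0 1"
    unfolding body_def[of G l C]
  proof (intro Un_least UN_least)
    fix c' assume "c' \<in> C"
    then show "cell_map G l c' ` cball 0 1 \<subseteq> ?B \<union> cell_map G l c ` cball 0 1"
      unfolding body_def by (cases "c' = c") (simp, blast)
  next
    fix \<epsilon>' assume "\<epsilon>' \<in> E"
    then show "edge_map \<epsilon>' ` {0..1} \<subseteq> ?B \<union> cell_map G l c ` cball 0 1"
      using edge unfolding body_def by (cases "\<epsilon>' = \<epsilon>") (simp add: le_supI2, blast)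
  next
    show "(\<lambda>k. (Pt0, real_of_int k)) ` {- N..N} \<subseteq> ?B \<union> cell_map G l c ` cball 0 1"
      unfolding body_def by blast
  qed
  then have F2: "F ` topspace Z \<subseteq> ?B \<union> cell_map G l c ` cball 0 1"
    using F(2) by (rule order_trans[rotated])
  show thesis
    by (rule collapse_homotopy[OF Hausdorff_space_cover compact_cball convex_cball continuous_map_cell_map[OF carc]
      rest_arc_retract clo rest out inj F(1) F2]) (assumption | rule that)+
qed

end

lemma (in extremal_lot) collapse_to_graph:
  assumes "finite C" "finite E" "fst ` C \<subseteq> arcs G" "fst ` E \<subseteq> verts G"
    and "\<And>c. c \<in> C \<Longrightarrow> cell_edges G l c \<subseteq> E"
    and "continuous_map Z cover F" "F ` topspace Z \<subseteq> body G l C E N"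
    and Q: "Q \<subseteq> topspace Z" "\<And>p. p \<in> Q \<Longrightarrow> F p = (Pt0, real_of_int k)" "\<bar>k\<bar> \<le> N"
  shows "\<exists>F' E'. fst ` E' \<subseteq> verts G \<and> F' ` topspace Z \<subseteq> body G l {} E' N \<and>
    homotopic_with (\<lambda>h. \<forall>p\<in>Q. h p = (Pt0, real_of_int k)) Z cover F F'"
  using assms(1-7) Q(2)
proof (induction "card C" arbitrary: C E F)
  case 0
  then have "C = {}" by simp
  then show ?case
    using 0 by (intro exI[of _ F] exI[of _ E]) auto
next
  case (Suc n)
  have "C \<noteq> {}" using Suc(2) by auto
  then obtain c \<epsilon> where c: "c \<in> C" "\<epsilon> \<in> cell_edges G l c"
    and free: "\<And>c'. c' \<in> C \<Longrightarrow> c' \<noteq> c \<Longrightarrow> \<epsilon> \<notin> cell_edges G l c'"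
    using ex_free_edge[OF Suc(3) _ Suc(5)] by blast
  let ?B = "body G l (C - {c}) (E - {\<epsilon>}) N"
  obtain F1 where F1: "continuous_map Z cover F1" "F1 ` topspace Z \<subseteq> ?B"
    "homotopic_with (\<lambda>h. \<forall>p\<in>topspace Z. F p \<in> ?B \<longrightarrow> h p = F p) Z cover F F1"
    using collapse_cell[OF ir Suc(3-7) c free Suc(8,9)] by blast
  have "k \<in> {-N..N}" using Q(3) by auto
  \<comment> \<open>\<open>body\<close> lists the vertices separately from the edges, so the image
    point of \<open>Q\<close> survives every removal and is never moved.\<close>
  then have base: "(Pt0, real_of_int k) \<in> ?B" unfolding body_def by (intro UnI2 imageI)
  have hom: "homotopic_with (\<lambda>h. \<forall>p\<in>Q. h p = (Pt0, real_of_int k)) Z cover F F1"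
    by (rule homotopic_with_mono[OF F1(3)]) (use Q(1) Suc(10) base in auto)
  then have F1Q: "F1 p = (Pt0, real_of_int k)" if "p \<in> Q" for p
    using homotopic_with_imp_property[OF hom] that by blast
  have "\<exists>F' E'. fst ` E' \<subseteq> verts G \<and> F' ` topspace Z \<subseteq> body G l {} E' N \<and>
    homotopic_with (\<lambda>h. \<forall>p\<in>Q. h p = (Pt0, real_of_int k)) Z cover F1 F'"
  proof (rule Suc(1)[of "C - {c}" "E - {\<epsilon>}"])
    show "n = card (C - {c})" using Suc(2,3) c by simp
    show "cell_edges G l c' \<subseteq> E - {\<epsilon>}" if "c' \<in> C - {c}" for c'
      using Suc(7)[of c'] free[of c'] that by auto
  qed (use Suc F1 F1Q in auto)
  then show ?case using homotopic_with_trans[OF hom] by blast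
qed

section \<open>Maps of a square into a graph\<close>

fun reduced :: "'g word \<Rightarrow> bool" where
  "reduced [] = True"
| "reduced (a # w) = (reduced w \<and> (w \<noteq> [] \<longrightarrow> hd w \<noteq> (fst a, \<not> snd a)))"

text \<open>The exponent sum added to \<open>k\<close>: the real coordinate of the tree vertex
  \<open>w\<close> when the root has coordinate \<open>k\<close>.\<close>

fun level :: "int \<Rightarrow> 'g word \<Rightarrow> int" where
  "level k [] = k"
| "level k (a # w) = level k w + (if snd a then 1 else -1)"

text \<open>Words list their letters from last to first, so suffixes are the vertices on the way back to
  the root of the Cayley tree.  The point at distance \<open>t\<close> along the last edge of \<open>u\<close> is encoded by
  how much of each edge (named by its far vertex) lies between it and the root.\<close>

definition tree_point :: "'g word \<Rightarrow> real \<Rightarrow> 'g word \<Rightarrow> real" where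
  "tree_point u t v = (if v = [] then 0 else if v = u then t else if strict_suffix v u then 1 else 0)"

text \<open>The inverse of the projection on the open star of the tree vertex \<open>w\<close>. A
  point inside an edge, at distance \<tau> from the vertex, is reached by going back on the last
  edge of \<open>w\<close> if the direction cancels its first letter, and by a new edge
  otherwise.\<close>

definition tree_lift :: "int \<Rightarrow> 'g word \<Rightarrow> ('g, 'r) cell_point \<Rightarrow> real \<Rightarrow> 'g word \<Rightarrow> real" where
  "tree_lift k w x \<theta> = (case x of
     Pt1 g s \<Rightarrow> (let b = (\<theta> > level k w); \<tau> = \<bar>\<theta> - level k w\<bar>
       in if w \<noteq> [] \<and> hd w = (g, \<not> b) then tree_point w (1 - \<tau>) else tree_point ((g, b) # w) \<tau>)
   | _ \<Rightarrow> tree_point w 1)"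

text \<open>The projection to the complex of the geodesic from the root to \<open>v\<close>, by arc
  length. Cutting it off early is what contracts the tree.\<close>

fun tree_path :: "'g word \<Rightarrow> real \<Rightarrow> ('g, 'r) cell_point" where
  "tree_path [] c = Pt0"
| "tree_path (a # v) c = (if c \<le> real (length v) then tree_path v c else letter_path a (c - real (length v)))"

lemma tree_path_end: "tree_path v (real (length v)) = Pt0"
  by (cases v) auto

lemma tree_path_0: "tree_path v 0 = Pt0"
  by (induction v) auto

definition depth :: "'g word \<Rightarrow> real \<Rightarrow> real" where
  "depth u t = (if u = [] then 0 else real (length u) - 1 + t)"

lemma tree_path_depth: "0 \<le> t \<Longrightarrow> tree_path u (depth u t) = (if u = [] then Pt0 else letter_path (hd u) t)"
  by (cases u) (auto simp: depth_def tree_path_end)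

lemma suffix_ConsE:
  assumes "strict_suffix w u"
  obtains a where "suffix (a # w) u"
proof -
  obtain zs where zs: "u = zs @ w" "zs \<noteq> []"
    using assms by (auto simp: strict_suffix_def suffix_def)
  then have "u = butlast zs @ (last zs # w)" by simp
  then show thesis using that[of "last zs"] by (auto simp: suffix_def)
qed

lemma level_Cons_ne: "level k (a # w) \<noteq> level k w"
  by simp

text \<open>A tree point does not determine \<open>u\<close> and \<open>t\<close>: the start
  \<open>t = 0\<close> of the edge \<open>u\<close> is also the end of the edge \<open>tl u\<close>.
  The positive coordinates recover the word once this ambiguity is normalised.\<close>

lemma tree_point_support:
  assumes "0 \<le> t"
  shows "{v. tree_point u t v > 0} = {v. v \<noteq> [] \<and> suffix v (if u \<noteq> [] \<and> t = 0 then tl u else u)}"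
proof (cases "u \<noteq> [] \<and> t = 0")
  case True
  then obtain a w where u: "u = a # w" by (cases u) auto
  have "v \<noteq> u \<and> strict_suffix v u \<longleftrightarrow> suffix v w" for v
    unfolding u strict_suffix_def suffix_Cons
    by (auto simp: suffix_def)
  then show ?thesis using True u by (auto simp: tree_point_def)
next
  case False
  then show ?thesis using assms by (auto simp: tree_point_def strict_suffix_def)
qed

lemma tree_path_normal:
  fixes u :: "'g word" and t c :: real
  assumes "0 \<le> t" "0 \<le> c"
  defines "n \<equiv> (if u \<noteq> [] \<and> t = 0 then tl u else u)"
  shows "tree_path u (min c (depth u t)) = tree_path n (min c (depth n (tree_point u t n)))"
proof (cases "u \<noteq> [] \<and> t = 0")
  case True
  then obtain a w where u: "u = a # w" by (cases u) auto
  have d: "depth u t = real (length w)" using True u by (simp add: depth_def)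
  have "depth w (tree_point u t w) = real (length w)"
    unfolding depth_def tree_point_def u by (auto simp: strict_suffix_def suffix_def)
  then show ?thesis using True d unfolding n_def u by simp
next
  case False
  then have "n = u" unfolding n_def by (rule if_not_P)
  then show ?thesis by (simp add: depth_def tree_point_def)
qed

text \<open>The cut-off geodesic depends on the tree point alone, so pieces of the contraction given
  by different words agree where they overlap.\<close>

lemma tree_path_unique:
  assumes "0 \<le> t" "0 \<le> t'" "0 \<le> c" "tree_point u t = tree_point u' t'"
  shows "(tree_path u (min c (depth u t)) :: ('g, 'r) cell_point) = tree_path u' (min c (depth u' t'))"
proof -
  define n where "n = (if u \<noteq> [] \<and> t = 0 then tl u else u)"
  define n' where "n' = (if u' \<noteq> [] \<and> t' = 0 then tl u' else u')"
  have "{v. v \<noteq> [] \<and> suffix v n} = {v. v \<noteq> [] \<and> suffix v n'}"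
    using tree_point_support[OF assms(1), of u] tree_point_support[OF assms(2), of u'] assms(4)
    unfolding n_def n'_def by simp
  then have "v \<noteq> [] \<Longrightarrow> suffix v n \<longleftrightarrow> suffix v n'" for v by blast
  then have "n = n'"
    by (metis suffix_order.antisym suffix_order.refl Nil_suffix)
  moreover have "(tree_path u (min c (depth u t)) :: ('g, 'r) cell_point) = tree_path n (min c (depth n (tree_point u t n)))"
    unfolding n_def by (rule tree_path_normal[OF assms(1,3)])
  moreover have "(tree_path u' (min c (depth u' t')) :: ('g, 'r) cell_point) = tree_path n' (min c (depth n' (tree_point u' t' n')))"
    unfolding n'_def by (rule tree_path_normal[OF assms(2,3)])
  ultimately show ?thesis using assms(4) by simp
qed

text \<open>The pair of \<open>f\<close> and \<theta> is a map of the square into the 1-skeleton of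
  the cyclic cover, constant on the frontier.\<close>

locale graph_map = labeled_oriented_graph G l for G :: "('v, 'e) pre_digraph" and l +
  fixes f :: "real \<times> real \<Rightarrow> ('v, 'e) cell_point" and \<theta> :: "real \<times> real \<Rightarrow> real" and k0 :: int
  assumes cont_f: "continuous_map (top_of_set unit_square) space f"
    and cont_\<theta>: "continuous_on unit_square \<theta>"
    and graph: "p \<in> unit_square \<Longrightarrow> (f p = Pt0 \<and> \<theta> p \<in> \<int>) \<or>
      (\<exists>g\<in>verts G. \<exists>s n. 0 < s \<and> s < 1 \<and> f p = Pt1 g s \<and> \<theta> p = of_int n + s)"
    and base: "p \<in> frontier unit_square \<Longrightarrow> f p = Pt0 \<and> \<theta> p = of_int k0"
begin

abbreviation letters :: "('v \<times> bool) set" where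
  "letters \<equiv> verts G \<times> UNIV"

abbreviation sec :: "'v word \<Rightarrow> real \<times> real \<Rightarrow> 'v word \<Rightarrow> real" where
  "sec w p \<equiv> tree_lift k0 w (f p) (\<theta> p)"

definition near :: "'v word \<Rightarrow> real \<times> real \<Rightarrow> bool" where
  "near w p \<longleftrightarrow> reduced w \<and> set w \<subseteq> letters \<and> \<bar>\<theta> p - level k0 w\<bar> < 1"

lemma point_cases:
  assumes "p \<in> unit_square" "\<bar>\<theta> p - of_int k\<bar> < 1"
  obtains "f p = Pt0" "\<theta> p = of_int k"
  | g s where "g \<in> verts G" "0 < s" "s < 1" "f p = Pt1 g s" "\<theta> p = of_int k + s"
  | g s where "g \<in> verts G" "0 < s" "s < 1" "f p = Pt1 g s" "\<theta> p = of_int k - 1 + s"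
  using graph[OF assms(1)]
proof (elim disjE conjE bexE exE)
  assume a: "f p = Pt0" "\<theta> p \<in> \<int>"
  then obtain n where "\<theta> p = of_int n" by (auto elim: Ints_cases)
  moreover have "n = k" using assms(2) calculation by linarith
  ultimately show thesis using that(1) a by simp
next
  fix g s n assume a: "g \<in> verts G" "0 < s" "s < 1" "f p = Pt1 g s" "\<theta> p = of_int n + s"
  have "n = k \<or> n = k - 1" using assms(2) a by linarith
  then show thesis using that(2,3) a by auto
qed

lemma sec_cases:
  assumes p: "p \<in> unit_square" and w: "near w p"
  obtains "f p = Pt0" "sec w p = tree_point w 1" "\<theta> p = level k0 w"
  | g b \<tau> where "g \<in> verts G" "0 < \<tau>" "\<tau> < 1" "w \<noteq> []" "hd w = (g, \<not> b)" "sec w p = tree_point w (1 - \<tau>)"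
      "f p = letter_path (g, b) \<tau>" "\<theta> p = real_of_int (level k0 w) + (if b then \<tau> else - \<tau>)"
  | g b \<tau> where "g \<in> verts G" "0 < \<tau>" "\<tau> < 1" "w \<noteq> [] \<longrightarrow> hd w \<noteq> (g, \<not> b)" "sec w p = tree_point ((g, b) # w) \<tau>"
      "f p = letter_path (g, b) \<tau>" "\<theta> p = real_of_int (level k0 w) + (if b then \<tau> else - \<tau>)"
proof -
  have "\<bar>\<theta> p - of_int (level k0 w)\<bar> < 1" using w unfolding near_def by simp
  with p show thesis
  proof (cases rule: point_cases)
    case 1
    then show thesis using that(1) by (simp add: tree_lift_def)
  next
    case (2 g s)
    then show thesis
      using that(2)[of g s True] that(3)[of g s True] by (cases "w \<noteq> [] \<and> hd w = (g, \<not> True)") (auto simp: tree_lift_def Let_def)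
  next
    case (3 g s)
    have "\<bar>s - 1\<bar> = 1 - s" using 3 by simp
    then show thesis
      using that(2)[of g "1 - s" False] that(3)[of g "1 - s" False] 3
      by (cases "w \<noteq> [] \<and> hd w = (g, \<not> False)") (auto simp: tree_lift_def Let_def)
  qed
qed

text \<open>A point inside an edge lies in the open stars of both ends, whose levels are the two
  integers next to \<theta>. The same tree point can therefore be written relative to the end of the
  prescribed level.\<close>

lemma rebase:
  assumes p: "p \<in> unit_square" and w: "near w p" and k: "\<bar>\<theta> p - of_int k\<bar> < 1"
  obtains w' where "near w' p" "level k0 w' = k" "sec w' p = sec w p"
proof (cases "level k0 w = k")
  case True
  then show thesis using that w by blast
next
  case False
  have w': "reduced w" "set w \<subseteq> letters" using w unfolding near_def by auto
  show thesis
    using p w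
  proof (cases rule: sec_cases)
    case 1
    then show thesis using k False by linarith
  next
    case (2 g b \<tau>)
    then obtain v where v: "w = (g, \<not> b) # v" by (cases w) auto
    have lv: "level k0 v = level k0 w + (if b then 1 else -1)" unfolding v by auto
    have vk: "level k0 v = k" using k 2 False unfolding lv by (cases b) (simp; linarith)+
    have near: "near v p" using w' k vk v unfolding near_def by auto
    have hd: "v \<noteq> [] \<longrightarrow> hd v \<noteq> (g, b)" using w'(1) unfolding v by auto
    obtain s where "f p = Pt1 g s" using 2 by (cases b) auto
    moreover have "(\<theta> p > level k0 v) = (\<not> b)" "\<bar>\<theta> p - level k0 v\<bar> = 1 - \<tau>"
      using 2(2,3,8) unfolding lv by (cases b; simp)+
    ultimately have "sec v p = tree_point w (1 - \<tau>)"
      using hd by (auto simp add: tree_lift_def v Let_def)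
    then show thesis using that[OF near vk] 2 by simp
  next
    case (3 g b \<tau>)
    let ?v = "(g, b) # w"
    have vk: "level k0 ?v = k" using k 3 False by (cases b) (simp; linarith)+
    have near: "near ?v p" using w' k vk 3 unfolding near_def by auto
    obtain s where "f p = Pt1 g s" using 3 by (cases b) auto
    moreover have "(\<theta> p > level k0 ?v) = (\<not> b)" "\<bar>\<theta> p - level k0 ?v\<bar> = 1 - \<tau>"
      using 3(2,3,7) by (cases b; simp)+
    ultimately have "sec ?v p = tree_point ?v \<tau>"
      by (simp only: tree_lift_def Let_def cell_point.case list.sel) simp
    then show thesis using that[OF near vk] 3 by simp
  qed
qed

text \<open>The open star of the vertex \<open>w\<close> in coordinates: the last edge of
  \<open>w\<close> has been entered and no edge beyond \<open>w\<close> is completed.\<close>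

definition star :: "'v word \<Rightarrow> ('v word \<Rightarrow> real) \<Rightarrow> bool" where
  "star w X \<longleftrightarrow> (w \<noteq> [] \<longrightarrow> X w > 0) \<and> (\<forall>a\<in>letters. X (a # w) < 1)"

lemma star_sec:
  assumes p: "p \<in> unit_square" and w: "near w p"
  shows "star w (sec w p)"
proof -
  have [simp]: "\<not> strict_suffix (a # w) w" "\<not> strict_suffix (a # w) (b # w)" "strict_suffix w (a # w)" for a b
    by (auto simp: strict_suffix_def suffix_def dest: arg_cong[of _ _ length])
  show ?thesis
    using p w by (cases rule: sec_cases) (auto simp: star_def tree_point_def)
qed

text \<open>Adjacent tree vertices differ in level by one, so the open stars of distinct vertices at
  one level are disjoint.\<close>

lemma star_unique:
  assumes p: "p \<in> unit_square" and w': "near w' p" and lev: "level k0 w = level k0 w'"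
    and st: "star w (sec w' p)"
  shows "w = w'"
proof -
  obtain u t where u: "sec w' p = tree_point u t" "set u \<subseteq> letters" "0 < t" "t \<le> 1"
    and ut: "u = w' \<or> t < 1 \<and> (\<exists>a. u = a # w')"
    using p w'
  proof (cases rule: sec_cases)
    case 1
    then show thesis using that[of w' 1] w' unfolding near_def by simp
  next
    case (2 g b \<tau>)
    then show thesis using that[of w' "1 - \<tau>"] w' unfolding near_def by simp
  next
    case (3 g b \<tau>)
    then show thesis using that[of "(g, b) # w'" \<tau>] w' unfolding near_def by auto
  qed
  have "suffix w u"
    using st unfolding star_def u(1) by (cases "w = []") (auto simp: tree_point_def strict_suffix_def split: if_splits)
  then consider "w = u" | "strict_suffix w u" by (auto simp: strict_suffix_def)
  then show ?thesis
  proof cases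
    case 1
    then show ?thesis using ut lev level_Cons_ne by metis
  next
    case 2
    then obtain a where a: "suffix (a # w) u" by (rule suffix_ConsE)
    then have "a \<in> letters" using u(2) unfolding suffix_def by auto
    then have less: "tree_point u t (a # w) < 1" using st unfolding star_def u(1) by blast
    then have "u = a # w" "t < 1" using a by (auto simp: tree_point_def strict_suffix_def split: if_splits)
    then show ?thesis using ut lev level_Cons_ne[of k0 a w] by auto
  qed
qed

end

section \<open>Continuity of the local lifts and their extension\<close>

context graph_map
begin

lemma finite_letters: "finite letters"
  by simp

definition edge_coordinate :: "int \<Rightarrow> 'v \<times> bool \<Rightarrow> real \<times> real \<Rightarrow> real" where
  "edge_coordinate k a p = (if (\<exists>s. f p = Pt1 (fst a) s) \<and> (\<theta> p > k) = snd a then \<bar>\<theta> p - k\<bar> else 0)"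

lemma continuous_on_edge_function:
  "S \<subseteq> unit_square \<Longrightarrow> continuous_on S (\<lambda>p. edge_function pres g (f p))"
proof -
  have "continuous_map (top_of_set unit_square) euclidean (edge_function pres g \<circ> f)"
    by (rule continuous_map_compose[OF cont_f continuous_map_edge_function])
  then have "continuous_on unit_square (\<lambda>p. edge_function pres g (f p))"
    by (simp add: o_def)
  then show "S \<subseteq> unit_square \<Longrightarrow> continuous_on S (\<lambda>p. edge_function pres g (f p))"
    by (rule continuous_on_subset)
qed

text \<open>Pasted from two closed sets. On \<open>S2\<close> the edge of \<open>fst a\<close> is
  not entered and the value is \<open>0\<close>; on \<open>S1\<close> no other edge is entered and
  the value is the positive part of a signed distance of \<theta> from \<open>k\<close>. They cover
  \<open>S\<close> since a point lies on at most one open edge, and where they meet \<theta> equals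
  \<open>k\<close>.\<close>

lemma continuous_on_edge_coordinate:
  assumes S: "S \<subseteq> unit_square" and k: "\<And>p. p \<in> S \<Longrightarrow> \<bar>\<theta> p - of_int k\<bar> < 1"
  shows "continuous_on S (edge_coordinate k a)"
proof -
  obtain g b where a: "a = (g, b)" by (cases a)
  define S1 where "S1 = (\<Inter>g'\<in>verts G - {g}. {p \<in> S. edge_function pres g' (f p) = 0}) \<inter> S"
  define S2 where "S2 = {p \<in> S. edge_function pres g (f p) = 0}"
  have clo: "closedin (top_of_set S) {p \<in> S. edge_function pres g' (f p) = 0}" for g'
    using continuous_closedin_preimage_constant[OF continuous_on_edge_function[OF S]] by simp
  have other: "edge_function pres g' (Pt1 g'' s) = 0" if "g'' \<noteq> g'" for g' g'' s
    using that by simp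
  have \<theta>: "continuous_on S \<theta>" using cont_\<theta> S by (rule continuous_on_subset)
  have val: "p \<in> S2 \<and> edge_coordinate k a p = 0 \<and> (p \<in> S1 \<longrightarrow> \<theta> p = k) \<or>
      p \<in> S1 \<and> edge_coordinate k a p = max 0 (if b then \<theta> p - k else k - \<theta> p) \<and> p \<notin> S2" if p: "p \<in> S" for p
  proof -
    have "p \<in> unit_square" using p S by blast
    then show ?thesis
      using k[OF p]
    proof (cases rule: point_cases)
      case 1
      then show ?thesis using p by (simp add: S1_def S2_def edge_coordinate_def)
    next
      case (2 g' s)
      have pos: "edge_function pres g' (f p) > 0" unfolding 2(4) by (rule edge_function_pos[OF 2(2,3)])
      show ?thesis
      proof (cases "g' = g")
        case True
        then show ?thesis using pos p 2 other by (auto simp: S1_def S2_def edge_coordinate_def a)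
      next
        case False
        then have "p \<notin> S1" using pos 2(1) by (auto simp: S1_def)
        then show ?thesis using False p 2 by (simp add: S2_def edge_coordinate_def a)
      qed
    next
      case (3 g' s)
      have pos: "edge_function pres g' (f p) > 0" unfolding 3(4) by (rule edge_function_pos[OF 3(2,3)])
      show ?thesis
      proof (cases "g' = g")
        case True
        then show ?thesis using pos p 3 other by (auto simp: S1_def S2_def edge_coordinate_def a)
      next
        case False
        then have "p \<notin> S1" using pos 3(1) by (auto simp: S1_def)
        then show ?thesis using False p 3 by (simp add: S2_def edge_coordinate_def a)
      qed
    qed
  qed
  have un: "S1 \<union> S2 = S" using val by (auto simp: S1_def S2_def)
  have "closedin (top_of_set S) S1"
  proof (cases "verts G - {g} = {}")
    case True
    show ?thesis unfolding S1_def True by simp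
  next
    case False
    then show ?thesis unfolding S1_def by (intro closedin_Int closedin_Inter) (use clo in auto)
  qed
  moreover have "closedin (top_of_set S) S2" unfolding S2_def by (rule clo)
  moreover have "continuous_on S1 (edge_coordinate k a)"
  proof (rule continuous_on_eq)
    show "continuous_on S1 (\<lambda>p. max 0 (if b then \<theta> p - k else k - \<theta> p))"
      using continuous_on_subset[OF \<theta>, of S1] un by (cases b) (auto intro!: continuous_intros)
    show "max 0 (if b then \<theta> p - k else k - \<theta> p) = edge_coordinate k a p" if "p \<in> S1" for p
      using val[of p] that un by auto
  qed
  moreover have "continuous_on S2 (edge_coordinate k a)"
  proof (rule continuous_on_eq)
    show "continuous_on S2 (\<lambda>p. 0)" by simp
    show "0 = edge_coordinate k a p" if "p \<in> S2" for p
      using val[of p] that un by auto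
  qed
  ultimately show ?thesis
    using continuous_on_Un_local[of S1 S2] unfolding un by blast
qed

text \<open>The case distinction in \<open>tree_lift\<close> depends on \<open>p\<close>. Here it
  depends on \<open>v\<close> and \<open>w\<close> only, which makes continuity visible coordinate
  by coordinate.\<close>

lemma sec_coord:
  assumes p: "p \<in> unit_square" and w: "near w p"
  shows "sec w p v = (if v = [] then 0
    else if v = w then 1 - edge_coordinate (level k0 w) (fst (hd w), \<not> snd (hd w)) p
    else if tl v = w then (if w \<noteq> [] \<and> hd w = (fst (hd v), \<not> snd (hd v)) then 0 else edge_coordinate (level k0 w) (hd v) p)
    else if strict_suffix v w then 1 else 0)"
proof -
  have suf: "strict_suffix v (a # w) \<longleftrightarrow> v = w \<or> strict_suffix v w" for a
    by (auto simp: strict_suffix_def suffix_def Cons_eq_append_conv)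
  have tlv: "\<not> strict_suffix v w" if "v \<noteq> []" "tl v = w"
  proof
    assume "strict_suffix v w"
    then have "length v \<le> length w" by (auto simp: strict_suffix_def dest: suffix_length_le)
    then show False using that by (cases v) auto
  qed
  have Cons: "v = a # w \<longleftrightarrow> hd v = a \<and> tl v = w" if "v \<noteq> []" for a using that by (cases v) auto
  show ?thesis
    using p w
  proof (cases rule: sec_cases)
    case 1
    then show ?thesis using tlv by (auto simp: tree_point_def edge_coordinate_def)
  next
    case (2 g b \<tau>)
    obtain s where fp: "f p = Pt1 g s" using 2 by (cases b) auto
    have \<tau>: "edge_coordinate (level k0 w) a p = (if a = (g, b) then \<tau> else 0)" for a
      using fp 2(2,3,8) by (cases a; cases b) (auto simp: edge_coordinate_def)
    have ne: "w \<noteq> v" if "v \<noteq> []" "tl v = w" using that by (cases v) auto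
    show ?thesis
      unfolding 2(6) \<tau> tree_point_def using 2(4,5) tlv ne by (cases "hd v") auto
  next
    case (3 g b \<tau>)
    obtain s where fp: "f p = Pt1 g s" using 3 by (cases b) auto
    have \<tau>: "edge_coordinate (level k0 w) a p = (if a = (g, b) then \<tau> else 0)" for a
      using fp 3(2,3,7) by (cases a; cases b) (auto simp: edge_coordinate_def)
    show ?thesis
    proof (cases "v = []")
      case False
      have lhs: "sec w p v = (if hd v = (g, b) \<and> tl v = w then \<tau> else if v = w \<or> strict_suffix v w then 1 else 0)"
        unfolding 3(5) tree_point_def Cons[OF False] suf using False by simp
      consider "v = w" | "v \<noteq> w" "tl v = w" | "v \<noteq> w" "tl v \<noteq> w" by blast
      then show ?thesis
      proof cases
        case 1
        have "(fst (hd w), \<not> snd (hd w)) \<noteq> (g, b)"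
        proof
          assume "(fst (hd w), \<not> snd (hd w)) = (g, b)"
          then have "hd w = (g, \<not> b)" by (cases "hd w") auto
          then show False using 3(4) False 1 by simp
        qed
        moreover have "tl v \<noteq> w" using 1 False by (cases v) auto
        ultimately show ?thesis using 1 False unfolding lhs \<tau> by auto
      next
        case 2
        then show ?thesis
          using False 3(4) tlv[OF False 2(2)] unfolding lhs \<tau> by (cases "hd v = (g, b)") auto
      next
        case 3
        then show ?thesis using False unfolding lhs by simp
      qed
    qed (simp add: tree_point_def 3(5))
  qed
qed

lemma continuous_on_sec:
  assumes S: "S \<subseteq> unit_square" and w: "\<And>p. p \<in> S \<Longrightarrow> near w p"
  shows "continuous_on S (\<lambda>p. sec w p v)"
proof -
  have k: "\<bar>\<theta> p - of_int (level k0 w)\<bar> < 1" if "p \<in> S" for p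
    using w[OF that] unfolding near_def by simp
  note \<tau> = continuous_on_edge_coordinate[OF S k]
  have if_cont: "continuous_on S (\<lambda>p. if c then h1 p else h2 p)"
    if "continuous_on S h1" "continuous_on S h2" for c and h1 h2 :: "real \<times> real \<Rightarrow> real"
    using that by (cases c) simp_all
  have "continuous_on S (\<lambda>p. if v = [] then 0
    else if v = w then 1 - edge_coordinate (level k0 w) (fst (hd w), \<not> snd (hd w)) p
    else if tl v = w then (if w \<noteq> [] \<and> hd w = (fst (hd v), \<not> snd (hd v)) then 0 else edge_coordinate (level k0 w) (hd v) p)
    else if strict_suffix v w then 1 else 0)"
    by (intro if_cont continuous_on_diff continuous_on_const \<tau>)
  then show ?thesis
  proof (rule continuous_on_eq)
    fix p assume p: "p \<in> S"
    then have "p \<in> unit_square" using S by blast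
    then show "(if v = [] then 0
      else if v = w then 1 - edge_coordinate (level k0 w) (fst (hd w), \<not> snd (hd w)) p
      else if tl v = w then (if w \<noteq> [] \<and> hd w = (fst (hd v), \<not> snd (hd v)) then 0 else edge_coordinate (level k0 w) (hd v) p)
      else if strict_suffix v w then 1 else 0) = sec w p v"
      by (rule sec_coord[OF _ w[OF p], symmetric])
  qed
qed

text \<open>Finiteness of \<open>W\<close> lets the final homotopy be pasted from finitely many
  closed pieces.\<close>

definition lift_on :: "(real \<times> real) set \<Rightarrow> (real \<times> real \<Rightarrow> 'v word \<Rightarrow> real) \<Rightarrow> 'v word set \<Rightarrow> bool" where
  "lift_on S X W \<longleftrightarrow> finite W \<and> (\<forall>v. continuous_on S (\<lambda>p. X p v)) \<and>
     (\<forall>p\<in>S. \<exists>w\<in>W. near w p \<and> X p = sec w p)"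

text \<open>By \<open>rebase\<close> the words can be taken at level \<open>k\<close>. Membership in
  an open star is given by finitely many strict inequalities between continuous functions, so it
  persists nearby, and \<open>star_unique\<close> shows that the word is locally constant.
  Connectedness makes it constant.\<close>

lemma lift_locally_constant:
  assumes S: "S \<subseteq> unit_square" "Topological_Spaces.connected S" "p0 \<in> S" and k: "\<And>p. p \<in> S \<Longrightarrow> \<bar>\<theta> p - of_int k\<bar> < 1"
    and X: "\<And>v. continuous_on S (\<lambda>p. X p v)" "\<And>p. p \<in> S \<Longrightarrow> \<exists>w. near w p \<and> X p = sec w p"
  shows "\<exists>w. level k0 w = k \<and> (\<forall>p\<in>S. near w p \<and> X p = sec w p)"
proof -
  have "\<exists>w. near w p \<and> level k0 w = k \<and> X p = sec w p" if p: "p \<in> S" for p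
  proof -
    obtain w where w: "near w p" "X p = sec w p" using X(2)[OF p] by blast
    have "p \<in> unit_square" using p S by blast
    then obtain w' where "near w' p" "level k0 w' = k" "sec w' p = sec w p"
      using rebase[OF _ w(1) k[OF p]] by metis
    then show ?thesis using w by metis
  qed
  then obtain W where W: "\<And>p. p \<in> S \<Longrightarrow> near (W p) p \<and> level k0 (W p) = k \<and> X p = sec (W p) p"
    by metis
  have loc: "eventually (\<lambda>q. W p = W q) (at p within S)" if p: "p \<in> S" for p
  proof -
    have lim: "((\<lambda>q. X q v) \<longlongrightarrow> X p v) (at p within S)" for v
      using X(1) p unfolding continuous_on_def by blast
    have psq: "p \<in> unit_square" using p S by blast
    have "star (W p) (sec (W p) p)" using star_sec[OF psq] W[OF p] by blast
    then have st: "W p \<noteq> [] \<longrightarrow> 0 < X p (W p)" "\<And>a. a \<in> letters \<Longrightarrow> X p (a # W p) < 1"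
      using W[OF p] unfolding star_def by auto
    have "eventually (\<lambda>q. W p \<noteq> [] \<longrightarrow> 0 < X q (W p)) (at p within S)"
      using st(1) order_tendstoD(1)[OF lim] by (cases "W p = []") auto
    moreover have "eventually (\<lambda>q. \<forall>a\<in>letters. X q (a # W p) < 1) (at p within S)"
      using st(2) order_tendstoD(2)[OF lim] by (intro eventually_ball_finite[OF finite_letters]) auto
    moreover have "eventually (\<lambda>q. q \<in> S) (at p within S)"
      by (simp add: eventually_at_filter)
    ultimately show ?thesis
    proof eventually_elim
      case (elim q)
      then have "star (W p) (X q)" unfolding star_def by blast
      then have "star (W p) (sec (W q) q)" using W[OF elim(3)] by simp
      moreover have "q \<in> unit_square" using elim(3) S by blast
      ultimately show ?case using star_unique[of q "W q" "W p"] W[OF elim(3)] W[OF p] by simp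
    qed
  qed
  have "W p0 = W p" if "p \<in> S" for p
    by (rule connected_local_const[OF S(2,3) that]) (use loc in blast)
  then show ?thesis
    using W S(3) by metis
qed

text \<open>On the connected overlap the lift is given by a single word \<open>w\<close>, and the
  local lift of that word is defined on all of \<open>R\<close>.\<close>

lemma lift_extend:
  assumes X: "lift_on S X W" and S: "closed S" "S \<subseteq> unit_square"
    and R: "closed R" "R \<subseteq> unit_square" "Topological_Spaces.connected (S \<inter> R)" "q \<in> S \<inter> R"
    and k: "\<And>p. p \<in> R \<Longrightarrow> \<bar>\<theta> p - of_int k\<bar> < 1"
  obtains X' W' where "lift_on (S \<union> R) X' W'" "\<And>p. p \<in> S \<Longrightarrow> X' p = X p"
proof -
  have "S \<inter> R \<subseteq> unit_square" using S by blast
  then have "\<exists>w. level k0 w = k \<and> (\<forall>p\<in>S \<inter> R. near w p \<and> X p = sec w p)"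
  proof (rule lift_locally_constant[OF _ R(3,4)])
    show "\<bar>\<theta> p - of_int k\<bar> < 1" if "p \<in> S \<inter> R" for p using k that by blast
    show "continuous_on (S \<inter> R) (\<lambda>p. X p v)" for v
      using X continuous_on_subset[of S "\<lambda>p. X p v" "S \<inter> R"] unfolding lift_on_def by auto
    show "\<exists>w. near w p \<and> X p = sec w p" if "p \<in> S \<inter> R" for p
      using X that unfolding lift_on_def by blast
  qed
  then obtain w where w: "level k0 w = k" "\<And>p. p \<in> S \<inter> R \<Longrightarrow> near w p \<and> X p = sec w p"
    by blast
  have near: "near w p" if "p \<in> R" for p
    using w(2)[OF R(4)] k[OF that] w(1) unfolding near_def by simp
  define X' where "X' p = (if p \<in> S then X p else sec w p)" for p
  have "continuous_on (S \<union> R) (\<lambda>p. X' p v)" for v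
  proof -
    have "continuous_on (S \<union> R) (\<lambda>p. if p \<in> S then X p v else sec w p v)"
    proof (rule continuous_on_cases[OF S(1) R(1)])
      show "continuous_on S (\<lambda>p. X p v)" using X unfolding lift_on_def by blast
      show "continuous_on R (\<lambda>p. sec w p v)" using continuous_on_sec[OF R(2) near] .
      show "\<forall>p. p \<in> S \<and> p \<notin> S \<or> p \<in> R \<and> p \<in> S \<longrightarrow> X p v = sec w p v" using w(2) by auto
    qed
    then show ?thesis unfolding X'_def by (simp add: if_distribR cong: if_cong)
  qed
  then have "lift_on (S \<union> R) X' (insert w W)"
    using X near unfolding lift_on_def X'_def by auto
  then show thesis using that[of X' "insert w W"] unfolding X'_def by auto
qed


end

lemma frontier_unit_square_iff:
  "p \<in> frontier unit_square \<longleftrightarrow> p \<in> unit_square \<and> (fst p = 0 \<or> fst p = 1 \<or> snd p = 0 \<or> snd p = (1::real))"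
  by (cases p) (auto simp: frontier_def closure_Times interior_Times)

lemma connected_frontier_unit_square: "Topological_Spaces.connected (frontier unit_square)"
proof (rule connected_frontier_simple)
  have "convex (unit_square :: (real \<times> real) set)" "bounded (unit_square :: (real \<times> real) set)"
    by (auto intro: convex_Times bounded_Times)
  then show "Topological_Spaces.connected (unit_square :: (real \<times> real) set)"
    "Topological_Spaces.connected (- (unit_square :: (real \<times> real) set))"
    by (auto intro: convex_connected connected_complement_bounded_convex)
qed

section \<open>Lifting the whole square\<close>

context graph_map
begin

text \<open>The left side belongs to the domain from the outset, so every new rectangle, also the
  first of a row, meets the old domain exactly in its left and lower sides, a connected set.\<close>

lemma lift_grid_step:
  fixes x x' y y' :: real
  assumes x: "0 \<le> x" "x < x'" "x' \<le> 1" and y: "0 \<le> y" "y < y'" "y' \<le> 1"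
    and X: "lift_on ({0} \<times> {0..1} \<union> {0..1} \<times> {0..y} \<union> {0..x} \<times> {0..y'}) X W"
    and k: "\<And>p. p \<in> {x..x'} \<times> {y..y'} \<Longrightarrow> \<bar>\<theta> p - of_int k\<bar> < 1"
  shows "\<exists>X' W'. lift_on ({0} \<times> {0..1} \<union> {0..1} \<times> {0..y} \<union> {0..x'} \<times> {0..y'}) X' W' \<and> X' (0, 0) = X (0, 0)"
proof -
  let ?S = "{0} \<times> {0..1} \<union> {0..1} \<times> {0..y} \<union> {0..x} \<times> {0..y'}"
  let ?R = "{x..x'} \<times> {y..y'}"
  have closed: "closed ?S" "closed ?R" by (intro closed_Un closed_Times; simp)+
  have sub: "?S \<subseteq> unit_square" "?R \<subseteq> unit_square" using x y by auto
  have int: "?S \<inter> ?R = {x} \<times> {y..y'} \<union> {x..x'} \<times> {y}" using x y by auto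
  have "Topological_Spaces.connected ({x} \<times> {y..y'})" "Topological_Spaces.connected ({x..x'} \<times> {y})"
    by (intro connected_Times; simp)+
  then have con: "Topological_Spaces.connected (?S \<inter> ?R)"
    unfolding int
  proof (rule connected_Un)
    have "(x, y) \<in> {x} \<times> {y..y'} \<inter> {x..x'} \<times> {y}" using x y by simp
    then show "{x} \<times> {y..y'} \<inter> {x..x'} \<times> {y} \<noteq> {}" by blast
  qed
  have mem: "(x, y) \<in> ?S \<inter> ?R" "(0, 0) \<in> ?S" using x y by auto
  obtain X' W' where X': "lift_on (?S \<union> ?R) X' W'" "\<And>p. p \<in> ?S \<Longrightarrow> X' p = X p"
    using lift_extend[OF X closed(1) sub(1) closed(2) sub(2) con mem(1) k] by blast
  have "?S \<union> ?R = {0} \<times> {0..1} \<union> {0..1} \<times> {0..y} \<union> {0..x'} \<times> {0..y'}"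
    using x y by auto
  then show ?thesis using X' mem(2) by metis
qed

lemma small_squares:
  obtains n :: nat where "0 < n"
    "\<And>x y. 0 \<le> x \<Longrightarrow> x + 1 / n \<le> 1 \<Longrightarrow> 0 \<le> y \<Longrightarrow> y + 1 / n \<le> 1 \<Longrightarrow>
      \<exists>k. \<forall>p \<in> {x..x + 1 / n} \<times> {y..y + 1 / n}. \<bar>\<theta> p - of_int k\<bar> < 1"
proof -
  have "uniformly_continuous_on unit_square \<theta>"
    by (rule compact_uniformly_continuous[OF cont_\<theta>]) (simp add: compact_Times)
  then obtain \<delta> where \<delta>: "\<delta> > 0" "\<And>p q. p \<in> unit_square \<Longrightarrow> q \<in> unit_square \<Longrightarrow> dist q p < \<delta> \<Longrightarrow> dist (\<theta> q) (\<theta> p) < 1 / 2"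
    unfolding uniformly_continuous_on_def by (metis half_gt_zero_iff zero_less_one)
  \<comment> \<open>The two coordinate differences sum to at most \<open>2 / n\<close>, which must
    stay below \<delta>. Then \<theta> varies by less than one half, and rounding its value at the
    corner costs at most another half.\<close>
  obtain n :: nat where n: "2 / \<delta> < n" using reals_Archimedean2 by blast
  moreover have "0 < 2 / \<delta>" using \<delta>(1) by simp
  ultimately have n0: "0 < real n" by linarith
  then have n\<delta>: "2 / real n < \<delta>" using n \<delta>(1) by (simp add: field_simps)
  show thesis
  proof (rule that)
    show "0 < n" using n0 by simp
    fix x y :: real assume xy: "0 \<le> x" "x + 1 / n \<le> 1" "0 \<le> y" "y + 1 / n \<le> 1"
    show "\<exists>k. \<forall>p \<in> {x..x + 1 / n} \<times> {y..y + 1 / n}. \<bar>\<theta> p - of_int k\<bar> < 1"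
    proof (intro exI ballI)
      fix p assume p: "p \<in> {x..x + 1 / real n} \<times> {y..y + 1 / real n}"
      have inv: "0 \<le> 1 / real n" by simp
      have sq: "p \<in> unit_square" "(x, y) \<in> unit_square" using p xy inv by (auto intro: order_trans)
      have "dist p (x, y) \<le> \<bar>fst p - x\<bar> + \<bar>snd p - y\<bar>"
        by (cases p) (auto simp: dist_Pair_Pair dist_real_def intro: order_trans[OF sqrt_sum_squares_le_sum_abs])
      also have "\<dots> \<le> 1 / n + 1 / n"
        using p by (intro add_mono) auto
      also have "\<dots> < \<delta>" using n\<delta> by simp
      finally have "dist (\<theta> p) (\<theta> (x, y)) < 1 / 2" using \<delta>(2)[OF sq(2,1)] by simp
      moreover have "\<bar>of_int (round (\<theta> (x, y))) - \<theta> (x, y)\<bar> \<le> 1 / 2" by (rule of_int_round_abs_le)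
      ultimately show "\<bar>\<theta> p - of_int (round (\<theta> (x, y)))\<bar> < 1" unfolding dist_real_def by linarith
    qed
  qed
qed

lemma ex_lift: "\<exists>X W. lift_on unit_square X W \<and> X (0, 0) = tree_point [] 1"
proof -
  obtain n :: nat where n: "0 < n"
    and k: "\<And>x y. 0 \<le> x \<Longrightarrow> x + 1 / n \<le> 1 \<Longrightarrow> 0 \<le> y \<Longrightarrow> y + 1 / n \<le> 1 \<Longrightarrow>
      \<exists>k. \<forall>p \<in> {x..x + 1 / n} \<times> {y..y + 1 / n}. \<bar>\<theta> p - of_int k\<bar> < 1"
    using small_squares by blast
  define c where "c i = real i / real n" for i
  have c: "c (Suc i) = c i + 1 / n" "0 \<le> c i" for i unfolding c_def by (auto simp: add_divide_distrib)
  have c1: "c i \<le> 1" if "i \<le> n" for i unfolding c_def using that n by simp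
  have cn: "c n = 1" "c 0 = 0" using n unfolding c_def by auto
  let ?T = "\<lambda>j. {0::real} \<times> {0..1} \<union> {0..1} \<times> {0..c j}"
  have col: "\<exists>X' W'. lift_on (?T (Suc j)) X' W' \<and> X' (0, 0) = tree_point [] 1"
    if j: "j < n" and X: "lift_on (?T j) X W" "X (0, 0) = tree_point [] 1" for j X W
  proof -
    have "\<exists>X' W'. lift_on (?T j \<union> {0..c i} \<times> {0..c (Suc j)}) X' W' \<and> X' (0, 0) = tree_point [] 1" if "i \<le> n" for i
      using that
    proof (induction i)
      case 0
      have "?T j \<union> {0..c 0} \<times> {0..c (Suc j)} = ?T j"
        using c1[of "Suc j"] j by (auto simp: cn)
      then show ?case using X by metis
    next
      case (Suc i)
      then obtain X' W' where X': "lift_on (?T j \<union> {0..c i} \<times> {0..c (Suc j)}) X' W'" "X' (0, 0) = tree_point [] 1"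
        by auto
      have ij: "c i + 1 / n \<le> 1" "c j + 1 / n \<le> 1"
        using c1[of "Suc i"] c1[of "Suc j"] Suc(2) j unfolding c by auto
      then obtain k0' where "\<forall>p \<in> {c i..c i + 1 / n} \<times> {c j..c j + 1 / n}. \<bar>\<theta> p - of_int k0'\<bar> < 1"
        using k[of "c i" "c j"] c by blast
      then have kk: "\<And>p. p \<in> {c i..c (Suc i)} \<times> {c j..c (Suc j)} \<Longrightarrow> \<bar>\<theta> p - of_int k0'\<bar> < 1"
        unfolding c by blast
      have "c i < c (Suc i)" "c j < c (Suc j)" "c (Suc i) \<le> 1" "c (Suc j) \<le> 1"
        using c n ij by auto
      then show ?case
        using lift_grid_step[OF c(2) _ _ c(2) _ _ X'(1) kk] X'(2) by metis
    qed
    moreover have "c j \<le> c (Suc j)" unfolding c by simp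
    then have "?T j \<union> {0..c n} \<times> {0..c (Suc j)} = ?T (Suc j)"
      unfolding cn by auto
    ultimately show ?thesis by (metis order_refl)
  qed
  have "\<exists>X W. lift_on (?T j) X W \<and> X (0, 0) = tree_point [] 1" if "j \<le> n" for j
    using that
  proof (induction j)
    case 0
    \<comment> \<open>\<open>?T 0\<close> is the left and the lower side of the square, where the
      lift can be constant at the root.\<close>
    have "lift_on (?T 0) (\<lambda>_. tree_point [] 1) {[]}"
      unfolding lift_on_def
    proof (intro conjI allI ballI)
      fix p assume "p \<in> ?T 0"
      then have "p \<in> frontier unit_square" unfolding frontier_unit_square_iff cn by auto
      then have "f p = Pt0" "\<theta> p = of_int k0" using base by auto
      then show "\<exists>w\<in>{[]}. near w p \<and> tree_point [] 1 = sec w p"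
        by (simp add: near_def tree_lift_def)
    qed auto
    then show ?case by blast
  next
    case (Suc j)
    then show ?case using col[of j] by auto
  qed
  moreover have "?T n = unit_square" unfolding cn by auto
  ultimately show ?thesis by (metis order_refl)
qed

lemma continuous_map_letter_path:
  assumes "fst a \<in> verts G"
  shows "continuous_map euclideanreal space (letter_path a)"
proof -
  obtain g b where a: "a = (g, b)" by (cases a)
  define c where "c t = max 0 (min 1 (if b then t else 1 - t))" for t :: real
  have "continuous_map euclideanreal (top_of_set {0..1}) c"
    unfolding c_def by (cases b) (auto simp: continuous_map_in_subtopology intro!: continuous_intros)
  moreover have "continuous_map (top_of_set {0..1}) space (char_map1 g)"
    using continuous_map_char_map1[OF well_formed_pres, of g] assms a by (simp del: char_map1.simps)
  ultimately have "continuous_map euclideanreal space (char_map1 g \<circ> c)"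
    by (rule continuous_map_compose)
  moreover have "char_map1 g \<circ> c = (letter_path a :: real \<Rightarrow> ('v, 'e) cell_point)"
    unfolding a c_def by (rule ext) (auto simp: max_def min_def)
  ultimately show ?thesis by simp
qed

lemma continuous_map_tree_path:
  assumes "set u \<subseteq> letters"
  shows "continuous_map euclideanreal space (tree_path u)"
  using assms
proof (induction u)
  case Nil
  then show ?case using Pt0_in_topspace by (simp add: continuous_map_def) 
next
  case (Cons a v)
  have "continuous_map euclideanreal space (letter_path a \<circ> (\<lambda>c. c - real (length v)))"
    using Cons(2) by (intro continuous_map_compose[OF _ continuous_map_letter_path]) (auto intro!: continuous_intros)
  then have "continuous_map euclideanreal space (\<lambda>c. letter_path a (c - real (length v)))"
    by (simp add: o_def)
  then have "continuous_map euclideanreal space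
      (\<lambda>c. if c \<le> real (length v) then tree_path v c else letter_path a (c - real (length v)))"
    using Cons
    by (intro continuous_map_cases_le) (auto simp: continuous_map_from_subtopology tree_path_end)
  then show ?case by simp
qed

text \<open>Only two sides were prescribed. The whole frontier maps to one vertex, and since it is
  connected, a single word describes the lift there; its value at the corner shows that the word is
  empty.\<close>

lemma lift_frontier:
  assumes X: "lift_on unit_square X W" "X (0, 0) = tree_point [] 1" and p: "p \<in> frontier unit_square"
  shows "X p = tree_point [] 1"
proof -
  have sub: "frontier unit_square \<subseteq> (unit_square :: (real \<times> real) set)"
    using frontier_unit_square_iff by blast
  have o: "(0, 0) \<in> frontier unit_square" unfolding frontier_unit_square_iff by simp
  have "\<exists>w. level k0 w = k0 \<and> (\<forall>p\<in>frontier unit_square. near w p \<and> X p = sec w p)"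
  proof (rule lift_locally_constant[OF sub connected_frontier_unit_square o])
    show "\<bar>\<theta> p - of_int k0\<bar> < 1" if "p \<in> frontier unit_square" for p using base[OF that] by simp
    show "continuous_on (frontier unit_square) (\<lambda>p. X p v)" for v
      using X(1) sub continuous_on_subset unfolding lift_on_def by metis
    show "\<exists>w. near w p \<and> X p = sec w p" if "p \<in> frontier unit_square" for p
      using X(1) sub that unfolding lift_on_def by blast
  qed
  then obtain w where w: "\<And>p. p \<in> frontier unit_square \<Longrightarrow> X p = sec w p" by blast
  have eq: "X p = tree_point w 1" if "p \<in> frontier unit_square" for p
    using w[OF that] base[OF that] by (simp add: tree_lift_def)
  have "w = []"
  proof (rule ccontr)
    assume "w \<noteq> []"
    then have "tree_point w 1 w = 1" "tree_point [] 1 w = 0" by (auto simp: tree_point_def)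
    then show False using eq[OF o] X(2) by simp
  qed
  then show ?thesis using eq[OF p] by simp
qed

end

section \<open>Contraction along the Cayley tree\<close>

context graph_map
begin

lemma sec_tree_point:
  assumes p: "p \<in> unit_square" and w: "near w p"
  obtains u t where "u \<in> insert w ((\<lambda>a. a # w) ` letters)" "0 \<le> t" "t \<le> 1" "set u \<subseteq> letters"
    "sec w p = tree_point u t" "f p = tree_path u (depth u t)"
proof -
  have sw: "set w \<subseteq> letters" using w unfolding near_def by simp
  show thesis
    using p w
  proof (cases rule: sec_cases)
    case 1
    have eq: "tree_path w (depth w 1) = f p"
      unfolding 1(1) tree_path_depth[OF zero_le_one] by simp
    show thesis by (rule that[OF insertI1 zero_le_one order_refl sw 1(2) eq[symmetric]])
  next
    case (2 g b \<tau>)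
    have "letter_path (g, \<not> b) (1 - \<tau>) = f p"
      unfolding 2(7) by (cases b) auto
    moreover have t0: "0 \<le> 1 - \<tau>" using 2(3) by simp
    ultimately have eq: "tree_path w (depth w (1 - \<tau>)) = f p"
      unfolding tree_path_depth[OF t0] using 2(4,5) by simp
    have "1 - \<tau> \<le> 1" using 2(2) by simp
    then show thesis by (rule that[OF insertI1 t0 _ sw 2(6) eq[symmetric]])
  next
    case (3 g b \<tau>)
    have eq: "tree_path ((g, b) # w) (depth ((g, b) # w) \<tau>) = f p"
      unfolding 3(6) tree_path_depth[OF less_imp_le[OF 3(2)]] by simp
    have mem: "(g, b) # w \<in> insert w ((\<lambda>a. a # w) ` letters)" "set ((g, b) # w) \<subseteq> letters"
      using 3(1) sw by auto
    show thesis
      by (rule that[OF mem(1) less_imp_le[OF 3(2)] less_imp_le[OF 3(3)] mem(2) 3(5) eq[symmetric]])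
  qed
qed

lemma tree_point_self: "tree_point u (tree_point u t u) = tree_point u t"
  by (rule ext) (auto simp: tree_point_def)

lemma depth_self: "depth u (tree_point u t u) = depth u t"
  by (simp add: depth_def tree_point_def)

text \<open>At time \<open>s\<close> the contraction follows the geodesic from the root to the
  lifted point only up to length \<open>s * L\<close>, projected to the complex. On each closed set
  \<open>D u\<close> a single word describes this geodesic.\<close>

theorem null_homotopic:
  "homotopic_with (\<lambda>h. \<forall>p\<in>frontier unit_square. h p = Pt0) (top_of_set unit_square) space f (\<lambda>_. Pt0)"
proof -
  obtain X W where X: "lift_on unit_square X W" and X0: "X (0, 0) = tree_point [] 1"
    using ex_lift by blast
  have finW: "finite W" and contX: "\<And>v. continuous_on unit_square (\<lambda>p. X p v)"
    and secX: "\<And>p. p \<in> unit_square \<Longrightarrow> \<exists>w\<in>W. near w p \<and> X p = sec w p"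
    using X unfolding lift_on_def by blast+
  define U where "U = {u \<in> insert [] (\<Union>w\<in>W. insert w ((\<lambda>a. a # w) ` letters)). set u \<subseteq> letters}"
  have finU: "finite U" unfolding U_def using finW finite_letters by auto
  \<comment> \<open>No depth that occurs exceeds \<open>L\<close>, so at time \<open>1\<close>
    nothing is cut off.\<close>
  define L where "L = real (Max (length ` U))"
  have L: "real (length u) \<le> L" if "u \<in> U" for u
    unfolding L_def using finU that by simp
  \<comment> \<open>The points whose lift has the form \<open>tree_point u t\<close>. As
    \<open>t\<close> must be the coordinate at \<open>u\<close> when \<open>u\<close> is nonempty,
    this is a family of equations between continuous coordinates and defines a closed set.\<close>
  define D where "D u = {p \<in> unit_square. X p = tree_point u (X p u)}" for u
  have rep: "\<exists>u\<in>U. p \<in> D u \<and> f p = tree_path u (depth u (X p u))" if p: "p \<in> unit_square" for p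
  proof -
    obtain w where w: "w \<in> W" "near w p" "X p = sec w p" using secX[OF p] by blast
    obtain u t where u: "u \<in> insert w ((\<lambda>a. a # w) ` letters)" "set u \<subseteq> letters"
      "X p = tree_point u t" "f p = tree_path u (depth u t)"
      using sec_tree_point[OF p w(2)] w(3) by metis
    have "u \<in> U" unfolding U_def using u(1,2) w(1) by blast
    moreover have "p \<in> D u" using p tree_point_self[of u t] u(3) unfolding D_def by simp
    moreover have "f p = tree_path u (depth u (X p u))" unfolding u(3) depth_self by (rule u(4))
    ultimately show ?thesis by blast
  qed
  have range: "0 \<le> X p v \<and> X p v \<le> 1" if p: "p \<in> unit_square" for p v
  proof -
    obtain w where w: "w \<in> W" "near w p" "X p = sec w p" using secX[OF p] by blast
    obtain u t where "0 \<le> t" "t \<le> 1" "X p = tree_point u t"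
      using sec_tree_point[OF p w(2)] w(3) by metis
    then show ?thesis by (simp add: tree_point_def)
  qed
  have closedD: "closedin (top_of_set unit_square) (D u)" for u
  proof -
    have "continuous_on unit_square (\<lambda>p. tree_point u (X p u) v)" for v
      unfolding tree_point_def using contX by (cases "v = []"; cases "v = u") simp_all
    then have "continuous_on unit_square (\<lambda>p. X p v - tree_point u (X p u) v)" for v
      using contX by (intro continuous_on_diff)
    then have "closedin (top_of_set unit_square) {p \<in> unit_square. X p v - tree_point u (X p u) v = 0}" for v
      by (rule continuous_closedin_preimage_constant)
    then have "closedin (top_of_set unit_square) (\<Inter>v. {p \<in> unit_square. X p v - tree_point u (X p u) v = 0})"
      by (intro closedin_Inter) auto
    moreover have "(\<Inter>v. {p \<in> unit_square. X p v - tree_point u (X p u) v = 0}) = D u"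
      unfolding D_def fun_eq_iff by auto
    ultimately show ?thesis by simp
  qed
  define h where "h u = (\<lambda>q. tree_path u (min (fst q * L) (depth u (X (snd q) u))) :: ('v, 'e) cell_point)" for u
  \<comment> \<open>An arbitrary choice of word; by \<open>agree\<close>, the value of the homotopy
    is the same for every word \<open>u\<close> with \<open>p\<close> in \<open>D u\<close>.\<close>
  define pick where "pick p = (SOME u. u \<in> U \<and> p \<in> D u \<and> f p = tree_path u (depth u (X p u)))" for p
  have pick: "pick p \<in> U" "p \<in> D (pick p)" "f p = tree_path (pick p) (depth (pick p) (X p (pick p)))"
    if "p \<in> unit_square" for p
    using someI_ex[of "\<lambda>u. u \<in> U \<and> p \<in> D u \<and> f p = tree_path u (depth u (X p u))"] rep[OF that]
    unfolding pick_def by blast+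
  define H where "H q = h (pick (snd q)) q" for q
  have L0: "0 \<le> L" unfolding L_def by simp
  have agree: "h u (s, p) = h u' (s, p)" if "0 \<le> s" "p \<in> D u" "p \<in> D u'" for u u' s p
  proof -
    have p: "p \<in> unit_square" "tree_point u (X p u) = tree_point u' (X p u')"
      using that unfolding D_def by auto
    show ?thesis
      unfolding h_def fst_conv snd_conv
      by (rule tree_path_unique) (use range[OF p(1)] p(2) that(1) L0 in auto)
  qed
  let ?Z = "prod_topology (top_of_set {0..1::real}) (top_of_set (unit_square :: (real \<times> real) set))"
  have contH: "continuous_map ?Z space H"
  proof (rule pasting_lemma_closed[where I = U and T = "\<lambda>u. {0..1} \<times> D u" and f = h])
    show "finite U" by (rule finU)
    fix u assume u: "u \<in> U"
    have "closedin (top_of_set {0..1::real}) {0..1}" using closedin_topspace[of "top_of_set {0..1::real}"] by simp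
    then show "closedin ?Z ({0..1} \<times> D u)"
      using closedD[of u] closedin_prod_Times_iff by blast
    have "continuous_on unit_square (\<lambda>p. depth u (X p u))"
      unfolding depth_def using contX by (cases "u = []") (auto intro!: continuous_intros)
    then have "continuous_on ({0..1} \<times> unit_square) (\<lambda>q. min (fst q * L) (depth u (X (snd q) u)))"
      by (intro continuous_intros continuous_on_compose2[where f = snd and s = "{0..1} \<times> unit_square"
          and g = "\<lambda>p. depth u (X p u)"]) auto
    then have "continuous_map ?Z euclideanreal (\<lambda>q. min (fst q * L) (depth u (X (snd q) u)))"
      by (simp only: prod_topology_subtopology_eu continuous_map_iff_continuous)
    moreover have "continuous_map euclideanreal space (tree_path u)"
      using continuous_map_tree_path u unfolding U_def by blast
    ultimately have "continuous_map ?Z space (tree_path u \<circ> (\<lambda>q. min (fst q * L) (depth u (X (snd q) u))))"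
      by (rule continuous_map_compose)
    then have "continuous_map ?Z space (h u)" unfolding h_def o_def .
    then show "continuous_map (subtopology ?Z ({0..1} \<times> D u)) space (h u)"
      by (rule continuous_map_from_subtopology)
  next
    fix u u' q assume "q \<in> topspace ?Z \<inter> {0..1} \<times> D u \<inter> {0..1} \<times> D u'"
    then show "h u q = h u' q" using agree[of "fst q" "snd q" u u'] by (cases q) auto
  next
    fix q assume "q \<in> topspace ?Z"
    then have "snd q \<in> unit_square" "fst q \<in> {0..1}" by auto
    then show "\<exists>u. u \<in> U \<and> q \<in> {0..1} \<times> D u \<and> H q = h u q"
      using pick[of "snd q"] unfolding H_def by (intro exI[of _ "pick (snd q)"]) (cases q, auto)
  qed
  have dep: "0 \<le> depth u (X p u) \<and> depth u (X p u) \<le> real (length u)" if "p \<in> unit_square" for u p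
    using range[OF that, of u] by (cases u) (auto simp: depth_def)
  have H0: "H (0, p) = Pt0" if p: "p \<in> unit_square" for p
    using dep[OF p, of "pick p"] unfolding H_def h_def by (simp add: min_absorb1 tree_path_0)
  have H1: "H (1, p) = f p" if p: "p \<in> unit_square" for p
  proof -
    have "depth (pick p) (X p (pick p)) \<le> L"
      using dep[OF p, of "pick p"] L[OF pick(1)[OF p]] by linarith
    then show ?thesis using pick(3)[OF p] unfolding H_def h_def by (simp add: min_absorb2)
  qed
  have Hf: "H (s, p) = Pt0" if p: "p \<in> frontier unit_square" and s: "0 \<le> s" for s p
  proof -
    have sq: "p \<in> unit_square" using p frontier_unit_square_iff by blast
    have "X p = tree_point [] 1" by (rule lift_frontier[OF X X0 p])
    then have "X p = tree_point [] (X p [])" by (metis tree_point_self)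
    then have "p \<in> D []" using sq unfolding D_def by blast
    then have "H (s, p) = h [] (s, p)"
      unfolding H_def snd_conv by (intro agree) (use s pick[OF sq] in auto)
    then show ?thesis by (simp add: h_def)
  qed
  have "homotopic_with (\<lambda>h. \<forall>p\<in>frontier unit_square. h p = Pt0) (top_of_set unit_square) space (\<lambda>_. Pt0) f"
  proof (subst homotopic_with)
    show "(\<forall>p\<in>frontier unit_square. h p = Pt0) = (\<forall>p\<in>frontier unit_square. k p = Pt0)"
      if "\<And>x. x \<in> topspace (top_of_set unit_square) \<Longrightarrow> h x = k x" for h k :: "real \<times> real \<Rightarrow> ('v, 'e) cell_point"
      using that frontier_unit_square_iff by auto
    show "\<exists>h. continuous_map ?Z space h \<and> (\<forall>x\<in>topspace (top_of_set unit_square). h (0, x) = Pt0) \<and>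
      (\<forall>x\<in>topspace (top_of_set unit_square). h (1, x) = f x) \<and>
      (\<forall>t\<in>{0..1}. \<forall>p\<in>frontier unit_square. h (t, p) = Pt0)"
      using contH H0 H1 Hf by (intro exI[of _ H]) auto
  qed
  then show ?thesis by (rule homotopic_with_symD)
qed

end

section \<open>Spheroids: lifting, collapsing and contracting\<close>

lemma (in extremal_lot) spheroid_null_homotopic:
  assumes f: "f \<in> spheroids space Pt0"
  shows "(f, \<lambda>_. Pt0) \<in> spheroid_homotopy space Pt0"
proof -
  let ?Z = "top_of_set (unit_square :: (real \<times> real) set)"
  let ?F = "frontier unit_square :: (real \<times> real) set"
  have contf: "continuous_map ?Z space f" and bf: "\<And>p. p \<in> ?F \<Longrightarrow> f p = Pt0"
    using f unfolding spheroids_def by auto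
  have sub: "?F \<subseteq> unit_square" using frontier_unit_square_iff by blast
  have "continuous_map ?Z euclidean (circle_map \<circ> f)"
    by (rule continuous_map_compose[OF contf continuous_map_circle_map])
  then have "continuous_on unit_square (\<lambda>p. circle_map (f p))" by (simp add: o_def)
  moreover have unit: "norm (circle_map x) = 1" for x :: "('a, 'b) cell_point" by (cases x) auto
  then have "circle_map (f p) \<noteq> 0" for p by (metis norm_zero zero_neq_one)
  moreover have "contractible (unit_square :: (real \<times> real) set)"
    by (intro convex_imp_contractible convex_Times) auto
  \<comment> \<open>The square is contractible, so the circle-valued function has a continuous
    logarithm. Its imaginary part, divided by \<open>2 * pi\<close>, is the real coordinate of the
    lift.\<close>
  ultimately obtain g where g: "continuous_on unit_square g" "\<And>p. p \<in> unit_square \<Longrightarrow> circle_map (f p) = exp (g p)"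
    by (metis continuous_logarithm_on_contractible)
  define \<theta> where "\<theta> p = Im (g p) / (2 * pi)" for p
  have \<theta>: "circle_map (f p) = cis (2 * pi * \<theta> p)" if p: "p \<in> unit_square" for p
  proof -
    have "exp (Re (g p)) = 1" using unit[of "f p"] g(2)[OF p] by simp
    then have "Re (g p) = 0" by simp
    then show ?thesis using g(2)[OF p] by (simp add: exp_eq_polar \<theta>_def)
  qed
  have cont\<theta>: "continuous_on unit_square \<theta>"
    unfolding \<theta>_def using g(1) by (intro continuous_intros) auto
  have int: "\<exists>n::int. \<theta> p = of_int n" if p: "p \<in> unit_square" "f p = Pt0" for p
  proof -
    have "cis (2 * pi * \<theta> p) = cis (2 * pi * 0)" using \<theta>[OF p(1)] p(2) by simp
    then show ?thesis by (rule cis_2pi_eq_imp) auto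
  qed
  have o: "(0, 0) \<in> ?F" unfolding frontier_unit_square_iff by simp
  obtain k0 :: int where k0: "\<theta> (0, 0) = of_int k0" using int[of "(0, 0)"] bf[OF o] o sub by blast
  \<comment> \<open>On the connected frontier \<theta> takes only integer values; two different ones
    would force the value \<open>m + 1 / 2\<close> in between.\<close>
  have b\<theta>: "\<theta> p = of_int k0" if p: "p \<in> ?F" for p
  proof (rule ccontr)
    assume ne: "\<theta> p \<noteq> of_int k0"
    obtain n :: int where n: "\<theta> p = of_int n" using int bf[OF p] p sub by blast
    have con: "Topological_Spaces.connected (\<theta> ` ?F)"
      by (rule connected_continuous_image[OF continuous_on_subset[OF cont\<theta> sub] connected_frontier_unit_square])
    have vals: "of_int n \<in> \<theta> ` ?F" "of_int k0 \<in> \<theta> ` ?F" using p o n k0 by (metis imageI)+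
    define m where "m = min n k0"
    have "{real_of_int m..real_of_int (max n k0)} \<subseteq> \<theta> ` ?F"
      using connected_contains_Icc[OF con] vals unfolding m_def by (simp add: min_def max_def)
    moreover have "real_of_int m + 1 / 2 \<in> {real_of_int m..real_of_int (max n k0)}"
    proof -
      have "m + 1 \<le> max n k0" using ne n unfolding m_def by auto
      then have "real_of_int m + 1 \<le> real_of_int (max n k0)" by linarith
      then show ?thesis by simp
    qed
    ultimately have "real_of_int m + 1 / 2 \<in> \<theta> ` ?F" by (rule subsetD)
    then have "\<exists>q\<in>?F. real_of_int m + 1 / 2 = \<theta> q" by (simp only: image_iff)
    then obtain q where q: "q \<in> ?F" "real_of_int m + 1 / 2 = \<theta> q" by blast
    obtain i :: int where "\<theta> q = of_int i" using int bf[OF q(1)] q(1) sub by blast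
    then have "real_of_int (2 * (i - m)) = real_of_int 1" using q(2) by simp
    then have "2 * (i - m) = 1" by (simp only: of_int_eq_iff)
    then show False by presburger
  qed
  define F where "F p = (f p, \<theta> p)" for p
  have contF: "continuous_map ?Z cover F"
    unfolding continuous_map_pairwise o_def F_def fst_conv snd_conv using contf cont\<theta> by simp
  have "compact (\<theta> ` unit_square)"
    by (rule compact_continuous_image[OF cont\<theta>]) (simp add: compact_Times)
  then obtain B where B: "\<And>p. p \<in> unit_square \<Longrightarrow> \<bar>\<theta> p\<bar> \<le> B"
    using compact_imp_bounded[of "\<theta> ` unit_square"] unfolding bounded_iff by (metis imageI real_norm_def)
  \<comment> \<open>The level of a cell through a point is \<theta> minus the height inside the
    cell, which is at most \<open>2\<close>.\<close>
  define N where "N = \<lceil>B\<rceil> + 2"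
  have N: "\<bar>n\<bar> \<le> N" if "p \<in> unit_square" "\<theta> p = of_int n + s" "0 \<le> s" "s \<le> 2" for p n s
  proof -
    have "\<bar>real_of_int n\<bar> \<le> B + 2" using B[OF that(1)] that(2-4) by linarith
    then show ?thesis unfolding N_def by linarith
  qed
  define C where "C = arcs G \<times> {-N..N}"
  \<comment> \<open>A cell at level \<open>k\<close> has sides at levels \<open>k\<close> and
    \<open>k + 1\<close>, hence the extra level at the upper end.\<close>
  define E where "E = verts G \<times> {-N..N + 1}"
  have range: "F p \<in> body G l C E N" if p: "p \<in> unit_square" for p
  proof (cases "f p")
    case Pt0
    obtain n :: int where n: "\<theta> p = of_int n" using int[OF p Pt0] by blast
    then have "n \<in> {-N..N}" using N[OF p, of n 0] by auto
    then show ?thesis unfolding body_def F_def Pt0 n by (intro UnI2 imageI)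
  next
    case (Pt1 g t)
    have pt: "f p \<in> complex_points pres"
      using contf p unfolding continuous_map_def topspace_standard_complex[OF well_formed_pres] by auto
    then have gt: "g \<in> verts G" "0 < t" "t < 1" unfolding Pt1 complex_points_def by auto
    have "cis (2 * pi * \<theta> p) = cis (2 * pi * t)" using \<theta>[OF p] Pt1 by simp
    then obtain n where n: "\<theta> p = t + of_int n" by (rule cis_2pi_eq_imp)
    then have "\<bar>n\<bar> \<le> N" using N[OF p, of n t] gt by simp
    then have mem: "(g, n) \<in> E" unfolding E_def using gt by auto
    have "F p = edge_map (g, n) t" using gt n unfolding F_def Pt1 edge_map_def by simp
    moreover have "t \<in> {0..1}" using gt by simp
    ultimately have "F p \<in> edge_map (g, n) ` {0..1}" by (rule image_eqI)
    then show ?thesis unfolding body_def by (rule UnI1[OF UnI2[OF UN_I[OF mem]]])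
  next
    case (Pt2 e z)
    have pt: "f p \<in> complex_points pres"
      using contf p unfolding continuous_map_def topspace_standard_complex[OF well_formed_pres] by auto
    then have ez: "e \<in> arcs G" "norm z < 1" unfolding Pt2 complex_points_def by auto
    have "cis (2 * pi * \<theta> p) = cis (2 * pi * height z)" using \<theta>[OF p] Pt2 by simp
    then obtain n where n: "\<theta> p = height z + of_int n" by (rule cis_2pi_eq_imp)
    then have "\<bar>n\<bar> \<le> N" using N[OF p, of n "height z"] height_range[of z] ez by simp
    then have mem: "(e, n) \<in> C" unfolding C_def using ez by auto
    have "F p = cell_map G l (e, n) z" using ez n unfolding F_def Pt2 cell_map_def char_map2_def by simp
    moreover have "z \<in> cball 0 1" using ez by simp
    ultimately have "F p \<in> cell_map G l (e, n) ` cball 0 1" by (rule image_eqI)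
    then show ?thesis unfolding body_def by (rule UnI1[OF UnI1[OF UN_I[OF mem]]])
  qed
  have k0N: "\<bar>k0\<bar> \<le> N" using N[of "(0, 0)" k0 0] k0 o sub by simp
  have "\<exists>F' E'. fst ` E' \<subseteq> verts G \<and> F' ` topspace ?Z \<subseteq> body G l {} E' N \<and>
    homotopic_with (\<lambda>h. \<forall>p\<in>?F. h p = (Pt0, real_of_int k0)) ?Z cover F F'"
  proof (rule collapse_to_graph[of C E])
    show "finite C" "finite E" unfolding C_def E_def by auto
    show "fst ` C \<subseteq> arcs G" "fst ` E \<subseteq> verts G" unfolding C_def E_def by auto
    show "cell_edges G l c \<subseteq> E" if "c \<in> C" for c
      using that label_in_verts unfolding C_def E_def cell_edges_def by (cases c) auto
    show "continuous_map ?Z cover F" by (rule contF)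
    show "F ` topspace ?Z \<subseteq> body G l C E N" using range by auto
    show "?F \<subseteq> topspace ?Z" using sub by simp
    show "F p = (Pt0, real_of_int k0)" if "p \<in> ?F" for p using bf b\<theta> that unfolding F_def by simp
    show "\<bar>k0\<bar> \<le> N" by (rule k0N)
  qed
  then obtain F' E' where E': "fst ` E' \<subseteq> verts G" and F': "F' ` topspace ?Z \<subseteq> body G l {} E' N"
    and hom: "homotopic_with (\<lambda>h. \<forall>p\<in>?F. h p = (Pt0, real_of_int k0)) ?Z cover F F'"
    by blast
  have contF': "continuous_map ?Z cover F'" using homotopic_with_imp_continuous_maps[OF hom] by blast
  have bF': "F' p = (Pt0, real_of_int k0)" if "p \<in> ?F" for p
    using homotopic_with_imp_property[OF hom] that by blast
  interpret gm: graph_map G l "fst \<circ> F'" "snd \<circ> F'" k0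
  proof
    show "continuous_map ?Z space (fst \<circ> F')" by (rule continuous_map_compose[OF contF' continuous_map_fst])
    have "continuous_map ?Z euclideanreal (snd \<circ> F')" by (rule continuous_map_compose[OF contF' continuous_map_snd])
    then show "continuous_on unit_square (snd \<circ> F')" by simp
    show "(fst \<circ> F') p = Pt0 \<and> (snd \<circ> F') p = real_of_int k0" if "p \<in> ?F" for p
      using bF'[OF that] by simp
    fix p :: "real \<times> real" assume p: "p \<in> unit_square"
    have "F' p \<in> body G l {} E' N" using F' p by auto
    then consider \<epsilon> t where "\<epsilon> \<in> E'" "t \<in> {0..1}" "F' p = edge_map \<epsilon> t" | k where "F' p = (Pt0, real_of_int k)"
      unfolding body_def by blast
    then show "(fst \<circ> F') p = Pt0 \<and> (snd \<circ> F') p \<in> \<int> \<or>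
      (\<exists>g\<in>verts G. \<exists>s n. 0 < s \<and> s < 1 \<and> (fst \<circ> F') p = Pt1 g s \<and> (snd \<circ> F') p = of_int n + s)"
    proof cases
      case (1 \<epsilon> t)
      consider "t = 0" | "t = 1" | "0 < t" "t < 1" using 1(2) by fastforce
      then show ?thesis
      proof cases
        case 3
        moreover have "fst \<epsilon> \<in> verts G" using 1(1) E' by auto
        ultimately show ?thesis unfolding o_def 1(3) edge_map_interior[OF 3] by auto
      qed (auto simp: 1(3) edge_map_def)
    next
      case 2
      then show ?thesis by simp
    qed
  qed
  \<comment> \<open>Projecting the collapse to the first factor leaves a map into the 1-skeleton of
    the complex, to which the contraction applies.\<close>
  have "homotopic_with (\<lambda>h. \<forall>p\<in>?F. h p = Pt0) ?Z space (fst \<circ> F) (fst \<circ> F')"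
    by (rule homotopic_with_compose_continuous_map_left[OF hom continuous_map_fst]) auto
  moreover have "fst \<circ> F = f" unfolding F_def by auto
  ultimately have "homotopic_with (\<lambda>h. \<forall>p\<in>?F. h p = Pt0) ?Z space f (\<lambda>_. Pt0)"
    using homotopic_with_trans[OF _ gm.null_homotopic] by simp
  moreover have "(\<lambda>_. Pt0) \<in> spheroids space Pt0"
    unfolding spheroids_def using Pt0_in_topspace by simp
  ultimately show ?thesis using f unfolding spheroid_homotopy_def by simp
qed

lemma trivial_pi2:
  assumes "x \<in> topspace X" and null: "\<And>f. f \<in> spheroids X x \<Longrightarrow> (f, \<lambda>_. x) \<in> spheroid_homotopy X x"
  shows "trivial_group (pi2 X x)"
proof -
  let ?R = "spheroid_homotopy X x" and ?S = "spheroids X x"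
  have const: "(\<lambda>_. x) \<in> ?S" unfolding spheroids_def using assms(1) by simp
  have sub: "?R `` A \<subseteq> ?S" for A unfolding spheroid_homotopy_def by auto
  have all: "(f, g) \<in> ?R" if "f \<in> ?S" "g \<in> ?S" for f g
    using null[OF that(1)] null[OF that(2)] homotopic_with_symD homotopic_with_trans
    unfolding spheroid_homotopy_def by blast
  then have cls: "?R `` {f} = ?S" if "f \<in> ?S" for f using sub that by blast
  then have car: "carrier (pi2 X x) = {?S}"
    unfolding pi2_def quotient_def using const by auto
  have one: "one (pi2 X x) = ?S" unfolding pi2_def using cls[OF const] by simp
  have join: "spheroid_join (\<lambda>_. x) (\<lambda>_. x) = (\<lambda>_. x)" by (auto simp: spheroid_join_def)
  have "(\<Union>f\<in>?S. \<Union>g\<in>?S. ?R `` {spheroid_join f g}) = ?S"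
  proof
    have "?S = ?R `` {spheroid_join (\<lambda>_. x) (\<lambda>_. x)}" using cls[OF const] join by simp
    then show "?S \<subseteq> (\<Union>f\<in>?S. \<Union>g\<in>?S. ?R `` {spheroid_join f g})" using const by blast
  qed (use sub in blast)
  then have mult: "mult (pi2 X x) ?S ?S = ?S" unfolding pi2_def by simp
  have "group (pi2 X x)"
    by (rule groupI) (auto simp: car one mult)
  then show ?thesis unfolding trivial_group_def car one by simp
qed

theorem (in extremal_lot) aspherical_log_presentation: "aspherical (log_presentation G l)"
  unfolding aspherical_def by (rule trivial_pi2[OF Pt0_in_topspace spheroid_null_homotopic])

theorem theorem1p2:
  shows "(\<forall>(G :: ('v, 'e) pre_digraph) l.
            labeled_oriented_graph G l \<and> interior_reduced G l \<and> Digraph_Component.connected G \<longrightarrow>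
            real (complexity G l) \<le> (real (card (verts G)) + 1) / 2)
       \<and> (\<forall>m :: nat. odd m \<longrightarrow>
            (\<exists>(G :: (nat, nat) pre_digraph) l.
               labeled_oriented_graph G l \<and> interior_reduced G l \<and> Digraph_Component.connected G \<and>
               card (verts G) = m \<and> real (complexity G l) = (real m + 1) / 2))
       \<and> (\<forall>(G :: ('v, 'e) pre_digraph) l.
            labeled_oriented_tree G l \<and> interior_reduced G l \<and>
            real (complexity G l) = (real (card (verts G)) + 1) / 2 \<longrightarrow>
            aspherical (log_presentation G l))"
proof (intro conjI allI impI)
  fix G :: "('v, 'e) pre_digraph" and l
  assume G: "labeled_oriented_graph G l \<and> interior_reduced G l \<and> Digraph_Component.connected G"
  then have "2 * complexity G l \<le> card (verts G) + 1"
    using labeled_oriented_graph.complexity_upper_bound by blast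
  then have "real (2 * complexity G l) \<le> real (card (verts G) + 1)" by (simp only: of_nat_le_iff)
  then show "real (complexity G l) \<le> (real (card (verts G)) + 1) / 2" by simp
next
  fix m :: nat assume "odd m"
  then obtain n where m: "m = 2 * n + 1" by (rule oddE)
  show "\<exists>(G :: (nat, nat) pre_digraph) l.
      labeled_oriented_graph G l \<and> interior_reduced G l \<and> Digraph_Component.connected G \<and>
      card (verts G) = m \<and> real (complexity G l) = (real m + 1) / 2"
    by (intro exI[of _ "star_graph n"] exI[of _ star_label])
      (simp add: star_labeled_oriented_graph star_interior_reduced star_connected star_complexity m)
next
  fix G :: "('v, 'e) pre_digraph" and l
  assume G: "labeled_oriented_tree G l \<and> interior_reduced G l \<and>
    real (complexity G l) = (real (card (verts G)) + 1) / 2"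
  then have lot: "labeled_oriented_tree G l" and ir: "interior_reduced G l" by simp_all
  have tree: "undirected_tree G" by (rule labeled_oriented_tree.tree[OF lot])
  then have con: "Digraph_Component.connected G" unfolding undirected_tree_def by simp
  have "real (2 * complexity G l) = real (card (verts G) + 1)" using G by simp
  then have "2 * complexity G l = card (verts G) + 1" by (simp only: of_nat_eq_iff)
  then have "extremal_lot G l"
    using labeled_oriented_tree.axioms(1)[OF lot] ir con tree
    by (intro extremal_lot.intro extremal_log.intro extremal_log_axioms.intro extremal_lot_axioms.intro)
  then show "aspherical (log_presentation G l)"
    by (rule extremal_lot.aspherical_log_presentation)
qed

end
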